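(* Assume $n=2t$ is even and let $\mathbb{L}'$ be the subfield with $\mathbb{K}\le\mathbb{L}'<\mathbb{L}$ and $[\mathbb{L}:\mathbb{L}']=2$. Let $F(y)\in\mathbb{K}[y]$ be monic irreducible of degree $s$, $F(y)\ne y$, $m$ the number of irreducible factors of $F(x^n)$ in $R$, $\ell=n/m$, and $f$ a monic irreducible factor of $F(x^n)$ with $f\notin Z(R)$. Let $k<m$ be a positive integer. For every $\gamma\in\mathbb{L}\setminus\mathbb{L}'$ such that $(-1)^{sk\ell}F_0^{k\ell}\mathrm{N}_{\mathbb{L}/\mathbb{K}}(\gamma)$ is not a square in $\mathbb{K}$ ($F_0$ the constant coefficient of $F(x^n)$), the set $$D_{n,s\ell,k}(\gamma,F)=\Big\{a_0'+\sum_{i=1}^{sk\ell-1}a_ix^i+\gamma a_0''x^{sk\ell}+RF(x^n): a_i\in\mathbb{L},\ a_0',a_0''\in\mathbb{L}'\Big\}$$ is a $\mathbb{K}$-linear MRD code in $R/RF(x^n)\cong M_m(\mathcal{E}(f))$ with minimum distance $m-k+1$.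
   Context: $\mathbb{K}$ is a field, $\mathbb{L}/\mathbb{K}$ cyclic Galois of degree $n$, $\sigma$ a generator of $\mathrm{Gal}(\mathbb{L}/\mathbb{K})$, $R=\mathbb{L}[x;\sigma]$ with $xa=\sigma(a)x$, $Z(R)=\mathbb{K}[x^n]$. The eigenring $\mathcal{E}(f)=\{g\in R:\deg g<\deg f,\ fg\in Rf\}$ is a central division algebra of degree $\ell$ over $E_F\cong\mathbb{K}[y]/(F)$, and $R/RF(x^n)\cong M_m(\mathcal{E}(f))$ via left multiplication on the $m$-dimensional right $\mathcal{E}(f)$-space $R/Rf$. The rank of $a\in R/RF(x^n)$ is the rank of its matrix, equivalently $m-\frac1{s\ell}\deg\mathrm{gcrd}(a,F(x^n))$; minimum distance is the least rank of a nonzero element. A $\mathbb{K}$-linear code $C\subseteq M_m(D)$ with minimum distance $d$ satisfies $\dim_{\mathbb{K}}C\le m(m-d+1)[D:\mathbb{K}]$, and it is MRD if equality holds. *)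

theory Defs
  imports
    "HOL-Algebra.Algebraic_Closure_Type"
    "HOL-Computational_Algebra.Polynomial"
begin

section \<open>Cyclic Galois extensions\<close>

text \<open>The big field is a type \<open>'a\<close> of class \<open>field\<close>; its subfields are
  \<open>subfield K (ring_of_type_algebra :: 'a ring)\<close>.\<close>

definition Gal :: "'a::field set \<Rightarrow> ('a \<Rightarrow> 'a) set" where
  "Gal K = {\<tau> \<in> ring_iso (ring_of_type_algebra :: 'a ring) (ring_of_type_algebra :: 'a ring).
              \<forall>c\<in>K. \<tau> c = c}"

definition galois_extension :: "'a::field set \<Rightarrow> nat \<Rightarrow> bool" where
  "galois_extension K n \<longleftrightarrow>
     subfield K (ring_of_type_algebra :: 'a ring) \<and>
     ring.dimension (ring_of_type_algebra :: 'a ring) n K UNIV \<and>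
     {a. \<forall>\<tau>\<in>Gal K. \<tau> a = a} = K"

text \<open>The Galois group is finite here, so it suffices to take powers with natural exponents.\<close>

definition cyclic_galois_extension :: "'a::field set \<Rightarrow> nat \<Rightarrow> ('a \<Rightarrow> 'a) \<Rightarrow> bool" where
  "cyclic_galois_extension K n \<sigma> \<longleftrightarrow>
     galois_extension K n \<and> \<sigma> \<in> Gal K \<and> Gal K = range (\<lambda>i::nat. \<sigma> ^^ i)"

definition field_norm :: "'a::field set \<Rightarrow> 'a \<Rightarrow> 'a" where
  "field_norm K a = (\<Prod>\<tau>\<in>Gal K. \<tau> a)"

text \<open>The polynomial ring \<open>K[y]\<close> over a subset \<open>K\<close> of the field type.\<close>

definition poly_ring_over :: "'a::field set \<Rightarrow> 'a poly ring" where
  "poly_ring_over K =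
     (ring_of_type_algebra :: 'a poly ring)\<lparr>carrier := {p. \<forall>i. Polynomial.coeff p i \<in> K}\<rparr>"


section \<open>The skew polynomial ring\<close>

text \<open>A skew polynomial is stored as the ordinary polynomial with the same left coefficients;
  only the multiplication is twisted, by \<open>x a = \<sigma>(a) x\<close>.  Hence \<open>F(x^n)\<close>, whose coefficients
  stand to the left of powers of \<open>x\<close>, is the ordinary composition.\<close>

definition skew_mult :: "('a::field \<Rightarrow> 'a) \<Rightarrow> 'a poly \<Rightarrow> 'a poly \<Rightarrow> 'a poly" where
  "skew_mult \<sigma> f g =
     (\<Sum>i\<le>Polynomial.degree f. \<Sum>j\<le>Polynomial.degree g.
        Polynomial.monom (Polynomial.coeff f i * (\<sigma> ^^ i) (Polynomial.coeff g j)) (i + j))"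

definition skew_poly_ring :: "('a::field \<Rightarrow> 'a) \<Rightarrow> 'a poly ring" where
  "skew_poly_ring \<sigma> =
     \<lparr>carrier = UNIV, monoid.mult = skew_mult \<sigma>, one = 1, ring.zero = 0, add = (+)\<rparr>"

definition poly_in_xn :: "'a::field poly \<Rightarrow> nat \<Rightarrow> 'a poly" where
  "poly_in_xn F n = pcompose F (Polynomial.monom 1 n)"

definition ring_center :: "('a, 'b) ring_scheme \<Rightarrow> 'a set" where
  "ring_center R = {z \<in> carrier R. \<forall>a\<in>carrier R. z \<otimes>\<^bsub>R\<^esub> a = a \<otimes>\<^bsub>R\<^esub> z}"

definition has_irreducible_factorization ::
    "('a, 'b) ring_scheme \<Rightarrow> 'a \<Rightarrow> nat \<Rightarrow> bool" where
  "has_irreducible_factorization R a m \<longleftrightarrow>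
     (\<exists>gs. length gs = m \<and> (\<forall>g\<in>set gs. g \<in> carrier R \<and> ring_irreducible\<^bsub>R\<^esub> g) \<and>
           foldr (\<otimes>\<^bsub>R\<^esub>) gs \<one>\<^bsub>R\<^esub> = a)"

text \<open>\<open>PIdl\<^bsub>R\<^esub> f\<close> is the left ideal \<open>R f\<close>; the remainder below is that of right division by \<open>f\<close>.\<close>

definition skew_rem :: "('a::field \<Rightarrow> 'a) \<Rightarrow> 'a poly \<Rightarrow> 'a poly \<Rightarrow> 'a poly" where
  "skew_rem \<sigma> a f =
     (THE r. Polynomial.degree r < Polynomial.degree f \<and> a - r \<in> PIdl\<^bsub>skew_poly_ring \<sigma>\<^esub> f)"

definition eigenring :: "('a::field \<Rightarrow> 'a) \<Rightarrow> 'a poly \<Rightarrow> 'a poly ring" where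
  "eigenring \<sigma> f =
     \<lparr>carrier = {g. Polynomial.degree g < Polynomial.degree f \<and>
                    f \<otimes>\<^bsub>skew_poly_ring \<sigma>\<^esub> g \<in> PIdl\<^bsub>skew_poly_ring \<sigma>\<^esub> f},
      monoid.mult = (\<lambda>g h. skew_rem \<sigma> (g \<otimes>\<^bsub>skew_poly_ring \<sigma>\<^esub> h) f),
      one = 1, ring.zero = 0, add = (+)\<rparr>"


section \<open>Rank-metric codes of square matrices over a (possibly noncommutative) ring\<close>

definition mat_ring :: "('e, 'b) ring_scheme \<Rightarrow> nat \<Rightarrow> (nat \<Rightarrow> nat \<Rightarrow> 'e) ring" where
  "mat_ring D m =
     \<lparr>carrier = {A. \<forall>i j. if i < m \<and> j < m then A i j \<in> carrier D else A i j = \<zero>\<^bsub>D\<^esub>},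
      monoid.mult = (\<lambda>A B i j. if i < m \<and> j < m
                               then (\<Oplus>\<^bsub>D\<^esub>k\<in>{..<m}. A i k \<otimes>\<^bsub>D\<^esub> B k j) else \<zero>\<^bsub>D\<^esub>),
      one = (\<lambda>i j. if i < m \<and> j < m \<and> i = j then \<one>\<^bsub>D\<^esub> else \<zero>\<^bsub>D\<^esub>),
      ring.zero = (\<lambda>i j. \<zero>\<^bsub>D\<^esub>),
      add = (\<lambda>A B i j. A i j \<oplus>\<^bsub>D\<^esub> B i j)\<rparr>"

definition scalar_mat :: "('e, 'b) ring_scheme \<Rightarrow> nat \<Rightarrow> 'e \<Rightarrow> nat \<Rightarrow> nat \<Rightarrow> 'e" where
  "scalar_mat D m c = (\<lambda>i j. if i < m \<and> j < m \<and> i = j then c else \<zero>\<^bsub>D\<^esub>)"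

text \<open>The rank is the maximal number of columns that are independent in the right space \<open>D^m\<close>.\<close>

definition columns_independent ::
    "('e, 'b) ring_scheme \<Rightarrow> nat \<Rightarrow> (nat \<Rightarrow> nat \<Rightarrow> 'e) \<Rightarrow> nat set \<Rightarrow> bool" where
  "columns_independent D m A J \<longleftrightarrow>
     (\<forall>c \<in> J \<rightarrow> carrier D.
        (\<forall>i<m. (\<Oplus>\<^bsub>D\<^esub>j\<in>J. A i j \<otimes>\<^bsub>D\<^esub> c j) = \<zero>\<^bsub>D\<^esub>) \<longrightarrow> (\<forall>j\<in>J. c j = \<zero>\<^bsub>D\<^esub>))"

definition mat_rank :: "('e, 'b) ring_scheme \<Rightarrow> nat \<Rightarrow> (nat \<Rightarrow> nat \<Rightarrow> 'e) \<Rightarrow> nat" where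
  "mat_rank D m A = Max (card ` {J. J \<subseteq> {..<m} \<and> columns_independent D m A J})"

definition has_min_distance ::
    "('e, 'b) ring_scheme \<Rightarrow> nat \<Rightarrow> (nat \<Rightarrow> nat \<Rightarrow> 'e) set \<Rightarrow> nat \<Rightarrow> bool" where
  "has_min_distance D m C d \<longleftrightarrow>
     (\<exists>A \<in> C - {\<zero>\<^bsub>mat_ring D m\<^esub>}. mat_rank D m A = d) \<and>
     (\<forall>A \<in> C - {\<zero>\<^bsub>mat_ring D m\<^esub>}. d \<le> mat_rank D m A)"

text \<open>\<open>subalgebra\<close> is the library's name for a linear subspace.  The field \<open>K\<close> lies in \<open>D\<close>
  and acts on matrices through scalar matrices.\<close>

definition linear_MRD_code ::
    "'e set \<Rightarrow> ('e, 'b) ring_scheme \<Rightarrow> nat \<Rightarrow> nat \<Rightarrow> (nat \<Rightarrow> nat \<Rightarrow> 'e) set \<Rightarrow> bool" where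
  "linear_MRD_code K D m d C \<longleftrightarrow>
     C \<subseteq> carrier (mat_ring D m) \<and>
     subalgebra (scalar_mat D m ` K) C (mat_ring D m) \<and>
     has_min_distance D m C d \<and>
     (\<exists>e. ring.dimension D e K (carrier D) \<and>
          ring.dimension (mat_ring D m) (m * (m - d + 1) * e) (scalar_mat D m ` K) C)"


section \<open>The quotient ring and its matrix representation\<close>

definition skew_quotient :: "('a::field \<Rightarrow> 'a) \<Rightarrow> 'a poly \<Rightarrow> 'a poly set ring" where
  "skew_quotient \<sigma> H = skew_poly_ring \<sigma> Quot (PIdl\<^bsub>skew_poly_ring \<sigma>\<^esub> H)"

definition skew_class :: "('a::field \<Rightarrow> 'a) \<Rightarrow> 'a poly \<Rightarrow> 'a poly \<Rightarrow> 'a poly set" where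
  "skew_class \<sigma> H a = PIdl\<^bsub>skew_poly_ring \<sigma>\<^esub> H +>\<^bsub>skew_poly_ring \<sigma>\<^esub> a"

text \<open>Elements of the right \<open>\<E>(f)\<close>-space \<open>R/Rf\<close>, with action \<open>(g + Rf) e = g e + Rf\<close>, are given by
  representatives: \<open>v 0, \<dots>, v (m - 1)\<close> represent a basis iff every class has unique
  coordinates.\<close>

definition right_basis :: "('a::field \<Rightarrow> 'a) \<Rightarrow> 'a poly \<Rightarrow> nat \<Rightarrow> (nat \<Rightarrow> 'a poly) \<Rightarrow> bool" where
  "right_basis \<sigma> f m v \<longleftrightarrow>
     (\<forall>g. \<exists>!c. c \<in> {..<m} \<rightarrow>\<^sub>E carrier (eigenring \<sigma> f) \<and>
        g - (\<Sum>i<m. v i \<otimes>\<^bsub>skew_poly_ring \<sigma>\<^esub> c i) \<in> PIdl\<^bsub>skew_poly_ring \<sigma>\<^esub> f)"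

text \<open>The matrix, with respect to such a basis, of left multiplication on \<open>R/Rf\<close> by an element
  \<open>u\<close> of the quotient ring: its \<open>j\<close>-th column holds the coordinates of \<open>a v_j\<close> for \<open>a \<in> u\<close>.\<close>

definition left_mult_matrix ::
    "('a::field \<Rightarrow> 'a) \<Rightarrow> 'a poly \<Rightarrow> nat \<Rightarrow> (nat \<Rightarrow> 'a poly) \<Rightarrow> 'a poly set
       \<Rightarrow> nat \<Rightarrow> nat \<Rightarrow> 'a poly" where
  "left_mult_matrix \<sigma> f m v u =
     (THE A. A \<in> carrier (mat_ring (eigenring \<sigma> f) m) \<and>
        (\<forall>a\<in>u. \<forall>j<m. a \<otimes>\<^bsub>skew_poly_ring \<sigma>\<^esub> v j - (\<Sum>i<m. v i \<otimes>\<^bsub>skew_poly_ring \<sigma>\<^esub> A i j)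
                        \<in> PIdl\<^bsub>skew_poly_ring \<sigma>\<^esub> f))"


section \<open>The code\<close>

text \<open>Here \<open>N\<close> plays the role of the exponent \<open>s k \<ell>\<close>.\<close>

definition code_polys :: "'a::field set \<Rightarrow> 'a \<Rightarrow> nat \<Rightarrow> 'a poly set" where
  "code_polys L' \<gamma> N =
     {Polynomial.monom a0 0 + (\<Sum>i=1..<N. Polynomial.monom (a i) i) + Polynomial.monom (\<gamma> * b0) N
        | a0 a b0. a0 \<in> L' \<and> b0 \<in> L'}"

definition code_D ::
    "('a::field \<Rightarrow> 'a) \<Rightarrow> 'a set \<Rightarrow> nat \<Rightarrow> nat \<Rightarrow> nat \<Rightarrow> 'a \<Rightarrow> 'a poly \<Rightarrow> 'a poly set set" where
  "code_D \<sigma> L' n l k \<gamma> F =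
     skew_class \<sigma> (poly_in_xn F n) ` code_polys L' \<gamma> (Polynomial.degree F * k * l)"

end

theory Submission
  imports Defs "Jordan_Normal_Form.Char_Poly"
begin

text \<open>
  Write \<open>H = F(x\<^sup>n)\<close>, a central element of \<open>R\<close>.  The left module \<open>R/Rf\<close> is simple, and an inductive
  form of the density theorem shows that \<open>j\<close> elements which are independent over the eigenring have
  an annihilator \<open>Rg\<close> with \<open>deg g = j deg f\<close>.  Since the two-sided ideals containing \<open>H\<close> are trivial,
  this makes \<open>R/RH\<close> the full matrix ring, and it shows that \<open>a\<close> of rank \<open>r\<close> satisfies
  \<open>(m - r) deg f \<le> deg a\<close>, with equality only if \<open>a\<close> divides \<open>H\<close> from the right.

  A codeword has degree at most \<open>k deg f\<close>, so only the case of equality has to be excluded.  Left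
  multiplication by \<open>x\<^sup>n\<close> on \<open>R/Ra\<close> is \<open>L\<close>-linear; its matrix is the product of the conjugates of the
  companion matrix of \<open>a\<close>, it is similar to its own conjugate, and \<open>F\<close> annihilates it.  So its
  characteristic polynomial lies in \<open>K[y]\<close> and is a power of \<open>F\<close>.  Comparing determinants gives
  \<open>N(a\<^sub>0) = (-1)\<^sup>d F\<^sub>0\<^sup>j\<close> for monic \<open>a\<close> of degree \<open>d = j deg F\<close>.  Norms of elements of \<open>L'\<close> are squares
  in \<open>K\<close>, so a codeword dividing \<open>H\<close> would contradict the condition on \<open>\<gamma>\<close>.  The same formula
  for \<open>a = f\<close> yields \<open>deg f = s l\<close>.
\<close>

text \<open>The eigenring is in general noncommutative, so ranks are never read off from
  determinants; the degree of the annihilator of an independent family, its size times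
  \<open>degree f\<close>, takes their place. Eigenring elements are handled as unreduced
  representatives in \<open>idealizer f\<close>, with \<open>rdvd f\<close> in the role of being
  zero, and are reduced only where matrices over \<open>eigenring\<close> appear. The constant and
  the top coefficient of a codeword contribute n/2 dimensions each, so the code has dimension
  \<open>n * N\<close> over \<open>K\<close>, as many as all polynomials of degree below
  \<open>N\<close>. The price is that degree \<open>N\<close> itself occurs, the one degree at which
  rank \<open>m - k\<close> is conceivable. A right divisor of \<open>H\<close> of that degree has a
  prescribed norm for the quotient of constant and leading coefficient, while in the code this norm
  is a square divided by the norm of \<gamma>; this is the origin of the condition on \<gamma>. The
  distance is attained by the annihilator of \<open>k - 1\<close> basis vectors, rescaled to
  constant coefficient 1. The order of \<sigma> and its action on \<open>L'\<close> are obtained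
  from the arguments of Dedekind and Artin.\<close>

section \<open>Linear systems, and coordinates over a subfield\<close>

text \<open>Gaussian elimination, by induction on the number of equations. The unknowns are indexed
  by an arbitrary finite set so that the pivot can simply be deleted from it.\<close>

lemma homogeneous_system_nontrivial:
  fixes A :: "nat \<Rightarrow> 'b \<Rightarrow> 'a::field"
  assumes "finite J" and "r < card J"
  shows "\<exists>c. (\<exists>j\<in>J. c j \<noteq> 0) \<and> (\<forall>i<r. (\<Sum>j\<in>J. A i j * c j) = 0)"
  using assms
proof (induction r arbitrary: J A)
  case 0
  then obtain j where "j \<in> J" by fastforce
  then show ?case by (intro exI[of _ "\<lambda>_. 1"]) auto
next
  case (Suc r)
  show ?case
  proof (cases "\<forall>j\<in>J. A r j = 0")
    case True
    obtain c where "\<exists>j\<in>J. c j \<noteq> 0" "\<forall>i<r. (\<Sum>j\<in>J. A i j * c j) = 0"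
      using Suc.IH[of J A] Suc.prems by auto
    moreover have "(\<Sum>j\<in>J. A r j * c j) = 0" using True by (intro sum.neutral) auto
    ultimately show ?thesis by (intro exI[of _ c]) (auto simp: less_Suc_eq)
  next
    case False
    then obtain p where p: "p \<in> J" "A r p \<noteq> 0" by auto
    \<comment> \<open>Each row minus the multiple of row \<open>r\<close> that clears column
      \<open>p\<close>.\<close>
    define B where "B i j = A i j - A i p * A r j / A r p" for i j
    have "r < card (J - {p})" using Suc.prems p by simp
    then obtain c where c: "\<exists>j\<in>J-{p}. c j \<noteq> 0" "\<forall>i<r. (\<Sum>j\<in>J-{p}. B i j * c j) = 0"
      using Suc.IH[of "J - {p}" B] Suc.prems by auto
    define x where "x = - (\<Sum>j\<in>J-{p}. A r j * c j) / A r p"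
    define c' where "c' = c(p := x)"
    have eq: "(\<Sum>j\<in>J. A i j * c' j) = A i p * x + (\<Sum>j\<in>J-{p}. A i j * c j)" for i
    proof -
      have "(\<Sum>j\<in>J-{p}. A i j * c' j) = (\<Sum>j\<in>J-{p}. A i j * c j)"
        by (intro sum.cong) (auto simp: c'_def)
      then show ?thesis using p Suc.prems by (simp add: sum.remove[of J p] c'_def)
    qed
    have "(\<Sum>j\<in>J. A i j * c' j) = 0" if "i < r" for i
    proof -
      have "0 = (\<Sum>j\<in>J-{p}. A i j * c j - (A i p / A r p) * (A r j * c j))"
        using c(2) that by (simp add: B_def algebra_simps)
      also have "\<dots> = (\<Sum>j\<in>J-{p}. A i j * c j) - (A i p / A r p) * (\<Sum>j\<in>J-{p}. A r j * c j)"
        by (simp add: sum_subtractf sum_distrib_left)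
      also have "\<dots> = (\<Sum>j\<in>J. A i j * c' j)" by (simp add: eq x_def)
      finally show ?thesis by simp
    qed
    moreover have "(\<Sum>j\<in>J. A r j * c' j) = 0" using p by (simp add: eq x_def)
    moreover have "\<exists>j\<in>J. c' j \<noteq> 0" using c(1) by (auto simp: c'_def)
    ultimately show ?thesis by (intro exI[of _ c']) (auto simp: less_Suc_eq)
  qed
qed

lemma ring_of_type_algebra_simps [simp]:
  "carrier (ring_of_type_algebra :: 'b::comm_ring_1 ring) = UNIV"
  "x \<otimes>\<^bsub>(ring_of_type_algebra :: 'b ring)\<^esub> y = x * y"
  "x \<oplus>\<^bsub>(ring_of_type_algebra :: 'b ring)\<^esub> y = x + y"
  "\<zero>\<^bsub>(ring_of_type_algebra :: 'b ring)\<^esub> = 0"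
  "\<one>\<^bsub>(ring_of_type_algebra :: 'b ring)\<^esub> = 1"
  by (simp_all add: ring_of_type_algebra_def)

lemma ring_of_type_algebra_a_inv [simp]:
  "\<ominus>\<^bsub>(ring_of_type_algebra :: 'b::comm_ring_1 ring)\<^esub> x = - x"
proof -
  interpret ring "ring_of_type_algebra :: 'b ring" by (rule ring_from_type_algebra)
  show ?thesis using add.inv_equality[of "-x" x] by simp
qed

lemma ring_of_type_algebra_inv:
  assumes "x \<noteq> 0"
  shows "inv\<^bsub>(ring_of_type_algebra :: 'b::field ring)\<^esub> x = inverse x"
proof -
  interpret field "ring_of_type_algebra :: 'b ring" by (rule field_from_type_algebra)
  show ?thesis using comm_inv_char[of x "inverse x"] assms by simp
qed

lemma subfield_type_closed:
  assumes "subfield K (ring_of_type_algebra :: 'a::field ring)"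
  shows "0 \<in> K" "1 \<in> K" "x \<in> K \<Longrightarrow> y \<in> K \<Longrightarrow> x + y \<in> K" "x \<in> K \<Longrightarrow> y \<in> K \<Longrightarrow> x * y \<in> K"
    "x \<in> K \<Longrightarrow> - x \<in> K" "x \<in> K \<Longrightarrow> y \<in> K \<Longrightarrow> x - y \<in> K" "x \<in> K \<Longrightarrow> inverse x \<in> K"
proof -
  interpret field "ring_of_type_algebra :: 'a ring" by (rule field_from_type_algebra)
  have s: "subring K (ring_of_type_algebra :: 'a ring)" by (rule subfieldE(1)[OF assms])
  show "0 \<in> K" "1 \<in> K" using subringE(2,3)[OF s] by simp_all
  show add: "x + y \<in> K" if "x \<in> K" "y \<in> K" for x y using subringE(7)[OF s that] by simp
  show "x * y \<in> K" if "x \<in> K" "y \<in> K" using subringE(6)[OF s that] by simp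
  show neg: "- x \<in> K" if "x \<in> K" for x using subringE(5)[OF s that] by simp
  show "x - y \<in> K" if "x \<in> K" "y \<in> K" using add[OF that(1) neg[OF that(2)]] by simp
  show "inverse x \<in> K" if "x \<in> K"
  proof (cases "x = 0")
    case True then show ?thesis using \<open>0 \<in> K\<close> by simp
  next
    case False
    then show ?thesis
      using subfield_m_inv(1)[OF assms, of x] that ring_of_type_algebra_inv[OF False] by simp
  qed
qed

text \<open>Each \<open>line_extension\<close> in the inductive \<open>dimension\<close> appends its
  vector as the last basis element; the sums over \<open>i<d\<close> are the form that linear
  systems need.\<close>

lemma dimension_has_coordinates:
  fixes K V :: "'a::field set"
  assumes "subfield K (ring_of_type_algebra :: 'a ring)"
    and "ring.dimension (ring_of_type_algebra :: 'a ring) d K V"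
  shows "\<exists>b. V = {\<Sum>i<d. c i * b i |c. \<forall>i<d. c i \<in> K} \<and>
             (\<forall>c. (\<forall>i<d. c i \<in> K) \<and> (\<Sum>i<d. c i * b i) = 0 \<longrightarrow> (\<forall>i<d. c i = 0))"
proof -
  interpret R: ring "ring_of_type_algebra :: 'a ring" by (rule ring_from_type_algebra)
  show ?thesis using assms(2,1)
  proof (induction rule: R.dimension.induct)
    case zero_dim
    then show ?case by auto
  next
    case (Suc_dim v E d K)
    note cl = subfield_type_closed[OF Suc_dim.prems]
    from Suc_dim obtain b where E: "E = {\<Sum>i<d. c i * b i |c. \<forall>i<d. c i \<in> K}"
      and ind: "\<And>c. (\<forall>i<d. c i \<in> K) \<Longrightarrow> (\<Sum>i<d. c i * b i) = 0 \<Longrightarrow> (\<forall>i<d. c i = 0)" by auto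
    define b' where "b' = b(d := v)"
    have s: "(\<Sum>i<Suc d. c i * b' i) = c d * v + (\<Sum>i<d. c i * b i)" for c
      by (simp add: b'_def)
    have "R.line_extension K v E = {\<Sum>i<Suc d. c i * b' i |c. \<forall>i<Suc d. c i \<in> K}" (is "?A = ?B")
    proof
      show "?A \<subseteq> ?B"
      proof
        fix u assume "u \<in> ?A"
        then obtain k c where k: "k \<in> K" "\<forall>i<d. c i \<in> K" "u = k * v + (\<Sum>i<d. c i * b i)"
          unfolding R.line_extension_mem_iff E by auto
        have "u = (\<Sum>i<Suc d. (c(d := k)) i * b' i)" unfolding s by (simp add: k)
        moreover have "\<forall>i<Suc d. (c(d := k)) i \<in> K" using k by (auto simp: less_Suc_eq)
        ultimately show "u \<in> ?B" by blast
      qed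
      show "?B \<subseteq> ?A"
      proof
        fix u assume "u \<in> ?B"
        then obtain c where c: "\<forall>i<Suc d. c i \<in> K" "u = c d * v + (\<Sum>i<d. c i * b i)"
          unfolding s by blast
        moreover have "(\<Sum>i<d. c i * b i) \<in> E" unfolding E using c(1) by auto
        ultimately show "u \<in> ?A" unfolding R.line_extension_mem_iff by auto
      qed
    qed
    moreover have "\<forall>i<Suc d. c i = 0" if c: "\<forall>i<Suc d. c i \<in> K" "(\<Sum>i<Suc d. c i * b' i) = 0" for c
    proof -
      have e: "c d * v + (\<Sum>i<d. c i * b i) = 0" using c(2) unfolding s .
      have "c d = 0"
      proof (rule ccontr)
        assume n: "c d \<noteq> 0"
        have "v = inverse (c d) * (c d * v)" using n by simp
        also have "c d * v = - (\<Sum>i<d. c i * b i)" using e by (simp add: eq_neg_iff_add_eq_0)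
        also have "inverse (c d) * - (\<Sum>i<d. c i * b i) = (\<Sum>i<d. (- inverse (c d) * c i) * b i)"
          by (simp add: sum_distrib_left sum_negf mult.assoc)
        finally have "v = (\<Sum>i<d. (- inverse (c d) * c i) * b i)" .
        moreover have "\<forall>i<d. - inverse (c d) * c i \<in> K" using c(1) cl by auto
        ultimately have "v \<in> E" unfolding E mem_Collect_eq by (intro exI[of _ "\<lambda>i. - inverse (c d) * c i"] conjI)
        with Suc_dim show False by simp
      qed
      moreover from this have "(\<Sum>i<d. c i * b i) = 0" using e by simp
      moreover have "\<forall>i<d. c i \<in> K" using c(1) by simp
      ultimately have "c d = 0 \<and> (\<forall>i<d. c i = 0)" using ind by blast
      then show ?thesis by (auto simp: less_Suc_eq)
    qed
    ultimately show ?case by blast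
  qed
qed

subsection \<open>Independence of characters and the order of the Galois group\<close>

text \<open>Dedekind's argument: the relation at \<open>x * y\<close> minus \<open>g r y\<close>
  times the relation at \<open>x\<close> cancels the last character. \<open>S\<close> is only a
  multiplicative monoid, so restrictions to a subfield are covered.\<close>

lemma independence_of_characters:
  fixes g :: "nat \<Rightarrow> 'a::field \<Rightarrow> 'a" and S :: "'a set"
  assumes "\<And>i x y. i < r \<Longrightarrow> x \<in> S \<Longrightarrow> y \<in> S \<Longrightarrow> g i (x * y) = g i x * g i y"
    and "\<And>x y. x \<in> S \<Longrightarrow> y \<in> S \<Longrightarrow> x * y \<in> S" and "1 \<in> S" and "\<And>i. i < r \<Longrightarrow> g i 1 = 1"
    and "\<And>i j. i < j \<Longrightarrow> j < r \<Longrightarrow> \<exists>x\<in>S. g i x \<noteq> g j x"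
    and "\<And>x. x \<in> S \<Longrightarrow> (\<Sum>i<r. c i * g i x) = 0"
  shows "\<forall>i<r. c i = 0"
  using assms(1,4,5,6)
proof (induction r arbitrary: c)
  case 0
  then show ?case by simp
next
  case (Suc r)
  have "c i = 0" if i: "i < r" for i
  proof -
    obtain y where y: "y \<in> S" "g i y \<noteq> g r y" using Suc.prems(3)[of i r] i by auto
    have "(\<Sum>i<r. (c i * (g i y - g r y)) * g i x) = 0" if x: "x \<in> S" for x
    proof -
      have "0 = (\<Sum>i<Suc r. c i * g i (x * y)) - (\<Sum>i<Suc r. c i * g i x) * g r y"
        unfolding Suc.prems(4)[OF x] Suc.prems(4)[OF assms(2)[OF x y(1)]] by simp
      also have "\<dots> = (\<Sum>i<Suc r. c i * (g i x * g i y)) - (\<Sum>i<Suc r. c i * g i x * g r y)"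
        using Suc.prems(1) x y by (simp add: sum_distrib_right del: sum.lessThan_Suc)
      also have "\<dots> = (\<Sum>i<Suc r. (c i * (g i y - g r y)) * g i x)"
        unfolding sum_subtractf[symmetric] by (intro sum.cong) (auto simp: algebra_simps)
      also have "\<dots> = (\<Sum>i<r. (c i * (g i y - g r y)) * g i x)" by simp
      finally show ?thesis by simp
    qed
    then have "\<forall>i<r. c i * (g i y - g r y) = 0"
      using Suc.IH[of "\<lambda>i. c i * (g i y - g r y)"] Suc.prems by auto
    then show ?thesis using i y by auto
  qed
  then show ?case using Suc.prems(4)[OF assms(3)] Suc.prems(2)[of r] by (auto simp: less_Suc_eq)
qed

text \<open>Vanishing on a basis of \<open>S\<close> is a system of \<open>d\<close> equations in
  \<open>r\<close> unknowns. If \<open>r > d\<close>, a nontrivial solution extends by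
  \<open>K\<close>-linearity to all of \<open>S\<close> and contradicts the independence of
  characters.\<close>

lemma card_characters_le_dimension:
  fixes K S :: "'a::field set" and g :: "nat \<Rightarrow> 'a \<Rightarrow> 'a"
  assumes K: "subfield K (ring_of_type_algebra :: 'a ring)"
    and dim: "ring.dimension (ring_of_type_algebra :: 'a ring) d K S"
    and S: "subfield S (ring_of_type_algebra :: 'a ring)"
    and add: "\<And>i x y. g i (x + y) = g i x + g i y" and mult: "\<And>i x y. g i (x * y) = g i x * g i y"
    and one: "\<And>i. g i 1 = 1" and fixed: "\<And>i x. x \<in> K \<Longrightarrow> g i x = x"
    and dist: "\<And>i j. i < j \<Longrightarrow> j < r \<Longrightarrow> \<exists>x\<in>S. g i x \<noteq> g j x"
  shows "r \<le> d"
proof (rule ccontr)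
  assume "\<not> r \<le> d"
  obtain b where b: "S = {\<Sum>i<d. c i * b i |c. \<forall>i<d. c i \<in> K}"
    using dimension_has_coordinates[OF K dim] by blast
  obtain c where c: "\<exists>j\<in>{..<r}. c j \<noteq> 0" "\<forall>i<d. (\<Sum>j<r. g j (b i) * c j) = 0"
    using homogeneous_system_nontrivial[of "{..<r}" d "\<lambda>i j. g j (b i)"] \<open>\<not> r \<le> d\<close> by auto
  have zero: "g j 0 = 0" for j using add[of j 0 0] by (metis add.right_neutral add_cancel_right_right)
  have "(\<Sum>j<r. c j * g j x) = 0" if x: "x \<in> S" for x
  proof -
    obtain k where k: "\<forall>i<d. k i \<in> K" "x = (\<Sum>i<d. k i * b i)" using x[unfolded b] by blast
    have "g j (sum u I) = (\<Sum>i\<in>I. g j (u i))" if "finite I" for j u and I :: "nat set"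
      using that by (induction I) (auto simp: zero add)
    then have "g j x = (\<Sum>i<d. k i * g j (b i))" for j
      using k fixed by (simp add: mult)
    then have "(\<Sum>j<r. c j * g j x) = (\<Sum>j<r. \<Sum>i<d. k i * (g j (b i) * c j))"
      by (simp add: sum_distrib_left algebra_simps)
    also have "\<dots> = (\<Sum>i<d. k i * (\<Sum>j<r. g j (b i) * c j))"
      by (subst sum.swap) (simp add: sum_distrib_left)
    also have "\<dots> = 0" using c(2) by simp
    finally show ?thesis .
  qed
  then have "\<forall>i<r. c i = 0"
    by (intro independence_of_characters[of r S g])
      (use mult one dist subfield_type_closed[OF S] in auto)
  with c(1) show False by auto
qed

text \<open>Artin's argument. If \<open>d > r\<close>, the \<open>r\<close> equations given by the
  conjugates of a basis have a nontrivial solution. Applying \<sigma> permutes the equations, so a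
  solution of least support that contains a 1 must be fixed by \<sigma>, hence lie in
  \<open>K\<close>; the equation for exponent 0 then contradicts independence.\<close>

lemma degree_le_order_of_cyclic_group:
  fixes K :: "'a::field set" and \<sigma> :: "'a \<Rightarrow> 'a"
  assumes K: "subfield K (ring_of_type_algebra :: 'a ring)"
    and dim: "ring.dimension (ring_of_type_algebra :: 'a ring) d K UNIV"
    and add: "\<And>x y. \<sigma> (x + y) = \<sigma> x + \<sigma> y" and mult: "\<And>x y. \<sigma> (x * y) = \<sigma> x * \<sigma> y"
    and one: "\<sigma> 1 = 1" and fix_sub: "\<And>x. \<sigma> x = x \<Longrightarrow> x \<in> K"
    and r: "0 < r" "\<sigma> ^^ r = id"
  shows "d \<le> r"
proof (rule ccontr)
  assume "\<not> d \<le> r"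
  obtain b where ind: "\<And>c. (\<forall>i<d. c i \<in> K) \<Longrightarrow> (\<Sum>i<d. c i * b i) = 0 \<Longrightarrow> (\<forall>i<d. c i = 0)"
    using dimension_has_coordinates[OF K dim] by blast
  define P where "P c \<longleftrightarrow> (\<exists>j<d. c j \<noteq> 0) \<and> (\<forall>i<r. (\<Sum>j<d. (\<sigma> ^^ i) (b j) * c j) = 0)" for c
  define supp where "supp c = card {j. j < d \<and> c j \<noteq> (0::'a)}" for c
  have "\<exists>c. P c"
    using homogeneous_system_nontrivial[of "{..<d}" r "\<lambda>i j. (\<sigma> ^^ i) (b j)"] \<open>\<not> d \<le> r\<close>
    unfolding P_def by auto
  then obtain c0 where c0: "P c0" and min: "\<And>c. P c \<Longrightarrow> supp c0 \<le> supp c"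
    using ex_has_least_nat[of P _ supp] by blast
  obtain p where p: "p < d" "c0 p \<noteq> 0" using c0 P_def by auto
  \<comment> \<open>The entry at \<open>p\<close> becomes 1, which \<sigma> fixes; so subtracting
    \<open>c\<close> from its image under \<sigma> shrinks the support.\<close>
  define c where "c j = c0 j / c0 p" for j
  have zero: "\<sigma> 0 = 0" using add[of 0 0] by (metis add.right_neutral add_cancel_right_right)
  have smult: "P (\<lambda>j. c' j * a)" if "P c'" "a \<noteq> 0" for a c'
  proof -
    have "(\<Sum>j<d. (\<sigma> ^^ i) (b j) * (c' j * a)) = (\<Sum>j<d. (\<sigma> ^^ i) (b j) * c' j) * a" for i
      by (simp add: sum_distrib_right mult.assoc)
    then show ?thesis using that unfolding P_def by simp
  qed
  have Pc: "P c" using smult[OF c0, of "inverse (c0 p)"] p by (simp add: c_def[abs_def] divide_inverse)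
  have inj: "\<sigma> x = 0 \<longleftrightarrow> x = 0" for x
  proof
    assume "\<sigma> x = 0"
    show "x = 0"
    proof (rule ccontr)
      assume "x \<noteq> 0"
      then show False using mult[of x "inverse x"] one \<open>\<sigma> x = 0\<close> by simp
    qed
  qed (simp add: zero)
  have hsum: "\<sigma> (sum u I) = (\<Sum>i\<in>I. \<sigma> (u i))" if "finite I" for u and I :: "nat set"
    using that by (induction I) (auto simp: zero add)
  have eqs: "(\<Sum>j<d. (\<sigma> ^^ i) (b j) * \<sigma> (c j)) = 0" if "i < r" for i
  proof -
    \<comment> \<open>The equation that \<sigma> carries to equation \<open>i\<close>; for
      \<open>i = 0\<close> it wraps around because \<open>\<sigma> ^^ r = id\<close>.\<close>
    define i' where "i' = (if i = 0 then r - 1 else i - 1)"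
    have i': "i' < r" using r that by (auto simp: i'_def)
    have e: "(\<sigma> ^^ i) x = \<sigma> ((\<sigma> ^^ i') x)" for x
    proof (cases "i = 0")
      case True
      have "\<sigma> ((\<sigma> ^^ i') x) = (\<sigma> ^^ Suc (r - 1)) x" using True by (simp add: i'_def)
      also have "Suc (r - 1) = r" using r by simp
      finally show ?thesis using r True by simp
    next
      case False
      then have "(\<sigma> ^^ i) x = (\<sigma> ^^ Suc i') x" by (simp add: i'_def)
      then show ?thesis by simp
    qed
    have "(\<Sum>j<d. (\<sigma> ^^ i) (b j) * \<sigma> (c j)) = \<sigma> (\<Sum>j<d. (\<sigma> ^^ i') (b j) * c j)"
      by (simp add: hsum mult e)
    also have "\<dots> = 0" using Pc i' unfolding P_def by (simp add: zero)
    finally show ?thesis .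
  qed
  have fixc: "\<sigma> (c j) = c j" if "j < d" for j
  proof (rule ccontr)
    assume ne: "\<sigma> (c j) \<noteq> c j"
    define c' where "c' j = \<sigma> (c j) - c j" for j
    have "P c'"
      using ne that Pc eqs unfolding P_def c'_def
      by (auto simp: right_diff_distrib sum_subtractf)
    moreover have "{j. j < d \<and> c' j \<noteq> 0} \<subset> {j. j < d \<and> c0 j \<noteq> 0}"
    proof -
      have "c' p = 0" using p by (simp add: c'_def c_def one)
      moreover have "c' j = 0" if "c0 j = 0" for j using that by (simp add: c'_def c_def zero)
      ultimately show ?thesis using p by blast
    qed
    then have "supp c' < supp c0" unfolding supp_def by (intro psubset_card_mono) auto
    ultimately show False using min by fastforce
  qed
  have "(\<Sum>j<d. c j * b j) = 0" using Pc r unfolding P_def by (auto simp: mult.commute)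
  moreover have "\<forall>j<d. c j \<in> K" using fix_sub[OF fixc] by blast
  ultimately have "c p = 0" using ind p(1) by blast
  then show False using p by (simp add: c_def)
qed

locale skew_poly = field_hom \<sigma> for \<sigma> :: "'a::field \<Rightarrow> 'a"
begin

lemma pow_mult: "(\<sigma> ^^ i) (x * y) = (\<sigma> ^^ i) x * (\<sigma> ^^ i) y"
  by (induction i) (auto simp: hom_mult)

lemma pow_add: "(\<sigma> ^^ i) (x + y) = (\<sigma> ^^ i) x + (\<sigma> ^^ i) y"
  by (induction i) (auto simp: hom_add)

lemma pow_one [simp]: "(\<sigma> ^^ i) 1 = 1"
  by (induction i) auto

lemma pow_zero [simp]: "(\<sigma> ^^ i) 0 = 0"
  by (induction i) auto

lemma pow_zero_iff [simp]: "(\<sigma> ^^ i) x = 0 \<longleftrightarrow> x = 0"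
  by (induction i) auto

end

section \<open>The cyclic group generated by \<sigma>, and norms\<close>

locale cyclic_galois =
  fixes K :: "'a::field set" and n :: nat and \<sigma> :: "'a \<Rightarrow> 'a"
  assumes cyclic_galois: "cyclic_galois_extension K n \<sigma>"
begin

abbreviation "L \<equiv> ring_of_type_algebra :: 'a ring"

lemma subfield_K: "subfield K L"
  and dimension_L: "ring.dimension L n K UNIV"
  and fixed_field: "{a. \<forall>\<tau>\<in>Gal K. \<tau> a = a} = K"
  and Gal_eq: "Gal K = range (\<lambda>i::nat. \<sigma> ^^ i)"
  using cyclic_galois unfolding cyclic_galois_extension_def galois_extension_def by auto

lemma \<sigma>_add [simp]: "\<sigma> (x + y) = \<sigma> x + \<sigma> y"
  and \<sigma>_mult [simp]: "\<sigma> (x * y) = \<sigma> x * \<sigma> y"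
  and \<sigma>_one [simp]: "\<sigma> 1 = 1"
  and \<sigma>_K [simp]: "c \<in> K \<Longrightarrow> \<sigma> c = c"
  and bij_\<sigma>: "bij \<sigma>"
proof -
  have "\<sigma> \<in> Gal K"
    using cyclic_galois unfolding cyclic_galois_extension_def by auto
  then show "\<sigma> (x + y) = \<sigma> x + \<sigma> y" "\<sigma> (x * y) = \<sigma> x * \<sigma> y" "\<sigma> 1 = 1"
     "c \<in> K \<Longrightarrow> \<sigma> c = c" "bij \<sigma>"
    unfolding Gal_def ring_iso_def Ring.ring_hom_def by auto
qed

sublocale skew_poly \<sigma>
proof
  show "\<sigma> 0 = 0" using \<sigma>_add[of 0 0] by (metis add.right_neutral add_cancel_right_right)
qed auto

lemma pow_K [simp]: "c \<in> K \<Longrightarrow> (\<sigma> ^^ i) c = c"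
  by (induction i) auto

lemma mem_K_iff: "c \<in> K \<longleftrightarrow> \<sigma> c = c"
proof
  assume "\<sigma> c = c"
  then have "(\<sigma> ^^ i) c = c" for i by (induction i) auto
  then show "c \<in> K" using fixed_field unfolding Gal_eq by auto
qed simp

lemma n_pos: "0 < n"
proof (rule ccontr)
  assume "\<not> 0 < n"
  interpret R: field L by (rule field_from_type_algebra)
  have "(UNIV :: 'a set) = {0}" using R.dimension_zero[OF subfield_K] dimension_L \<open>\<not> 0 < n\<close> by simp
  moreover have "(1 :: 'a) \<in> UNIV" by (rule UNIV_I)
  ultimately have "(1 :: 'a) = 0" by (metis singletonD)
  then show False by simp
qed

lemma pow_cancel:
  assumes "\<And>x. (\<sigma> ^^ i) x = (\<sigma> ^^ j) x" "i < j"
  shows "\<sigma> ^^ (j - i) = id"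
proof
  fix x
  have "(\<sigma> ^^ i) x = (\<sigma> ^^ (i + (j - i))) x" using assms by simp
  also have "\<dots> = (\<sigma> ^^ i) ((\<sigma> ^^ (j - i)) x)" unfolding funpow_add by simp
  finally have "(\<sigma> ^^ i) x = (\<sigma> ^^ i) ((\<sigma> ^^ (j - i)) x)" .
  moreover have "inj (\<sigma> ^^ i)" using bij_\<sigma> bij_fn bij_is_inj by blast
  ultimately show "(\<sigma> ^^ (j - i)) x = id x" by (simp add: inj_eq)
qed

text \<open>The \<open>d + 1\<close> maps \<open>\<sigma> ^^ (q * i)\<close> fix \<open>K'\<close>
  pointwise and, by Dedekind, cannot all differ on \<open>S\<close>. The step \<open>q\<close>
  allows a use over the intermediate field as well as over \<open>K\<close>.\<close>

lemma pow_coincide: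
  assumes S: "subfield S L"
    and K': "subfield K' L"
    and "ring.dimension L d K' S"
    and "\<And>x. x \<in> K' \<Longrightarrow> (\<sigma> ^^ q) x = x"
  shows "\<exists>i j. i < j \<and> j \<le> d \<and> (\<forall>x\<in>S. (\<sigma> ^^ (q * i)) x = (\<sigma> ^^ (q * j)) x)"
proof (rule ccontr)
  assume *: "\<not> ?thesis"
  have fix1: "(\<sigma> ^^ (q * i)) x = x" if "x \<in> K'" for i x
    using that by (induction i) (auto simp: funpow_add assms(4))
  have "Suc d \<le> d"
  proof (rule card_characters_le_dimension[OF K' assms(3) S, of "\<lambda>i. \<sigma> ^^ (q * i)"])
    show "\<exists>x\<in>S. (\<sigma> ^^ (q * i)) x \<noteq> (\<sigma> ^^ (q * j)) x" if "i < j" "j < Suc d" for i j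
      using * that by (auto simp: less_Suc_eq_le)
  qed (simp_all add: fix1 pow_mult pow_add)
  then show False by simp
qed

lemma subfield_UNIV: "subfield UNIV L"
  proof -
  interpret R: field L by (rule field_from_type_algebra)
  show ?thesis using R.carrier_is_subfield by simp
qed

text \<open>Artin's bound makes every period of \<sigma> at least \<open>n\<close>, and Dedekind's
  bound yields a period of at most \<open>n\<close>.\<close>

lemma pow_n: "\<sigma> ^^ n = id" and pow_less_n: "\<And>i. 0 < i \<Longrightarrow> i < n \<Longrightarrow> \<sigma> ^^ i \<noteq> id"
proof -
  have lower: "n \<le> r" if "0 < r" "\<sigma> ^^ r = id" for r
    by (rule degree_le_order_of_cyclic_group[OF subfield_K dimension_L, of \<sigma>])
      (use that mem_K_iff in auto)
  obtain i j where ij: "i < j" "j \<le> n" "\<forall>x\<in>UNIV. (\<sigma> ^^ (1 * i)) x = (\<sigma> ^^ (1 * j)) x"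
    using pow_coincide[OF subfield_UNIV subfield_K dimension_L, of 1] by auto
  then have "\<sigma> ^^ (j - i) = id" by (intro pow_cancel) auto
  moreover from this have "n \<le> j - i" using ij by (intro lower) auto
  moreover have "j - i \<le> n" using ij by simp
  ultimately show "\<sigma> ^^ n = id" using le_antisym[of n "j - i"] by simp
  show "\<sigma> ^^ i \<noteq> id" if "0 < i" "i < n" for i
  proof
    assume "\<sigma> ^^ i = id"
    then show False using lower[OF that(1)] that(2) by simp
  qed
qed

lemma pow_add_n [simp]: "(\<sigma> ^^ (n + i)) x = (\<sigma> ^^ i) x" "(\<sigma> ^^ (i + n)) x = (\<sigma> ^^ i) x"
  "(\<sigma> ^^ (n * i)) x = x"  "(\<sigma> ^^ n) x = x"
proof -
  show "(\<sigma> ^^ (n * i)) x = x" by (induction i) (auto simp: funpow_add pow_n)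
qed (auto simp: funpow_add pow_n)

lemma pow_inj_mod:
  assumes "\<And>x. (\<sigma> ^^ i) x = (\<sigma> ^^ j) x" "i \<le> j"
  shows "n dvd j - i"
proof -
  define k where "k = j - i"
  have k: "\<sigma> ^^ k = id" using pow_cancel[of i j] assms by (cases "i = j") (auto simp: k_def)
  have "\<sigma> ^^ (k mod n) = id"
  proof
    fix x
    have "(\<sigma> ^^ k) x = (\<sigma> ^^ (n * (k div n) + k mod n)) x" by simp
    also have "\<dots> = (\<sigma> ^^ (k mod n)) x" unfolding funpow_add comp_def pow_add_n ..
    finally show "(\<sigma> ^^ (k mod n)) x = id x" using k by simp
  qed
  then have "k mod n = 0" using pow_less_n[of "k mod n"] n_pos by auto
  then show ?thesis by (auto simp: k_def)
qed

lemma field_norm_eq: "field_norm K a = (\<Prod>i<n. (\<sigma> ^^ i) a)"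
proof -
  have "\<sigma> ^^ i = \<sigma> ^^ (i mod n)" for i
  proof
    fix x
    have "(\<sigma> ^^ i) x = (\<sigma> ^^ (n * (i div n) + i mod n)) x" by simp
    then show "(\<sigma> ^^ i) x = (\<sigma> ^^ (i mod n)) x" unfolding funpow_add comp_def pow_add_n .
  qed
  moreover have "i mod n \<in> {..<n}" for i using n_pos by simp
  ultimately have "Gal K \<subseteq> (\<lambda>i. \<sigma> ^^ i) ` {..<n}" unfolding Gal_eq by blast
  then have G: "Gal K = (\<lambda>i. \<sigma> ^^ i) ` {..<n}" unfolding Gal_eq by auto
  have le: "i = j" if "i \<le> j" "i < n" "j < n" "\<sigma> ^^ i = \<sigma> ^^ j" for i j
  proof -
    have "n dvd j - i" using pow_inj_mod[of i j] that by auto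
    then have "j - i = 0" using that nat_dvd_not_less[of "j - i" n] by linarith
    then show ?thesis using that by simp
  qed
  have "inj_on (\<lambda>i. \<sigma> ^^ i) {..<n}"
  proof (rule inj_onI)
    fix i j assume "i \<in> {..<n}" "j \<in> {..<n}" "\<sigma> ^^ i = \<sigma> ^^ j"
    then show "i = j" using le[of i j] le[of j i] by (cases "i \<le> j") auto
  qed
  then show ?thesis unfolding field_norm_def G by (simp add: prod.reindex)
qed

lemma field_norm_mult: "field_norm K (a * b) = field_norm K a * field_norm K b"
proof -
  show ?thesis unfolding field_norm_eq pow_mult by (rule prod.distrib)
qed

lemma field_norm_eq_0_iff: "field_norm K a = 0 \<longleftrightarrow> a = 0"
proof -
  have "(\<exists>i<n. a = 0) = (a = 0)" using n_pos by blast
  then show ?thesis unfolding field_norm_eq prod_zero_iff[OF finite_lessThan] by simp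
qed

lemma field_norm_minus:
  assumes "even n"
  shows "field_norm K (- a) = field_norm K a"
proof -
  have m: "(\<sigma> ^^ i) (- a) = - (\<sigma> ^^ i) a" for i by (induction i) (auto simp: hom_uminus)
  have "(- 1 :: 'a) ^ n = 1" using assms by (simp only: neg_one_even_power)
  then show ?thesis unfolding field_norm_eq m prod_uminus card_lessThan by (simp only: mult_1_left)
qed

lemma dimension_intermediate:
  assumes "n = 2 * t" and L': "subfield L' L" and "K \<subseteq> L'"
    and dim: "ring.dimension L 2 L' UNIV"
  shows "ring.dimension L t K L'"
proof -
  note R = ring_from_type_algebra
  have "subalgebra K L' L"
    unfolding subalgebra_def subalgebra_axioms_def
    using subring.axioms(1)[OF subfieldE(1)[OF L']] subfield_type_closed(4)[OF L'] \<open>K \<subseteq> L'\<close> by auto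
  then obtain t' where t': "ring.dimension L t' K L'"
    using ring.subalbegra_incl_imp_finite_dimension[OF R subfield_K ring.finite_dimensionI[OF R dimension_L]]
    using ring.finite_dimensionE'[OF R] by blast
  have "t' * 2 = n"
    using ring.dimension_is_inj[OF R subfield_K ring.telescopic_base[OF R subfield_K L' t' dim] dimension_L] .
  then have "t' = t" using assms(1) by simp
  then show ?thesis using t' by simp
qed

text \<open>Since \<open>\<sigma> ^^ t\<close> fixes \<open>L'\<close>, the norm of \<open>a\<close>
  is the square of the product of its first \<open>t\<close> conjugates, and this product is fixed
  by \<sigma>.\<close>

lemma norm_square:
  assumes "n = 2 * t" and L': "subfield L' L" and "K \<subseteq> L'"
    and dim: "ring.dimension L 2 L' UNIV"
    and "a \<in> L'"
  shows "\<exists>c\<in>K. field_norm K a = c ^ 2"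
proof -
  have t_pos: "0 < t" using n_pos assms(1) by simp
  have dim_t: "ring.dimension L t K L'"
    by (rule dimension_intermediate[OF assms(1-4)])
  obtain i j where ij: "i < j" "j \<le> t" "\<forall>x\<in>L'. (\<sigma> ^^ (1 * i)) x = (\<sigma> ^^ (1 * j)) x"
    using pow_coincide[OF L' subfield_K dim_t, of 1] by auto
  \<comment> \<open>Dedekind over \<open>K\<close> gives \<open>q \<le> t\<close>. Dedekind over
    \<open>L'\<close>, for the powers of \<open>\<sigma> ^^ q\<close>, will give
    \<open>n \<le> 2 * q\<close>, so that \<open>q = t\<close>.\<close>
  define q where "q = j - i"
  have q: "0 < q" "q \<le> t" using ij by (auto simp: q_def)
  have q_fix: "(\<sigma> ^^ q) x = x" if "x \<in> L'" for x
  proof -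
    have "(\<sigma> ^^ i) x = (\<sigma> ^^ (i + q)) x" using ij that by (simp add: q_def)
    also have "\<dots> = (\<sigma> ^^ i) ((\<sigma> ^^ q) x)" unfolding funpow_add by simp
    finally have "(\<sigma> ^^ i) x = (\<sigma> ^^ i) ((\<sigma> ^^ q) x)" .
    moreover have "inj (\<sigma> ^^ i)" using bij_\<sigma> bij_fn bij_is_inj by blast
    ultimately show ?thesis by (simp add: inj_eq)
  qed
  obtain i' j' where ij': "i' < j'" "j' \<le> 2" "\<forall>x\<in>UNIV. (\<sigma> ^^ (q * i')) x = (\<sigma> ^^ (q * j')) x"
    using pow_coincide[OF subfield_UNIV L' dim q_fix] by auto
  have "n dvd q * j' - q * i'" using pow_inj_mod[of "q * i'" "q * j'"] ij' by auto
  then have "n dvd q * (j' - i')" by (simp add: right_diff_distrib')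
  moreover have "0 < q * (j' - i')" using q ij' by simp
  ultimately have "n \<le> q * (j' - i')" by (rule dvd_imp_le)
  moreover have "q * (j' - i') \<le> q * 2" by (rule mult_le_mono2) (use ij'(2) in linarith)
  ultimately have "q = t" using q assms(1) by linarith
  then have t: "(\<sigma> ^^ t) x = x" if "x \<in> L'" for x using q_fix that by simp
  define c where "c = (\<Prod>i<t. (\<sigma> ^^ i) a)"
  have "field_norm K a = c ^ 2"
  proof -
    have "(\<Prod>i<t+t. (\<sigma> ^^ i) a) = c * (\<Prod>i\<in>{t..<t+t}. (\<sigma> ^^ i) a)"
      unfolding c_def atLeast0LessThan[symmetric] by (rule prod.atLeastLessThan_concat[symmetric]) auto
    also have "(\<Prod>i\<in>{t..<t+t}. (\<sigma> ^^ i) a) = (\<Prod>i\<in>{0..<t}. (\<sigma> ^^ (i + t)) a)"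
      using prod.shift_bounds_nat_ivl[of "\<lambda>i. (\<sigma> ^^ i) a" 0 t t] unfolding add_0 .
    also have "\<dots> = (\<Prod>i\<in>{0..<t}. (\<sigma> ^^ i) a)"
      unfolding funpow_add comp_def t[OF assms(5)] ..
    also have "\<dots> = c" unfolding c_def atLeast0LessThan ..
    finally show ?thesis unfolding field_norm_eq assms(1) power2_eq_square mult_2 .
  qed
  moreover have "\<sigma> c = c"
  proof -
    \<comment> \<open>The factor \<open>a\<close> completes the shifted product to
      \<open>t + 1\<close> conjugates, the last of which is \<open>a\<close> again.\<close>
    have "a * \<sigma> c = (\<sigma> ^^ 0) a * (\<Prod>i<t. (\<sigma> ^^ (Suc i)) a)"
      unfolding c_def hom_prod funpow.simps comp_def id_def ..
    also have "\<dots> = (\<Prod>i<Suc t. (\<sigma> ^^ i) a)"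
      by (rule prod.lessThan_Suc_shift[symmetric])
    also have "\<dots> = c * a" unfolding prod.lessThan_Suc c_def t[OF assms(5)] ..
    finally have e: "a * \<sigma> c = a * c" unfolding mult.commute[of c a] .
    show ?thesis
    proof (cases "a = 0")
      case True
      then have "c = 0" unfolding c_def using t_pos by (intro prod_zero) (auto simp: Bex_def)
      then show ?thesis by (simp only: hom_zero)
    next
      case False
      then show ?thesis using e mult_left_cancel by blast
    qed
  qed
  ultimately show ?thesis using mem_K_iff by blast
qed

end

section \<open>Skew polynomials\<close>

text \<open>Skew multiplication is additive in both arguments, so identities such as associativity
  need checking on monomials only.\<close>

lemma poly_monom_induct [case_names zero monom add]:
  assumes "P 0" and "\<And>a i. P (monom a i)" and "\<And>p q. P p \<Longrightarrow> P q \<Longrightarrow> P (p + q)"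
  shows "P (p :: 'a::comm_monoid_add poly)"
proof -
  have "P (\<Sum>i\<in>A. monom (coeff p i) i)" if "finite A" for A
    using that by (induction A) (auto intro: assms)
  from this[of "{..degree p}"] show ?thesis by (simp add: poly_as_sum_of_monoms)
qed

context skew_poly
begin

abbreviation "R \<equiv> skew_poly_ring \<sigma>"

abbreviation skew_times (infixl "\<star>" 70) where "p \<star> q \<equiv> skew_mult \<sigma> p q"

text \<open>Frees the product from the degree bounds in its definition; the extra summands
  vanish.\<close>

lemma coeff_skew_mult: "coeff (p \<star> q) k = (\<Sum>i\<le>k. coeff p i * (\<sigma> ^^ i) (coeff q (k - i)))"
proof -
  let ?g = "\<lambda>i. coeff p i * (\<sigma> ^^ i) (coeff q (k - i))"
  have inner: "(\<Sum>j\<le>degree q. if i + j = k then coeff p i * (\<sigma> ^^ i) (coeff q j) else 0)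
      = (if i \<le> k then ?g i else 0)" for i
  proof (cases "i \<le> k")
    case True
    then have "(\<Sum>j\<le>degree q. if i + j = k then coeff p i * (\<sigma> ^^ i) (coeff q j) else 0)
       = (\<Sum>j\<le>degree q. if j = k - i then coeff p i * (\<sigma> ^^ i) (coeff q j) else 0)"
      by (intro sum.cong) auto
    then show ?thesis using True by (auto simp: sum.delta coeff_eq_0)
  qed (auto intro: sum.neutral)
  have "coeff (p \<star> q) k
      = (\<Sum>i\<le>degree p. \<Sum>j\<le>degree q. if i + j = k then coeff p i * (\<sigma> ^^ i) (coeff q j) else 0)"
    by (simp add: skew_mult_def coeff_sum)
  also have "\<dots> = (\<Sum>i\<le>degree p. if i \<le> k then ?g i else 0)" by (simp only: inner)
  also have "\<dots> = (\<Sum>i\<in>{..degree p} \<inter> {..k}. ?g i)" by (simp only: sum.inter_restrict[OF finite_atMost] atMost_iff)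
  also have "\<dots> = (\<Sum>i\<le>k. ?g i)"
    by (intro sum.mono_neutral_left) (auto simp: coeff_eq_0 not_le)
  finally show ?thesis .
qed

lemma add_skew: "(p + q) \<star> r = p \<star> r + q \<star> r"
  by (rule poly_eqI) (simp add: coeff_skew_mult distrib_right sum.distrib)

lemma skew_add: "r \<star> (p + q) = r \<star> p + r \<star> q"
  by (rule poly_eqI) (simp add: coeff_skew_mult pow_add distrib_left sum.distrib)

lemma zero_skew [simp]: "0 \<star> p = 0"
  by (rule poly_eqI) (simp add: coeff_skew_mult)

lemma skew_zero [simp]: "p \<star> 0 = 0"
  by (rule poly_eqI) (simp add: coeff_skew_mult)

lemma minus_skew: "(- p) \<star> r = - (p \<star> r)"
  using add_skew[of p "- p" r] by (simp add: eq_neg_iff_add_eq_0 add.commute)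

lemma skew_minus: "r \<star> (- p) = - (r \<star> p)"
  using skew_add[of r p "- p"] by (simp add: eq_neg_iff_add_eq_0 add.commute)

lemma diff_skew: "(p - q) \<star> r = p \<star> r - q \<star> r"
  using add_skew[of p "- q" r] by (simp add: minus_skew)

lemma skew_diff: "r \<star> (p - q) = r \<star> p - r \<star> q"
  using skew_add[of r p "- q"] by (simp add: skew_minus)

lemma sum_skew: "sum g I \<star> r = (\<Sum>i\<in>I. g i \<star> r)"
  by (induction I rule: infinite_finite_induct) (auto simp: add_skew)

lemma skew_sum: "r \<star> sum g I = (\<Sum>i\<in>I. r \<star> g i)"
  by (induction I rule: infinite_finite_induct) (auto simp: skew_add)

lemma coeff_monom_skew:
  "coeff (monom a i \<star> q) k = (if i \<le> k then a * (\<sigma> ^^ i) (coeff q (k - i)) else 0)"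
proof -
  have "coeff (monom a i \<star> q) k
      = (\<Sum>j\<le>k. if j = i then a * (\<sigma> ^^ i) (coeff q (k - i)) else 0)"
    unfolding coeff_skew_mult by (intro sum.cong) auto
  then show ?thesis by (simp add: sum.delta)
qed

lemma monom_skew_monom [simp]:
  "monom a i \<star> monom b j = monom (a * (\<sigma> ^^ i) b) (i + j)"
  by (rule poly_eqI) (auto simp: coeff_monom_skew)

lemma const_skew [simp]: "[:c:] \<star> p = smult c p"
  using coeff_monom_skew[of c 0 p] by (intro poly_eqI) (simp add: monom_0)

lemma one_skew [simp]: "1 \<star> p = p"
  using const_skew[of 1 p] by (simp add: one_pCons)

lemma skew_one [simp]: "p \<star> 1 = p"
proof (rule poly_eqI)
  fix k
  have "coeff (p \<star> 1) k = (\<Sum>i\<le>k. if i = k then coeff p i else 0)"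
    unfolding coeff_skew_mult by (intro sum.cong) auto
  then show "coeff (p \<star> 1) k = coeff p k" by simp
qed

lemma skew_assoc: "(p \<star> q) \<star> r = p \<star> (q \<star> r)"
proof (induction p rule: poly_monom_induct)
  case (monom a i)
  show ?case
  proof (induction q rule: poly_monom_induct)
    case (monom b j)
    show ?case
    proof (induction r rule: poly_monom_induct)
      case (monom c k)
      show ?case by (simp add: pow_mult funpow_add mult.assoc add.assoc)
    qed (auto simp: skew_add)
  qed (auto simp: skew_add add_skew)
qed (auto simp: add_skew)

lemma smult_skew: "smult c p \<star> q = smult c (p \<star> q)"
  using skew_assoc[of "[:c:]" p q] by simp

lemma lead_coeff_skew:
  "coeff (p \<star> q) (degree p + degree q) = lead_coeff p * (\<sigma> ^^ degree p) (lead_coeff q)"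
proof -
  have "coeff (p \<star> q) (degree p + degree q)
     = (\<Sum>i\<le>degree p + degree q. if i = degree p then lead_coeff p * (\<sigma> ^^ degree p) (lead_coeff q) else 0)"
    unfolding coeff_skew_mult
  proof (intro sum.cong refl)
    fix i
    consider "i < degree p" | "i = degree p" | "i > degree p" by linarith
    then show "coeff p i * (\<sigma> ^^ i) (coeff q (degree p + degree q - i)) =
       (if i = degree p then lead_coeff p * (\<sigma> ^^ degree p) (lead_coeff q) else 0)"
      by cases (auto simp: coeff_eq_0)
  qed
  then show ?thesis by simp
qed

lemma degree_skew_le: "degree (p \<star> q) \<le> degree p + degree q"
proof (rule degree_le, intro allI impI)
  fix k assume "degree p + degree q < k"
  then show "coeff (p \<star> q) k = 0" unfolding coeff_skew_mult
  proof (intro sum.neutral ballI)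
    fix i assume "i \<in> {..k}"
    show "coeff p i * (\<sigma> ^^ i) (coeff q (k - i)) = 0"
    proof (cases "degree p < i")
      case False
      then have "degree q < k - i" using \<open>degree p + degree q < k\<close> by linarith
      then show ?thesis by (simp add: coeff_eq_0)
    qed (simp add: coeff_eq_0)
  qed
qed

lemma skew_eq_0_iff [simp]: "p \<star> q = 0 \<longleftrightarrow> p = 0 \<or> q = 0"
proof -
  have "p \<star> q \<noteq> 0" if "p \<noteq> 0" "q \<noteq> 0"
  proof
    assume "p \<star> q = 0"
    then have "lead_coeff p * (\<sigma> ^^ degree p) (lead_coeff q) = 0"
      using lead_coeff_skew[of p q] by simp
    then show False using that by simp
  qed
  then show ?thesis by auto
qed

lemma degree_skew:
  assumes "p \<noteq> 0" "q \<noteq> 0"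
  shows "degree (p \<star> q) = degree p + degree q"
proof (rule antisym[OF degree_skew_le])
  show "degree p + degree q \<le> degree (p \<star> q)"
    using assms lead_coeff_skew[of p q] by (intro le_degree) auto
qed

lemma lead_coeff_skew_mult:
  "lead_coeff (p \<star> q) = lead_coeff p * (\<sigma> ^^ degree p) (lead_coeff q)"
  using lead_coeff_skew[of p q] degree_skew[of p q] by (cases "p = 0 \<or> q = 0") auto

lemma coeff_0_skew: "coeff (p \<star> q) 0 = coeff p 0 * coeff q 0"
  by (simp add: coeff_skew_mult)

lemma skew_cancel_right: "r \<noteq> 0 \<Longrightarrow> p \<star> r = q \<star> r \<longleftrightarrow> p = q"
  using diff_skew[of p q r] by (metis eq_iff_diff_eq_0 skew_eq_0_iff)

lemma skew_cancel_left: "r \<noteq> 0 \<Longrightarrow> r \<star> p = r \<star> q \<longleftrightarrow> p = q"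
  using skew_diff[of r p q] by (metis eq_iff_diff_eq_0 skew_eq_0_iff)

subsection \<open>Right division\<close>

text \<open>Membership of \<open>p\<close> in the left ideal \<open>Rh\<close>, so
  \<open>rdvd h\<close> is the vanishing predicate of the module \<open>R/Rh\<close>.\<close>

definition rdvd :: "'a poly \<Rightarrow> 'a poly \<Rightarrow> bool" where "rdvd h p \<longleftrightarrow> (\<exists>q. p = q \<star> h)"

lemma rdvd_refl [simp]: "rdvd h h"
  unfolding rdvd_def by (metis one_skew)

lemma rdvd_0 [simp]: "rdvd h 0"
  unfolding rdvd_def by (metis zero_skew)

lemma rdvd_skew [simp]: "rdvd h (q \<star> h)"
  unfolding rdvd_def by auto

lemma rdvd_mult: "rdvd h p \<Longrightarrow> rdvd h (q \<star> p)"
  unfolding rdvd_def by (metis skew_assoc)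

lemma rdvd_add: "rdvd h p \<Longrightarrow> rdvd h q \<Longrightarrow> rdvd h (p + q)"
  unfolding rdvd_def by (metis add_skew)

lemma rdvd_diff: "rdvd h p \<Longrightarrow> rdvd h q \<Longrightarrow> rdvd h (p - q)"
  unfolding rdvd_def by (metis diff_skew)

lemma rdvd_minus: "rdvd h p \<Longrightarrow> rdvd h (- p)"
  unfolding rdvd_def by (metis minus_skew)

lemma rdvd_smult: "rdvd h p \<Longrightarrow> rdvd h (smult c p)"
  using rdvd_mult[of h p "[:c:]"] by simp

lemma rdvd_sum: "(\<And>i. i \<in> I \<Longrightarrow> rdvd h (g i)) \<Longrightarrow> rdvd h (sum g I)"
  by (induction I rule: infinite_finite_induct) (auto intro: rdvd_add)

lemma rdvd_trans: "rdvd a b \<Longrightarrow> rdvd b c \<Longrightarrow> rdvd a c"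
  unfolding rdvd_def by (metis skew_assoc)

lemma rdvd_degree_le: "rdvd h p \<Longrightarrow> p \<noteq> 0 \<Longrightarrow> degree h \<le> degree p"
  unfolding rdvd_def by (auto simp: degree_skew)

lemma rdvd_small: "rdvd h p \<Longrightarrow> degree p < degree h \<Longrightarrow> p = 0"
  using rdvd_degree_le by fastforce

lemma rdvd_congr: "rdvd h (p - q) \<Longrightarrow> rdvd h p \<longleftrightarrow> rdvd h q"
  using rdvd_add[of h "p - q" q] rdvd_diff[of h p "p - q"] by auto

lemma rdvd_const: "degree h = 0 \<Longrightarrow> h \<noteq> 0 \<Longrightarrow> rdvd h p"
proof -
  assume h: "degree h = 0" "h \<noteq> 0"
  then obtain c where c: "h = [:c:]" "c \<noteq> 0" by (metis degree_eq_zeroE pCons_0_0)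
  have "p = (p \<star> [:inverse c:]) \<star> h"
    unfolding skew_assoc c const_skew by (simp add: c one_pCons[symmetric])
  then show ?thesis unfolding rdvd_def by blast
qed

lemma right_division_exists:
  assumes "h \<noteq> 0"
  shows "\<exists>q r. p = q \<star> h + r \<and> (r = 0 \<or> degree r < degree h)"
\<comment> \<open>The measure separates 0 from the nonzero constants, which have the same
  degree.\<close>
proof (induction "if p = 0 then 0 else Suc (degree p)" arbitrary: p rule: less_induct)
  case less
  show ?case
  proof (cases "p = 0 \<or> degree p < degree h")
    case True
    then show ?thesis by (intro exI[of _ 0] exI[of _ p]) auto
  next
    case False
    \<comment> \<open>Multiplying by a power of \<open>x\<close> from the left twists the leading
      coefficient of \<open>h\<close>, so the quotient term divides by the twisted
      coefficient.\<close>
    define m where "m = monom (lead_coeff p / (\<sigma> ^^ (degree p - degree h)) (lead_coeff h))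
      (degree p - degree h)"
    have m0: "lead_coeff p / (\<sigma> ^^ (degree p - degree h)) (lead_coeff h) \<noteq> 0"
      using False assms by simp
    have dm: "degree m = degree p - degree h" unfolding m_def by (rule degree_monom_eq[OF m0])
    have mnz: "m \<noteq> 0" using m0 unfolding m_def by (simp add: monom_eq_0_iff)
    have deg: "degree (m \<star> h) = degree p" using False by (simp add: degree_skew[OF mnz assms] dm)
    have "lead_coeff (m \<star> h) = lead_coeff p"
      unfolding lead_coeff_skew_mult dm using assms by (simp add: m_def dm[unfolded m_def])
    then have c0: "coeff (p - m \<star> h) (degree p) = 0" using deg by simp
    have dle: "degree (p - m \<star> h) \<le> degree p" using deg by (intro degree_diff_le) auto
    have "p - m \<star> h = 0 \<or> degree (p - m \<star> h) < degree p"
      using c0 dle by (metis eq_zero_or_degree_less)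
    then have "(if p - m \<star> h = 0 then 0 else Suc (degree (p - m \<star> h))) < (if p = 0 then 0 else Suc (degree p))"
      using False by auto
    from less[OF this] obtain q r where "p - m \<star> h = q \<star> h + r" "r = 0 \<or> degree r < degree h"
      by blast
    then have "p = (q + m) \<star> h + r" by (simp add: add_skew algebra_simps)
    then show ?thesis using \<open>r = 0 \<or> degree r < degree h\<close> by blast
  qed
qed

lemma mem_PIdl_iff: "p \<in> PIdl\<^bsub>R\<^esub> h \<longleftrightarrow> rdvd h p"
  unfolding cgenideal_def rdvd_def by (auto simp: skew_poly_ring_def)

lemma skew_rem_unique:
  assumes "degree r < degree h" "rdvd h (p - r)"
  shows "skew_rem \<sigma> p h = r"
  unfolding skew_rem_def mem_PIdl_iff
proof (rule the_equality)
  fix r' assume r': "degree r' < degree h \<and> rdvd h (p - r')"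
  then have "rdvd h ((p - r) - (p - r'))" using assms rdvd_diff by blast
  then have "rdvd h (r' - r)" by simp
  moreover have "degree (r' - r) < degree h"
    using assms r' by (intro degree_diff_less) auto
  ultimately show "r' = r" using rdvd_small by fastforce
qed (use assms in auto)

lemma skew_rem_spec:
  assumes "0 < degree h"
  shows "degree (skew_rem \<sigma> p h) < degree h" and "rdvd h (p - skew_rem \<sigma> p h)"
proof -
  have "h \<noteq> 0" using assms by auto
  then obtain q r where qr: "p = q \<star> h + r" "r = 0 \<or> degree r < degree h"
    using right_division_exists by blast
  then have "degree r < degree h" "rdvd h (p - r)" using assms by auto
  then show "degree (skew_rem \<sigma> p h) < degree h" "rdvd h (p - skew_rem \<sigma> p h)"
    using skew_rem_unique by auto
qed

lemma rdvd_skew_rem_iff: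
  assumes "0 < degree h"
  shows "rdvd h p \<longleftrightarrow> skew_rem \<sigma> p h = 0"
  using skew_rem_unique[of 0 h p] skew_rem_spec(2)[OF assms, of p] assms by auto

lemma skew_rem_small: "degree p < degree h \<Longrightarrow> skew_rem \<sigma> p h = p"
  by (rule skew_rem_unique) auto

lemma skew_rem_add:
  assumes "0 < degree h"
  shows "skew_rem \<sigma> (p + q) h = skew_rem \<sigma> p h + skew_rem \<sigma> q h"
proof (rule skew_rem_unique)
  show "degree (skew_rem \<sigma> p h + skew_rem \<sigma> q h) < degree h"
    using skew_rem_spec(1)[OF assms] by (intro degree_add_less) auto
  have "rdvd h ((p - skew_rem \<sigma> p h) + (q - skew_rem \<sigma> q h))"
    using skew_rem_spec(2)[OF assms] by (intro rdvd_add) auto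
  then show "rdvd h (p + q - (skew_rem \<sigma> p h + skew_rem \<sigma> q h))" by (simp add: algebra_simps)
qed

lemma skew_rem_smult:
  assumes "0 < degree h"
  shows "skew_rem \<sigma> (smult c p) h = smult c (skew_rem \<sigma> p h)"
proof (rule skew_rem_unique)
  show "degree (smult c (skew_rem \<sigma> p h)) < degree h"
    using skew_rem_spec(1)[OF assms, of p] degree_smult_le[of c "skew_rem \<sigma> p h"] by simp
  show "rdvd h (smult c p - smult c (skew_rem \<sigma> p h))"
    using rdvd_smult[OF skew_rem_spec(2)[OF assms, of p], of c] by (simp add: smult_diff_right)
qed

lemma skew_rem_sum:
  assumes "0 < degree h"
  shows "skew_rem \<sigma> (sum g I) h = (\<Sum>i\<in>I. skew_rem \<sigma> (g i) h)"
proof (induction I rule: infinite_finite_induct)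
  case (insert x F)
  then show ?case by (simp add: skew_rem_add[OF assms])
qed (use assms in \<open>auto simp: skew_rem_small\<close>)

lemma skew_rem_cong:
  assumes "0 < degree h" "rdvd h (p - q)"
  shows "skew_rem \<sigma> p h = skew_rem \<sigma> q h"
proof (rule skew_rem_unique[OF skew_rem_spec(1)[OF assms(1)]])
  show "rdvd h (p - skew_rem \<sigma> q h)"
    using rdvd_add[OF assms(2) skew_rem_spec(2)[OF assms(1), of q]] by simp
qed

section \<open>Left ideals and common left multiples\<close>

definition left_ideal :: "'a poly set \<Rightarrow> bool" where
  "left_ideal I \<longleftrightarrow> 0 \<in> I \<and> (\<forall>p\<in>I. \<forall>q\<in>I. p + q \<in> I) \<and> (\<forall>p\<in>I. \<forall>a. a \<star> p \<in> I)"

lemma left_ideal_diff: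
  assumes "left_ideal I" "p \<in> I" "q \<in> I"
  shows "p - q \<in> I"
proof -
  have "[:- 1:] \<star> q \<in> I" using assms unfolding left_ideal_def by blast
  then have "- q \<in> I" by simp
  then have "p + (- q) \<in> I" using assms unfolding left_ideal_def by blast
  then show ?thesis by simp
qed

lemma left_ideal_principal:
  assumes I: "left_ideal I" and ne: "p \<in> I" "p \<noteq> 0"
  shows "\<exists>g. lead_coeff g = 1 \<and> (\<forall>r. r \<in> I \<longleftrightarrow> rdvd g r)"
proof -
  obtain h where h: "h \<in> I" "h \<noteq> 0" and min: "\<And>r. r \<in> I \<Longrightarrow> r \<noteq> 0 \<Longrightarrow> degree h \<le> degree r"
    using ex_has_least_nat[of "\<lambda>r. r \<in> I \<and> r \<noteq> 0" p degree] ne by blast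
  define g where "g = smult (inverse (lead_coeff h)) h"
  have "[:inverse (lead_coeff h):] \<star> h \<in> I" using h I unfolding left_ideal_def by blast
  then have g: "g \<in> I" "lead_coeff g = 1" "degree g = degree h" "g \<noteq> 0"
    using h unfolding g_def by auto
  have "rdvd g r" if "r \<in> I" for r
  proof -
    obtain q s where qs: "r = q \<star> g + s" "s = 0 \<or> degree s < degree g"
      using right_division_exists[OF g(4)] by blast
    have "r - q \<star> g \<in> I" using I that g(1) left_ideal_diff[OF I] unfolding left_ideal_def by blast
    then have "s \<in> I" using qs(1) by simp
    then have "s = 0" using min[of s] qs(2) g(3) by fastforce
    then show ?thesis using qs by simp
  qed
  moreover have "r \<in> I" if "rdvd g r" for r
    using that g(1) I unfolding rdvd_def left_ideal_def by blast
  ultimately show ?thesis using g(2) by blast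
qed

text \<open>The Ore condition with a degree bound: the remainders of \<open>x^i u\<close> modulo
  \<open>h\<close> for \<open>i \<le> degree h\<close> are one too many for a space of dimension
  \<open>degree h\<close>, and a relation with left coefficients is the polynomial
  \<open>p\<close>.\<close>

lemma common_left_multiple:
  assumes "h \<noteq> 0"
  shows "\<exists>p. p \<noteq> 0 \<and> degree p \<le> degree h \<and> rdvd h (p \<star> u)"
proof (cases "degree h = 0")
  case True
  then show ?thesis using rdvd_const[OF True assms] by (intro exI[of _ 1]) auto
next
  case False
  define d where "d = degree h"
  have d: "0 < degree h" using False by simp
  define r where "r i = skew_rem \<sigma> (monom 1 i \<star> u) h" for i
  obtain c where c: "\<exists>i\<in>{..d}. c i \<noteq> 0" "\<forall>j<d. (\<Sum>i\<le>d. coeff (r i) j * c i) = 0"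
    using homogeneous_system_nontrivial[of "{..d}" d "\<lambda>j i. coeff (r i) j"] by auto
  define p where "p = (\<Sum>i\<le>d. monom (c i) i)"
  have cp: "coeff p i = (if i \<le> d then c i else 0)" for i
    by (simp add: p_def coeff_sum sum.delta)
  have "p \<noteq> 0" using c(1) cp by (metis atMost_iff coeff_0)
  moreover have "degree p \<le> degree h" unfolding d_def[symmetric] by (rule degree_le) (simp add: cp)
  moreover have "rdvd h (p \<star> u)"
  proof -
    have "p \<star> u = (\<Sum>i\<le>d. smult (c i) (monom 1 i \<star> u))"
      unfolding p_def sum_skew smult_skew[symmetric] smult_monom by simp
    then have "skew_rem \<sigma> (p \<star> u) h = (\<Sum>i\<le>d. smult (c i) (r i))"
      by (simp add: skew_rem_sum[OF d] skew_rem_smult[OF d] r_def)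
    also have "\<dots> = 0"
    proof (rule poly_eqI)
      fix j
      show "coeff (\<Sum>i\<le>d. smult (c i) (r i)) j = coeff 0 j"
      proof (cases "j < d")
        case True
        then show ?thesis using c(2) by (simp add: coeff_sum mult.commute)
      next
        case False
        then have "coeff (r i) j = 0" for i
          using skew_rem_spec(1)[OF d, of "monom 1 i \<star> u"] unfolding r_def d_def
          by (intro coeff_eq_0) simp
        then show ?thesis by (simp add: coeff_sum)
      qed
    qed
    finally show ?thesis using rdvd_skew_rem_iff[OF d] by simp
  qed
  ultimately show ?thesis by blast
qed

end

context skew_poly
begin

section \<open>Irreducible skew polynomials\<close>

definition skew_irreducible :: "'a poly \<Rightarrow> bool" where
  "skew_irreducible f \<longleftrightarrow> 0 < degree f \<and> (\<forall>a b. f = a \<star> b \<longrightarrow> degree a = 0 \<or> degree b = 0)"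

lemma skew_irreducible_degree: "skew_irreducible f \<Longrightarrow> 0 < degree f"
  by (simp add: skew_irreducible_def)

lemma skew_irreducible_factor:
  "skew_irreducible f \<Longrightarrow> f = a \<star> b \<Longrightarrow> degree a = 0 \<or> degree b = 0"
  unfolding skew_irreducible_def by (elim conjE allE impE) assumption+

lemma skew_irreducible_not_rdvd_1: "skew_irreducible f \<Longrightarrow> \<not> rdvd f 1"
  using rdvd_degree_le[of f 1] skew_irreducible_degree[of f] by auto

lemma rdvd_cofactor_const:
  assumes "f = c \<star> g" "degree c = 0" "f \<noteq> 0"
  shows "rdvd f g"
proof -
  obtain a where a: "c = [:a:]" using assms(2) by (metis degree_eq_zeroE)
  then have "a \<noteq> 0" using assms by auto
  then have "g = [:inverse a:] \<star> f" using assms a by simp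
  then show ?thesis unfolding rdvd_def by blast
qed

text \<open>\<open>Rf\<close> is a maximal left ideal: the generator \<open>g\<close> of
  \<open>Rf + Ru\<close> divides \<open>f\<close> from the right, so it is a constant, and 1 is in
  the sum, or an associate of \<open>f\<close>, which would put \<open>u\<close> into
  \<open>Rf\<close>.\<close>

lemma skew_irreducible_inverse:
  assumes f: "skew_irreducible f" and u: "\<not> rdvd f u"
  shows "\<exists>b. rdvd f (b \<star> u - 1)"
proof -
  define I where "I = {a \<star> f + b \<star> u |a b. True}"
  have I: "left_ideal I" unfolding left_ideal_def
  proof (intro conjI ballI allI)
    show "0 \<in> I" unfolding I_def by (rule CollectI, rule exI[of _ 0], rule exI[of _ 0]) simp
  next
    fix p q assume "p \<in> I" "q \<in> I"
    then obtain a b a' b' where e: "p = a \<star> f + b \<star> u" "q = a' \<star> f + b' \<star> u" unfolding I_def by blast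
    have "p + q = (a + a') \<star> f + (b + b') \<star> u" by (simp add: e add_skew)
    then show "p + q \<in> I" unfolding I_def by blast
  next
    fix p r assume "p \<in> I"
    then obtain a b where e: "p = a \<star> f + b \<star> u" unfolding I_def by blast
    have "r \<star> p = (r \<star> a) \<star> f + (r \<star> b) \<star> u" by (simp add: e skew_add skew_assoc)
    then show "r \<star> p \<in> I" unfolding I_def by blast
  qed
  have "f = 1 \<star> f + 0 \<star> u" "u = 0 \<star> f + 1 \<star> u" by simp_all
  then have fI: "f \<in> I" and uI: "u \<in> I" unfolding I_def by blast+
  have f0: "f \<noteq> 0" using f by (auto simp: skew_irreducible_def)
  obtain g where g: "lead_coeff g = 1" "\<And>r. r \<in> I \<longleftrightarrow> rdvd g r"
    using left_ideal_principal[OF I fI f0] by blast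
  have "rdvd g f" using fI g(2) by simp
  then obtain c where c: "f = c \<star> g" unfolding rdvd_def by blast
  from skew_irreducible_factor[OF f c] consider "degree c = 0" | "degree g = 0" by auto
  then show ?thesis
  proof cases
    case 1
    have "rdvd f u" using rdvd_trans[OF rdvd_cofactor_const[OF c 1 f0]] uI g(2) by blast
    with u show ?thesis by simp
  next
    case 2
    have "g \<noteq> 0" using g(1) by auto
    then have "1 \<in> I" unfolding g(2) using rdvd_const[OF 2] by blast
    then obtain a b where ab: "1 = a \<star> f + b \<star> u" unfolding I_def by blast
    have "b \<star> u - 1 = - (a \<star> f)" unfolding ab by simp
    then show ?thesis using rdvd_minus[OF rdvd_skew[of f a]] by metis
  qed
qed

lemma annihilator_generator:
  assumes "f \<noteq> 0"
  shows "\<exists>p. lead_coeff p = 1 \<and> degree p \<le> degree f \<and> (\<forall>r. rdvd f (r \<star> u) \<longleftrightarrow> rdvd p r)"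
proof -
  let ?I = "{r. rdvd f (r \<star> u)}"
  have I: "left_ideal ?I"
    unfolding left_ideal_def by (auto simp: add_skew skew_assoc intro: rdvd_add rdvd_mult)
  obtain r0 where r0: "r0 \<noteq> 0" "degree r0 \<le> degree f" "r0 \<in> ?I"
    using common_left_multiple[OF assms] by blast
  obtain p where p: "lead_coeff p = 1" "\<And>r. r \<in> ?I \<longleftrightarrow> rdvd p r"
    using left_ideal_principal[OF I r0(3,1)] by blast
  have "degree p \<le> degree f" using rdvd_degree_le[of p r0] p(2) r0 by (metis le_trans)
  then show ?thesis using p by blast
qed

text \<open>\<open>R/Rp\<close> is isomorphic to the simple module \<open>R/Rf\<close> through
  multiplication by \<open>u\<close>. Both inequalities come from
  \<open>common_left_multiple\<close>, for \<open>u\<close> modulo \<open>f\<close> and for its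
  inverse \<open>b\<close> modulo \<open>p\<close>.\<close>

lemma annihilator_degree:
  assumes f: "skew_irreducible f" and u: "\<not> rdvd f u"
    and p: "lead_coeff p = 1" "\<And>r. rdvd f (r \<star> u) \<longleftrightarrow> rdvd p r"
  shows "degree p = degree f"
proof (rule antisym)
  have f0: "f \<noteq> 0" using f by (auto simp: skew_irreducible_def)
  obtain r0 where "r0 \<noteq> 0" "degree r0 \<le> degree f" "rdvd f (r0 \<star> u)"
    using common_left_multiple[OF f0] by blast
  then show "degree p \<le> degree f" using rdvd_degree_le[of p r0] p(2) by simp
  obtain b where b: "rdvd f (b \<star> u - 1)" using skew_irreducible_inverse[OF f u] by blast
  have "p \<noteq> 0" using p(1) by auto
  then obtain r1 where r1: "r1 \<noteq> 0" "degree r1 \<le> degree p" "rdvd p (r1 \<star> b)"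
    using common_left_multiple[of p b] by blast
  \<comment> \<open>Since \<open>b u\<close> is 1 modulo \<open>f\<close>, this makes
    \<open>r1\<close> itself a multiple of \<open>f\<close>.\<close>
  then have "rdvd f ((r1 \<star> b) \<star> u)" using p(2) by blast
  then have "rdvd f (r1 \<star> (b \<star> u))" by (simp only: skew_assoc)
  moreover have "rdvd f (r1 \<star> (b \<star> u) - r1)" using rdvd_mult[OF b, of r1] by (simp add: skew_diff)
  ultimately have "rdvd f r1" using rdvd_congr by blast
  then show "degree f \<le> degree p" using rdvd_degree_le r1 by fastforce
qed

text \<open>The annihilator of the nonzero element \<open>u\<close> of \<open>R/Rg\<close> is some
  \<open>Rp\<close> with \<open>degree p = degree g\<close>; the irreducible \<open>f\<close> lies
  in it and so is an associate of \<open>p\<close>.\<close>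

lemma skew_irreducible_degree_eq:
  assumes f: "skew_irreducible f" and g: "skew_irreducible g"
    and u: "rdvd g (f \<star> u)" "\<not> rdvd g u"
  shows "degree f = degree g"
proof -
  have g0: "g \<noteq> 0" and f0: "f \<noteq> 0" using f g by (auto simp: skew_irreducible_def)
  obtain p where p: "lead_coeff p = 1" "\<And>r. rdvd g (r \<star> u) \<longleftrightarrow> rdvd p r"
    using annihilator_generator[OF g0] by blast
  have p0: "p \<noteq> 0" using p(1) by auto
  have dp: "degree p = degree g" using annihilator_degree[OF g u(2) p] .
  have "rdvd p f" using u(1) p(2) by simp
  then obtain c where c: "f = c \<star> p" unfolding rdvd_def by blast
  from skew_irreducible_factor[OF f c] consider "degree c = 0" | "degree p = 0" by auto
  then show ?thesis
  proof cases
    case 1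
    have "c \<noteq> 0" using c f0 by auto
    then show ?thesis using c 1 dp p0 by (simp add: degree_skew)
  next
    case 2
    then show ?thesis using dp g by (simp add: skew_irreducible_def)
  qed
qed

section \<open>The eigenring and independence\<close>

text \<open>The representatives of the elements of the eigenring, without the bound on the degree.\<close>

definition idealizer :: "'a poly \<Rightarrow> 'a poly set" where
  "idealizer f = {e. rdvd f (f \<star> e)}"

text \<open>Right multiplication by \<open>e\<close> descends to \<open>R/Rf\<close>: the idealizer
  acts on this module by endomorphisms.\<close>

lemma idealizer_rdvd: "e \<in> idealizer f \<Longrightarrow> rdvd f a \<Longrightarrow> rdvd f (a \<star> e)"
  unfolding idealizer_def by (auto simp: rdvd_def[of f a] skew_assoc intro: rdvd_mult)

lemma idealizer_0 [simp]: "0 \<in> idealizer f"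
  and idealizer_1 [simp]: "1 \<in> idealizer f"
  and idealizer_add: "a \<in> idealizer f \<Longrightarrow> b \<in> idealizer f \<Longrightarrow> a + b \<in> idealizer f"
  and idealizer_minus: "a \<in> idealizer f \<Longrightarrow> - a \<in> idealizer f"
  and idealizer_skew: "a \<in> idealizer f \<Longrightarrow> b \<in> idealizer f \<Longrightarrow> a \<star> b \<in> idealizer f"
  and idealizer_multiple: "rdvd f a \<Longrightarrow> a \<in> idealizer f"
     apply (simp_all add: idealizer_def skew_add skew_minus rdvd_add rdvd_minus rdvd_mult)
  by (metis idealizer_def idealizer_rdvd mem_Collect_eq skew_assoc)

lemma idealizer_diff: "a \<in> idealizer f \<Longrightarrow> b \<in> idealizer f \<Longrightarrow> a - b \<in> idealizer f"
  using idealizer_add[of a f "- b"] idealizer_minus[of b f] by simp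

lemma idealizer_sum: "(\<And>i. i \<in> I \<Longrightarrow> g i \<in> idealizer f) \<Longrightarrow> sum g I \<in> idealizer f"
  by (induction I rule: infinite_finite_induct) (auto intro: idealizer_add)

text \<open>Schur's argument: \<open>v\<close> generates the simple module, so an endomorphism that
  kills \<open>v\<close> kills 1 and is zero.\<close>

lemma idealizer_no_zero_divisors:
  assumes f: "skew_irreducible f" and e: "e \<in> idealizer f" and ve: "rdvd f (v \<star> e)" and v: "\<not> rdvd f v"
  shows "rdvd f e"
proof -
  obtain b where b: "rdvd f (b \<star> v - 1)" using skew_irreducible_inverse[OF f v] by blast
  have "rdvd f ((b \<star> v - 1) \<star> e)" using idealizer_rdvd[OF e b] .
  moreover have "rdvd f (b \<star> (v \<star> e))" using rdvd_mult[OF ve] .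
  ultimately have "rdvd f (b \<star> (v \<star> e) - (b \<star> v - 1) \<star> e)" by (intro rdvd_diff)
  then show ?thesis by (simp add: diff_skew skew_assoc)
qed

lemma idealizer_left_inverse:
  assumes f: "skew_irreducible f" and e: "e \<in> idealizer f" "\<not> rdvd f e"
  shows "\<exists>b\<in>idealizer f. rdvd f (b \<star> e - 1)"
proof -
  obtain b where b: "rdvd f (b \<star> e - 1)" using skew_irreducible_inverse[OF f e(2)] by blast
  have "rdvd f (f \<star> (b \<star> e - 1))" using rdvd_mult[OF b] .
  then have "rdvd f ((f \<star> b) \<star> e - f)" by (simp add: skew_diff skew_assoc)
  then have "rdvd f ((f \<star> b) \<star> e)" using rdvd_congr rdvd_refl by blast
  then have "rdvd f (f \<star> b)" using idealizer_no_zero_divisors[OF f e(1)] e(2) by blast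
  then show ?thesis using b unfolding idealizer_def by blast
qed

text \<open>Unlike in \<open>skew_irreducible_inverse\<close>, the inverse stands on the right: the
  left inverse \<open>b\<close> has a left inverse \<open>c\<close> of its own, and \<open>c\<close>
  is congruent to \<open>e\<close>.\<close>

lemma idealizer_inverse:
  assumes f: "skew_irreducible f" and e: "e \<in> idealizer f" "\<not> rdvd f e"
  shows "\<exists>b\<in>idealizer f. rdvd f (e \<star> b - 1)"
proof -
  obtain b where b: "b \<in> idealizer f" "rdvd f (b \<star> e - 1)"
    using idealizer_left_inverse[OF f e] by blast
  have "\<not> rdvd f b"
  proof
    assume "rdvd f b"
    then have "rdvd f 1" using rdvd_congr[OF b(2)] idealizer_rdvd[OF e(1)] rdvd_diff[OF _ b(2)] by fastforce
    then show False using skew_irreducible_not_rdvd_1[OF f] by simp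
  qed
  then obtain c where c: "rdvd f (c \<star> b - 1)"
    using idealizer_left_inverse[OF f b(1)] by blast
  have "rdvd f ((c \<star> b - 1) \<star> e - c \<star> (b \<star> e - 1))"
    using idealizer_rdvd[OF e(1) c] rdvd_mult[OF b(2)] by (intro rdvd_diff)
  then have "rdvd f (c - e)" by (simp add: diff_skew skew_diff skew_assoc)
  then have "rdvd f ((c - e) \<star> b)" using idealizer_rdvd[OF b(1)] by blast
  then have "rdvd f ((c \<star> b - 1) - (c - e) \<star> b)" by (rule rdvd_diff[OF c])
  also have "(c \<star> b - 1) - (c - e) \<star> b = e \<star> b - 1" by (simp add: diff_skew)
  finally show ?thesis using b(1) by blast
qed

text \<open>Independence in the right space \<open>R/Rf\<close>. The coefficients are unreduced, so
  one of them counts as zero when \<open>f\<close> divides it.\<close>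

definition independent_mod :: "'a poly \<Rightarrow> ('i \<Rightarrow> 'a poly) \<Rightarrow> 'i set \<Rightarrow> bool" where
  "independent_mod f v J \<longleftrightarrow> (\<forall>c. (\<forall>j\<in>J. c j \<in> idealizer f) \<and> rdvd f (\<Sum>j\<in>J. v j \<star> c j)
     \<longrightarrow> (\<forall>j\<in>J. rdvd f (c j)))"

definition in_span_mod :: "'a poly \<Rightarrow> ('i \<Rightarrow> 'a poly) \<Rightarrow> 'i set \<Rightarrow> 'a poly \<Rightarrow> bool" where
  "in_span_mod f v J w \<longleftrightarrow> (\<exists>c. (\<forall>j\<in>J. c j \<in> idealizer f) \<and> rdvd f (w - (\<Sum>j\<in>J. v j \<star> c j)))"

lemma independent_mod_subset:
  assumes "independent_mod f v J" "I \<subseteq> J" "finite J"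
  shows "independent_mod f v I"
  unfolding independent_mod_def
proof (intro allI impI)
  fix c assume c: "(\<forall>j\<in>I. c j \<in> idealizer f) \<and> rdvd f (\<Sum>j\<in>I. v j \<star> c j)"
  define c' where "c' j = (if j \<in> I then c j else 0)" for j
  have "(\<Sum>j\<in>J. v j \<star> c' j) = (\<Sum>j\<in>I. v j \<star> c j)"
    using assms by (intro sum.mono_neutral_cong_right) (auto simp: c'_def)
  moreover have "\<forall>j\<in>J. c' j \<in> idealizer f" using c by (auto simp: c'_def)
  ultimately have "\<forall>j\<in>J. rdvd f (c' j)" using assms(1) c unfolding independent_mod_def by metis
  then show "\<forall>j\<in>I. rdvd f (c j)" using assms(2) by (auto simp: c'_def subset_iff split: if_splits)
qed

text \<open>A coefficient of \<open>v j\<close> that \<open>f\<close> does not divide is invertible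
  in the eigenring, so the relation could be solved for \<open>v j\<close>.\<close>

lemma independent_mod_insert:
  assumes f: "skew_irreducible f" and J: "finite J" "j \<notin> J"
    and ind: "independent_mod f v J" and ns: "\<not> in_span_mod f v J (v j)"
  shows "independent_mod f v (insert j J)"
  unfolding independent_mod_def
proof (intro allI impI)
  fix c assume c: "(\<forall>i\<in>insert j J. c i \<in> idealizer f) \<and> rdvd f (\<Sum>i\<in>insert j J. v i \<star> c i)"
  then have s: "rdvd f (v j \<star> c j + (\<Sum>i\<in>J. v i \<star> c i))" using J by simp
  have cj: "rdvd f (c j)"
  proof (rule ccontr)
    assume "\<not> rdvd f (c j)"
    then obtain b where b: "b \<in> idealizer f" "rdvd f (c j \<star> b - 1)"
      using idealizer_inverse[OF f] c by blast
    have "rdvd f ((v j \<star> c j + (\<Sum>i\<in>J. v i \<star> c i)) \<star> b - v j \<star> (c j \<star> b - 1))"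
      using idealizer_rdvd[OF b(1) s] rdvd_mult[OF b(2)] by (intro rdvd_diff)
    then have "rdvd f (v j - (\<Sum>i\<in>J. v i \<star> (- (c i \<star> b))))"
      by (simp add: add_skew skew_diff skew_assoc sum_skew skew_minus sum_negf algebra_simps)
    moreover have "\<forall>i\<in>J. - (c i \<star> b) \<in> idealizer f"
      using c b(1) by (auto intro: idealizer_minus idealizer_skew)
    ultimately have "in_span_mod f v J (v j)"
      unfolding in_span_mod_def by (intro exI[of _ "\<lambda>i. - (c i \<star> b)"]) simp
    with ns show False by simp
  qed
  then have "rdvd f (\<Sum>i\<in>J. v i \<star> c i)" using rdvd_diff[OF s rdvd_mult[OF cj, of "v j"]] by simp
  then show "\<forall>i\<in>insert j J. rdvd f (c i)" using ind c cj unfolding independent_mod_def by auto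
qed

lemma independent_mod_not_in_span:
  assumes f: "skew_irreducible f" and J: "finite J" "j \<notin> J"
    and ind: "independent_mod f v (insert j J)"
  shows "\<not> in_span_mod f v J (v j)"
proof
  assume "in_span_mod f v J (v j)"
  then obtain c where c: "\<forall>i\<in>J. c i \<in> idealizer f" "rdvd f (v j - (\<Sum>i\<in>J. v i \<star> c i))"
    unfolding in_span_mod_def by blast
  define c' where "c' = c(j := - 1)"
  have "(\<Sum>i\<in>J. v i \<star> c' i) = (\<Sum>i\<in>J. v i \<star> c i)"
    using J by (intro sum.cong) (auto simp: c'_def)
  then have "(\<Sum>i\<in>insert j J. v i \<star> c' i) = - (v j - (\<Sum>i\<in>J. v i \<star> c i))"
    using J by (simp add: c'_def skew_minus)
  then have "rdvd f (\<Sum>i\<in>insert j J. v i \<star> c' i)" using rdvd_minus[OF c(2)] by simp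
  moreover have "\<forall>i\<in>insert j J. c' i \<in> idealizer f"
    using c(1) by (auto simp: c'_def intro: idealizer_minus)
  ultimately have "rdvd f (c' j)" using ind unfolding independent_mod_def by blast
  then have "rdvd f 1" using rdvd_minus[of f "- 1"] by (simp add: c'_def)
  then show False using skew_irreducible_not_rdvd_1[OF f] by simp
qed

text \<open>The density theorem for \<open>R/Rf\<close>.  In the induction step, \<open>u = g v\<^sub>j\<close> has an inverse \<open>b\<close> modulo
  \<open>f\<close>, and the coefficient of \<open>v\<^sub>j\<close> in \<open>w\<close> is \<open>b g w\<close>.\<close>

lemma annihilator_of_independent:
  assumes f: "skew_irreducible f" and "finite J" "independent_mod f v J"
  shows "\<exists>g. lead_coeff g = 1 \<and> degree g = card J * degree f \<and>
           (\<forall>r. (\<forall>j\<in>J. rdvd f (r \<star> v j)) \<longleftrightarrow> rdvd g r) \<and>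
           (\<forall>w. rdvd f (g \<star> w) \<longrightarrow> in_span_mod f v J w)"
  using assms(2,3)
proof (induction J rule: finite_induct)
  case empty
  have "rdvd 1 r" for r unfolding rdvd_def by (metis skew_one)
  then show ?case by (intro exI[of _ 1]) (auto simp: in_span_mod_def)
next
  case (insert j J)
  have f0: "f \<noteq> 0" using f by (auto simp: skew_irreducible_def)
  have indJ: "independent_mod f v J" using independent_mod_subset[OF insert.prems] insert.hyps by blast
  obtain g where g: "lead_coeff g = 1" "degree g = card J * degree f"
    "\<And>r. (\<forall>j\<in>J. rdvd f (r \<star> v j)) \<longleftrightarrow> rdvd g r"
    "\<And>w. rdvd f (g \<star> w) \<Longrightarrow> in_span_mod f v J w"
    using insert.IH[OF indJ] by blast
  define u where "u = g \<star> v j"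
  have u: "\<not> rdvd f u"
    using g(4)[of "v j"] independent_mod_not_in_span[OF f insert.hyps insert.prems] unfolding u_def by blast
  obtain p where p: "lead_coeff p = 1" "\<And>r. rdvd f (r \<star> u) \<longleftrightarrow> rdvd p r"
    using annihilator_generator[OF f0] by blast
  have dp: "degree p = degree f" using annihilator_degree[OF f u p] .
  have nz: "p \<noteq> 0" "g \<noteq> 0" using p(1) g(1) by auto
  have "lead_coeff (p \<star> g) = 1" using p(1) g(1) by (simp add: lead_coeff_skew_mult)
  moreover have "degree (p \<star> g) = card (insert j J) * degree f"
    using nz insert.hyps by (simp add: degree_skew dp g(2))
  moreover have "(\<forall>i\<in>insert j J. rdvd f (r \<star> v i)) \<longleftrightarrow> rdvd (p \<star> g) r" for r
  proof
    assume a: "\<forall>i\<in>insert j J. rdvd f (r \<star> v i)"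
    then obtain q where q: "r = q \<star> g" using g(3)[of r] unfolding rdvd_def by auto
    then have "rdvd f (q \<star> u)" using a by (simp add: u_def skew_assoc)
    then have "rdvd p q" using p(2) by blast
    then obtain q' where "q = q' \<star> p" unfolding rdvd_def by blast
    then show "rdvd (p \<star> g) r" unfolding q rdvd_def by (metis skew_assoc)
  next
    assume "rdvd (p \<star> g) r"
    then obtain q where q: "r = (q \<star> p) \<star> g" unfolding rdvd_def by (metis skew_assoc)
    then have "\<forall>i\<in>J. rdvd f (r \<star> v i)" using g(3)[of r] by simp
    moreover have "rdvd f ((q \<star> p) \<star> u)" using p(2) rdvd_skew by blast
    then have "rdvd f (r \<star> v j)" by (simp add: q u_def skew_assoc)
    ultimately show "\<forall>i\<in>insert j J. rdvd f (r \<star> v i)" by simp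
  qed
  moreover have "in_span_mod f v (insert j J) w" if w: "rdvd f ((p \<star> g) \<star> w)" for w
  proof -
    obtain b where b: "rdvd f (b \<star> u - 1)" using skew_irreducible_inverse[OF f u] by blast
    define e where "e = b \<star> (g \<star> w)"
    have pw: "rdvd f (q \<star> (g \<star> w))" if "rdvd p q" for q
      using that rdvd_mult[OF w] by (auto simp: rdvd_def[of p q] skew_assoc)
    \<comment> \<open>\<open>f b\<close> annihilates \<open>u\<close>, so it lies in
      \<open>Rp\<close>, and all of \<open>Rp\<close> kills \<open>g w\<close> as well. Hence
      \<open>f e\<close> lies in \<open>Rf\<close>, as the idealizer requires.\<close>
    have "rdvd f (f \<star> (b \<star> u - 1))" using rdvd_mult[OF b] .
    then have "rdvd f ((f \<star> b) \<star> u - f)" by (simp add: skew_diff skew_assoc)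
    then have "rdvd f ((f \<star> b) \<star> u)" using rdvd_congr rdvd_refl by blast
    then have "rdvd p (f \<star> b)" by (simp only: p(2))
    then have "rdvd f (f \<star> e)" using pw[of "f \<star> b"] by (simp add: e_def skew_assoc)
    then have e: "e \<in> idealizer f" by (simp add: idealizer_def)
    \<comment> \<open>In the same way \<open>1 - u b\<close> annihilates \<open>u\<close> and
      therefore \<open>g w\<close>. This says that \<open>g\<close> kills
      \<open>w - v j \<star> e\<close>, to which the induction hypothesis applies.\<close>
    have "rdvd f (u \<star> (1 - b \<star> u))" using rdvd_mult[OF rdvd_minus[OF b], of u] by simp
    then have "rdvd f ((1 - u \<star> b) \<star> u)" by (simp add: skew_diff diff_skew skew_assoc)
    then have "rdvd f ((1 - u \<star> b) \<star> (g \<star> w))" using pw p(2) by blast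
    then have "rdvd f (g \<star> (w - v j \<star> e))"
      by (simp add: diff_skew skew_diff skew_assoc u_def e_def)
    then obtain c where c: "\<forall>i\<in>J. c i \<in> idealizer f" "rdvd f (w - v j \<star> e - (\<Sum>i\<in>J. v i \<star> c i))"
      using g(4) unfolding in_span_mod_def by blast
    define c' where "c' = c(j := e)"
    have "(\<Sum>i\<in>J. v i \<star> c' i) = (\<Sum>i\<in>J. v i \<star> c i)"
      using insert.hyps by (intro sum.cong) (auto simp: c'_def)
    then have "w - (\<Sum>i\<in>insert j J. v i \<star> c' i) = w - v j \<star> e - (\<Sum>i\<in>J. v i \<star> c i)"
      using insert.hyps by (simp add: c'_def)
    then have "rdvd f (w - (\<Sum>i\<in>insert j J. v i \<star> c' i))" by (simp only: c(2))
    moreover have "\<forall>i\<in>insert j J. c' i \<in> idealizer f" using c(1) e by (auto simp: c'_def)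
    ultimately show ?thesis unfolding in_span_mod_def by blast
  qed
  ultimately show ?case by blast
qed

end

section \<open>Central polynomials and two-sided ideals\<close>

context cyclic_galois
begin

abbreviation in_xn :: "'a poly \<Rightarrow> 'a poly" where "in_xn q \<equiv> poly_in_xn q n"

lemma coeff_in_xn: "coeff (in_xn q) k = (if n dvd k then coeff q (k div n) else 0)"
proof -
  have "coeff (in_xn q) (n * (k div n) + k mod n) = (if k mod n = 0 then coeff q (k div n) else 0)"
    unfolding poly_in_xn_def by (rule coeff_pcompose_monom) (use n_pos in simp)
  then show ?thesis by (simp add: dvd_eq_mod_eq_0)
qed

lemma in_xn_add: "in_xn (p + q) = in_xn p + in_xn q"
  by (simp add: poly_in_xn_def pcompose_add)

lemma in_xn_monom: "in_xn (monom a i) = monom a (n * i)"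
  using n_pos by (intro poly_eqI) (auto simp: coeff_in_xn, metis dvd_triv_left)

lemma in_xn_zero [simp]: "in_xn 0 = 0"
  by (simp add: poly_in_xn_def)

lemma in_xn_one [simp]: "in_xn 1 = 1"
  by (simp add: poly_in_xn_def pcompose_1)

lemma in_xn_mult: "in_xn (p * q) = in_xn p \<star> in_xn q"
proof (induction p rule: poly_monom_induct)
  case (monom a i)
  show ?case
  proof (induction q rule: poly_monom_induct)
    case (monom b j)
    show ?case by (simp add: mult_monom in_xn_monom distrib_left)
  qed (auto simp: in_xn_add skew_add distrib_left)
qed (auto simp: in_xn_add add_skew distrib_right)

lemma degree_in_xn: "degree (in_xn q) = n * degree q"
  using n_pos by (simp add: poly_in_xn_def degree_pcompose degree_monom_eq)

lemma in_xn_eq_0_iff [simp]: "in_xn q = 0 \<longleftrightarrow> q = 0"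
proof
  assume "in_xn q = 0"
  then have "coeff q k = 0" for k using coeff_in_xn[of q "n * k"] n_pos by simp
  then show "q = 0" by (intro poly_eqI) simp
qed simp

lemma coeff_0_in_xn: "coeff (in_xn q) 0 = coeff q 0"
  by (simp add: coeff_in_xn)

definition K_poly :: "'a poly \<Rightarrow> bool" where "K_poly q \<longleftrightarrow> (\<forall>i. coeff q i \<in> K)"

lemma K_poly_iff: "K_poly q \<longleftrightarrow> map_poly \<sigma> q = q"
  by (auto simp: K_poly_def mem_K_iff poly_eq_iff coeff_map_poly)

lemma in_xn_central:
  assumes "K_poly q"
  shows "in_xn q \<star> p = p \<star> in_xn q"
proof (induction p rule: poly_monom_induct)
  case (monom a i)
  have "in_xn q = (\<Sum>j\<le>degree q. monom (coeff q j) (n * j))"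
  proof -
    have "in_xn (\<Sum>j\<in>A. monom (coeff q j) j) = (\<Sum>j\<in>A. monom (coeff q j) (n * j))"
      if "finite A" for A
      using that by (induction A) (auto simp: in_xn_add in_xn_monom)
    from this[of "{..degree q}"] show ?thesis by (simp add: poly_as_sum_of_monoms)
  qed
  moreover have "(\<sigma> ^^ i) (coeff q j) = coeff q j" for i j
    using assms by (intro pow_K) (simp add: K_poly_def)
  moreover have "(\<sigma> ^^ (j * n)) a = a" for j
    using pow_add_n(3)[of j a] by (simp only: mult.commute)
  ultimately show ?case
    by (simp add: sum_skew skew_sum add.commute mult.commute)
qed (auto simp: skew_add add_skew)

text \<open>\<open>K\<close> is the fixed field of \<sigma>, and applying \<sigma> to the
  coefficients commutes with division with remainder.\<close>

lemma K_poly_mod_div: "K_poly p \<Longrightarrow> K_poly q \<Longrightarrow> K_poly (p div q) \<and> K_poly (p mod q)"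
  unfolding K_poly_iff by (simp add: map_poly_div map_poly_mod)

text \<open>For a monic irreducible polynomial a nonzero constant coefficient means
  \<open>F \<noteq> y\<close>. In this form the condition passes to all factors of
  \<open>F(x^n)\<close>, as constant coefficients multiply.\<close>

definition K_irreducible :: "'a poly \<Rightarrow> bool" where
  "K_irreducible F \<longleftrightarrow> K_poly F \<and> lead_coeff F = 1 \<and> 0 < degree F \<and> coeff F 0 \<noteq> 0 \<and>
     (\<forall>a b. K_poly a \<longrightarrow> K_poly b \<longrightarrow> F = a * b \<longrightarrow> degree a = 0 \<or> degree b = 0)"

lemma K_irreducible_factor:
  "K_irreducible F \<Longrightarrow> K_poly a \<Longrightarrow> K_poly b \<Longrightarrow> F = a * b \<Longrightarrow> degree a = 0 \<or> degree b = 0"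
  unfolding K_irreducible_def by (elim conjE allE impE) assumption+

text \<open>With \<open>d = deg h\<close>, the multiples \<open>h c - \<sigma>\<^sup>d(c) h\<close> and \<open>h x - x h\<close> of \<open>h\<close> vanish: the first has
  smaller degree, the second would have to be a constant multiple although its constant term is 0.\<close>

lemma two_sided_generator_central:
  assumes h: "lead_coeff h = 1" "coeff h 0 \<noteq> 0"
    and two: "\<And>a. rdvd h (h \<star> a)"
  shows "\<exists>q. K_poly q \<and> h = in_xn q"
proof -
  define d where "d = degree h"
  have h0: "h \<noteq> 0" using h(1) by auto
  have d1: "coeff h d = 1" using h(1) by (simp add: d_def)
  have scal: "coeff h i * (\<sigma> ^^ i) c = (\<sigma> ^^ d) c * coeff h i" for i c
  proof -
    let ?p = "h \<star> [:c:] - [:(\<sigma> ^^ d) c:] \<star> h"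
    have cp: "coeff ?p i = coeff h i * (\<sigma> ^^ i) c - (\<sigma> ^^ d) c * coeff h i" for i
    proof -
      have "coeff (h \<star> [:c:]) i = (\<Sum>j\<le>i. if j = i then coeff h i * (\<sigma> ^^ i) c else 0)"
        unfolding coeff_skew_mult
        by (intro sum.cong) (auto simp: coeff_pCons split: nat.splits)
      then show ?thesis by simp
    qed
    have "rdvd h ?p" by (intro rdvd_diff two rdvd_skew)
    moreover have "?p = 0 \<or> degree ?p < d"
    proof -
      have "coeff ?p d = 0" unfolding cp d1 by simp
      moreover have "degree ?p \<le> d"
      proof (rule degree_le, intro allI impI)
        fix i assume "d < i"
        then show "coeff ?p i = 0" unfolding cp by (simp add: coeff_eq_0 d_def)
      qed
      ultimately show ?thesis by (metis eq_zero_or_degree_less)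
    qed
    ultimately have "?p = 0" using rdvd_small unfolding d_def by blast
    then show ?thesis using cp[of i] by simp
  qed
  have comm: "coeff h i = \<sigma> (coeff h i)" for i
  proof -
    let ?x = "monom 1 (Suc 0) :: 'a poly"
    let ?p = "h \<star> ?x - ?x \<star> h"
    have hx: "coeff (h \<star> ?x) k = (if k = 0 then 0 else coeff h (k - 1))" for k
    proof -
      have "coeff (h \<star> ?x) k = (\<Sum>j\<le>k. if Suc j = k then coeff h j else 0)"
        unfolding coeff_skew_mult by (intro sum.cong) auto
      also have "\<dots> = (if k = 0 then 0 else coeff h (k - 1))"
        by (cases k) (auto simp: sum.delta)
      finally show ?thesis .
    qed
    have cp: "coeff ?p k = (if k = 0 then 0 else coeff h (k - 1) - \<sigma> (coeff h (k - 1)))" for k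
      by (auto simp: hx coeff_monom_skew)
    have "rdvd h ?p" by (intro rdvd_diff two rdvd_skew)
    then obtain q where q: "?p = q \<star> h" unfolding rdvd_def by blast
    have "?p = 0"
    proof (rule ccontr)
      assume "?p \<noteq> 0"
      have "degree ?p \<le> d"
      proof (rule degree_le, intro allI impI)
        fix k assume "d < k"
        then consider "k - 1 = d" | "d < k - 1" by linarith
        then show "coeff ?p k = 0" unfolding cp
          by cases (auto simp: d1, auto simp: coeff_eq_0 d_def)
      qed
      moreover have "q \<noteq> 0" using q \<open>?p \<noteq> 0\<close> by auto
      ultimately have "degree q = 0" unfolding q using h0 by (simp add: degree_skew d_def)
      then obtain c where c: "q = [:c:]" by (metis degree_eq_zeroE)
      have "coeff ?p 0 = c * coeff h 0" unfolding q c by simp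
      then have "c = 0" using h(2) cp[of 0] by simp
      then show False using c \<open>q \<noteq> 0\<close> by simp
    qed
    then show ?thesis using cp[of "Suc i"] by simp
  qed
  have dvd: "n dvd i" if "coeff h i \<noteq> 0" for i
  proof -
    \<comment> \<open>The nonzero constant coefficient shows that \<open>\<sigma> ^^ d\<close> is
      the identity; a nonzero coefficient at \<open>i\<close> then makes
      \<open>\<sigma> ^^ i\<close> the identity too.\<close>
    have "(\<sigma> ^^ d) c = c" for c using scal[of 0 c] h(2) by simp
    then have "(\<sigma> ^^ 0) c = (\<sigma> ^^ i) c" for c using scal[of i c] that by simp
    then show ?thesis using pow_inj_mod[of 0 i] by simp
  qed
  define q where "q = Abs_poly (\<lambda>i. coeff h (n * i))"
  have "\<forall>\<^sub>\<infinity>i. coeff h (n * i) = 0"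
    unfolding MOST_nat
  proof (intro exI[of _ d] allI impI)
    fix i assume "d < i"
    moreover have "i \<le> n * i" using n_pos by simp
    ultimately have "degree h < n * i" unfolding d_def by linarith
    then show "coeff h (n * i) = 0" by (rule coeff_eq_0)
  qed
  then have cq: "coeff q i = coeff h (n * i)" for i
    unfolding q_def by (simp add: Abs_poly_inverse)
  have "h = in_xn q" using dvd by (intro poly_eqI) (auto simp: coeff_in_xn cq)
  moreover have "K_poly q" unfolding K_poly_def cq mem_K_iff using comm by simp
  ultimately show ?thesis by blast
qed

text \<open>The generator has the form \<open>q(x^n)\<close> with \<open>q\<close> over
  \<open>K\<close>, which moves the question to the commutative ring \<open>K[y]\<close>:
  \<open>q\<close> divides the irreducible \<open>F\<close>, so only the unit ideal and the ideal of
  \<open>F(x^n)\<close> remain.\<close>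

lemma two_sided_ideal_eq:
  assumes F: "K_irreducible F" and I: "left_ideal I" and two: "\<And>p a. p \<in> I \<Longrightarrow> p \<star> a \<in> I"
    and FI: "in_xn F \<in> I" and "1 \<notin> I"
  shows "r \<in> I \<longleftrightarrow> rdvd (in_xn F) r"
proof -
  have F0: "F \<noteq> 0" and mon: "lead_coeff F = 1" and KF: "K_poly F"
    using F by (auto simp: K_irreducible_def)
  obtain h where h: "lead_coeff h = 1" "\<And>r. r \<in> I \<longleftrightarrow> rdvd h r"
    using left_ideal_principal[OF I FI] F0 by auto
  obtain c where c: "in_xn F = c \<star> h" using FI unfolding h(2) rdvd_def by blast
  have "coeff c 0 * coeff h 0 \<noteq> 0"
    using F coeff_0_in_xn[of F] unfolding K_irreducible_def c coeff_0_skew by auto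
  then have h0: "coeff h 0 \<noteq> 0" by auto
  have "rdvd h (h \<star> a)" for a using two h(2) rdvd_refl by blast
  then obtain q where q: "K_poly q" "h = in_xn q"
    using two_sided_generator_central[OF h(1) h0] by blast
  have q0: "q \<noteq> 0" using q h by auto
  have e: "in_xn F = in_xn (F div q) \<star> in_xn q + in_xn (F mod q)"
    by (simp flip: in_xn_mult in_xn_add)
  have "rdvd h (in_xn F - in_xn (F div q) \<star> h)"
    by (intro rdvd_diff rdvd_skew) (use FI h(2) in simp)
  then have "rdvd (in_xn q) (in_xn (F mod q))" unfolding e q(2) by simp
  have "F mod q = 0"
  proof (rule ccontr)
    assume ne: "F mod q \<noteq> 0"
    then have "n * degree q \<le> n * degree (F mod q)"
      using rdvd_degree_le[OF \<open>rdvd (in_xn q) (in_xn (F mod q))\<close>] by (simp add: degree_in_xn)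
    moreover have "degree (F mod q) < degree q" using degree_mod_less[OF q0, of F] ne by blast
    ultimately show False using n_pos by simp
  qed
  then have Fq: "F = (F div q) * q" by (metis add.right_neutral div_mult_mod_eq)
  then have "degree (F div q) = 0 \<or> degree q = 0"
    using K_poly_mod_div[OF KF q(1)] by (intro K_irreducible_factor[OF F _ q(1)]) auto
  moreover have "degree q \<noteq> 0"
  proof
    assume "degree q = 0"
    then have "rdvd h 1" using rdvd_const[of h] q0 by (simp add: q degree_in_xn)
    then show False using \<open>1 \<notin> I\<close> h(2) by simp
  qed
  ultimately obtain a where a: "F div q = [:a:]" by (metis degree_eq_zeroE)
  then have Fa: "F = smult a q" using Fq by simp
  then have "a \<noteq> 0" using F0 by auto
  have Hh: "in_xn F = smult a h" unfolding Fa q(2) poly_in_xn_def pcompose_smult ..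
  have "rdvd h r = rdvd (in_xn F) r"
  proof
    assume "rdvd h r"
    then obtain b where "r = b \<star> h" unfolding rdvd_def by blast
    also have "h = [:inverse a:] \<star> in_xn F" unfolding Hh using \<open>a \<noteq> 0\<close> by simp
    finally show "rdvd (in_xn F) r" by (metis rdvd_mult rdvd_skew)
  next
    assume "rdvd (in_xn F) r"
    then show "rdvd h r" using rdvd_trans[of h "in_xn F"] rdvd_smult[OF rdvd_refl, of h a] Hh by simp
  qed
  then show ?thesis using h(2) by simp
qed

end

section \<open>The norm of a right divisor of a central irreducible polynomial\<close>

interpretation to_ac: field_hom "to_ac :: 'a::field \<Rightarrow> 'a alg_closure"
  by unfold_locales auto

context cyclic_galois
begin

text \<open>For a root \<open>z\<close> of \<chi>, a polynomial of least degree over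
  \<open>K\<close> vanishing at \<open>z\<close> divides both \<chi> and \<open>F\<close>, hence is
  an associate of \<open>F\<close>, and \<open>F\<close> can be split off. The roots are taken in
  the algebraic closure because \<chi> need not split over the big field.\<close>

lemma K_power_of_roots:
  assumes F: "K_irreducible F" and "K_poly \<chi>" and "lead_coeff \<chi> = 1"
    and "\<And>z. poly (map_poly to_ac \<chi>) z = 0 \<Longrightarrow> poly (map_poly to_ac F) z = 0"
  shows "\<exists>j. \<chi> = F ^ j"
  using assms(2-4)
proof (induction "degree \<chi>" arbitrary: \<chi> rule: less_induct)
  case less
  have F0: "F \<noteq> 0" and mon: "lead_coeff F = 1" and KF: "K_poly F" and dF: "0 < degree F"
    using F by (auto simp: K_irreducible_def)
  show ?case
  proof (cases "degree \<chi> = 0")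
    case True
    then obtain c where "\<chi> = [:c:]" by (metis degree_eq_zeroE)
    then have "\<chi> = F ^ 0" using less.prems(2) by (simp add: one_pCons)
    then show ?thesis by blast
  next
    case False
    interpret m: map_poly_comm_ring_hom "to_ac :: 'a \<Rightarrow> 'a alg_closure" ..
    let ?r = "\<lambda>p :: 'a poly. poly (map_poly to_ac p)"
    have rmult: "?r (p * q) z = ?r p z * ?r q z" and radd: "?r (p + q) z = ?r p z + ?r q z" for p q z
      by (simp_all add: m.hom_mult m.hom_add)
    have "0 < degree (map_poly to_ac \<chi>)" using False by simp
    then obtain z where z: "?r \<chi> z = 0"
      using alg_closed_imp_poly_has_root by blast
    have zF: "?r F z = 0" using less.prems(3)[OF z] .
    obtain G where G: "K_poly G" "G \<noteq> 0" "?r G z = 0"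
      and min: "\<And>G'. K_poly G' \<and> G' \<noteq> 0 \<and> ?r G' z = 0 \<Longrightarrow> degree G \<le> degree G'"
      using ex_has_least_nat[of "\<lambda>G. K_poly G \<and> G \<noteq> 0 \<and> ?r G z = 0" F degree] KF F0 zF by blast
    have Gdvd: "p = (p div G) * G" if "K_poly p" "?r p z = 0" for p
    proof -
      have "?r p z = ?r (p div G) z * ?r G z + ?r (p mod G) z"
        unfolding rmult[symmetric] radd[symmetric] by simp
      then have "?r (p mod G) z = 0" using that G by simp
      moreover have "K_poly (p mod G)" using K_poly_mod_div that G by blast
      ultimately have "p mod G = 0" using min[of "p mod G"] degree_mod_less[OF G(2), of p] by fastforce
      then show ?thesis by (metis add.right_neutral div_mult_mod_eq)
    qed
    have "degree G \<noteq> 0"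
    proof
      assume "degree G = 0"
      then obtain c where "G = [:c:]" by (metis degree_eq_zeroE)
      then show False using G by simp
    qed
    moreover have "degree (F div G) = 0 \<or> degree G = 0"
      using K_poly_mod_div[OF KF G(1)] by (intro K_irreducible_factor[OF F _ G(1) Gdvd[OF KF zF]]) auto
    ultimately obtain c where c: "F div G = [:c:]" by (metis degree_eq_zeroE)
    then have Fc: "F = smult c G" using Gdvd[OF KF zF] by simp
    then have "c \<noteq> 0" using F0 by auto
    then have "\<chi> = smult (inverse c) (\<chi> div G) * F"
      using Gdvd[OF less.prems(1) z] unfolding Fc by simp
    then have "F dvd \<chi>" by (metis dvd_triv_right)
    define q where "q = \<chi> div F"
    have q: "\<chi> = q * F" using \<open>F dvd \<chi>\<close> by (simp add: q_def)
    have q0: "q \<noteq> 0" using q less.prems(2) by auto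
    have "lead_coeff q = 1" using less.prems(2) unfolding q lead_coeff_mult mon by simp
    moreover have "degree q < degree \<chi>" unfolding q using dF q0 F0 by (simp add: degree_mult_eq)
    moreover have "K_poly q" unfolding q_def using K_poly_mod_div less.prems(1) KF by blast
    moreover have "?r F z = 0" if "?r q z = 0" for z
      using less.prems(3)[of z] that unfolding q rmult by simp
    ultimately obtain j where "q = F ^ j" using less.hyps by blast
    then have "\<chi> = F ^ Suc j" unfolding q by simp
    then show ?thesis by blast
  qed
qed

section \<open>Semilinear shift matrices, their determinants and eigenvalues\<close>

text \<open>The matrix, by rows and in the basis of powers of \<open>x\<close>, of left
  multiplication by \<open>x^k\<close> on \<open>R/Ra\<close>. This map is only semilinear with
  respect to \<open>\<sigma> ^^ k\<close>; for \<open>k = 1\<close> the matrix is the companion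
  matrix of a monic \<open>a\<close>.\<close>

definition shift_mat :: "'a poly \<Rightarrow> nat \<Rightarrow> 'a mat" where
  "shift_mat a k = mat (degree a) (degree a)
     (\<lambda>(i, j). coeff (skew_rem \<sigma> (monom 1 (k + i)) a) j)"

lemma shift_mat_carrier [simp]: "shift_mat a k \<in> carrier_mat (degree a) (degree a)"
  "dim_row (shift_mat a k) = degree a" "dim_col (shift_mat a k) = degree a"
  by (simp_all add: shift_mat_def)

lemma skew_rem_expand:
  assumes "0 < degree a"
  shows "skew_rem \<sigma> p a = (\<Sum>q<degree a. monom (coeff (skew_rem \<sigma> p a) q) q)"
proof -
  have "degree (skew_rem \<sigma> p a) \<le> degree a - 1" using skew_rem_spec(1)[OF assms, of p] by simp
  from poly_as_sum_of_monoms'[OF this] have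
    "(\<Sum>q\<le>degree a - 1. monom (coeff (skew_rem \<sigma> p a) q) q) = skew_rem \<sigma> p a" .
  moreover have "{..degree a - 1} = {..<degree a}" using assms by auto
  ultimately show ?thesis by simp
qed

lemma skew_rem_monom_shift:
  assumes d: "0 < degree a"
  shows "skew_rem \<sigma> (monom 1 k \<star> p) a =
    (\<Sum>q<degree a. smult ((\<sigma> ^^ k) (coeff (skew_rem \<sigma> p a) q)) (skew_rem \<sigma> (monom 1 (k + q)) a))"
proof -
  have "rdvd a (monom 1 k \<star> (p - skew_rem \<sigma> p a))"
    using rdvd_mult[OF skew_rem_spec(2)[OF d]] .
  then have "skew_rem \<sigma> (monom 1 k \<star> p) a
      = skew_rem \<sigma> (monom 1 k \<star> skew_rem \<sigma> p a) a"
    by (intro skew_rem_cong[OF d]) (simp add: skew_diff)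
  also have "monom 1 k \<star> skew_rem \<sigma> p a
      = (\<Sum>q<degree a. smult ((\<sigma> ^^ k) (coeff (skew_rem \<sigma> p a) q)) (monom 1 (k + q)))"
    by (subst skew_rem_expand[OF d]) (simp add: skew_sum smult_monom)
  finally show ?thesis by (simp add: skew_rem_sum[OF d] skew_rem_smult[OF d])
qed

text \<open>Composition of semilinear maps: moving \<open>x^k\<close> past the coordinates of
  \<open>x^(l+i)\<close> twists them, and in the row convention the twisted matrix is the left
  factor.\<close>

lemma shift_mat_add:
  assumes d: "0 < degree a"
  shows "shift_mat a (k + l) = map_mat (\<sigma> ^^ k) (shift_mat a l) * shift_mat a k"
proof (rule eq_matI)
  fix i j
  assume "i < dim_row (map_mat (\<sigma> ^^ k) (shift_mat a l) * shift_mat a k)"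
    and "j < dim_col (map_mat (\<sigma> ^^ k) (shift_mat a l) * shift_mat a k)"
  then have ij: "i < degree a" "j < degree a" by simp_all
  have "shift_mat a (k + l) $$ (i, j) = coeff (skew_rem \<sigma> (monom 1 k \<star> monom 1 (l + i)) a) j"
    using ij by (simp add: shift_mat_def add.assoc)
  also have "\<dots> = (\<Sum>q<degree a. (\<sigma> ^^ k) (coeff (skew_rem \<sigma> (monom 1 (l + i)) a) q)
      * coeff (skew_rem \<sigma> (monom 1 (k + q)) a) j)"
    unfolding skew_rem_monom_shift[OF d] by (simp add: coeff_sum)
  also have "\<dots> = (map_mat (\<sigma> ^^ k) (shift_mat a l) * shift_mat a k) $$ (i, j)"
    using ij by (simp add: scalar_prod_def shift_mat_def atLeast0LessThan)
  finally show "shift_mat a (k + l) $$ (i, j) = \<dots>" .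
qed auto

lemma shift_mat_0:
  assumes d: "0 < degree a"
  shows "shift_mat a 0 = 1\<^sub>m (degree a)"
proof (rule eq_matI)
  fix i j assume "i < dim_row (1\<^sub>m (degree a) :: 'a mat)" "j < dim_col (1\<^sub>m (degree a) :: 'a mat)"
  then have ij: "i < degree a" "j < degree a" by simp_all
  then have "skew_rem \<sigma> (monom 1 i) a = monom 1 i"
    by (intro skew_rem_small) (simp add: degree_monom_eq)
  then show "shift_mat a 0 $$ (i, j) = 1\<^sub>m (degree a) $$ (i, j)" using ij by (simp add: shift_mat_def)
qed auto

text \<open>Expansion along column 0, where only the last row contributes: it is the row of
  \<open>x^d - a\<close>, the remainder of \<open>x^d\<close>. Deleting that row and column leaves
  the identity.\<close>

lemma det_shift_mat_1:
  assumes d: "0 < degree a" and a: "lead_coeff a = 1"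
  shows "det (shift_mat a 1) = (- 1) ^ degree a * coeff a 0"
proof -
  define d where "d = degree a"
  define B where "B = shift_mat a 1"
  have d0: "0 < d" using d by (simp add: d_def)
  have B: "B \<in> carrier_mat d d" by (simp add: B_def d_def)
  have row: "B $$ (i, j) = (if j = Suc i then 1 else 0)" if "Suc i < d" "j < d" for i j
  proof -
    have "skew_rem \<sigma> (monom 1 (Suc i)) a = monom 1 (Suc i)"
      using that by (intro skew_rem_small) (simp add: degree_monom_eq d_def)
    then show ?thesis using that by (simp add: B_def shift_mat_def d_def)
  qed
  have last: "B $$ (d - 1, 0) = - coeff a 0"
  proof -
    have "skew_rem \<sigma> (monom 1 d) a = monom 1 d - a"
    proof (rule skew_rem_unique)
      have "coeff (monom 1 d - a) d = 0" using a by (simp add: d_def)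
      moreover have "degree (monom 1 d - a) \<le> d"
        by (intro degree_diff_le degree_monom_le) (simp add: d_def)
      ultimately show "degree (monom 1 d - a) < degree a"
        using d0 unfolding d_def[symmetric] by (metis degree_0 eq_zero_or_degree_less)
    qed auto
    then show ?thesis using d0 by (simp add: B_def shift_mat_def d_def)
  qed
  have "det B = (\<Sum>i<d. B $$ (i, 0) * cofactor B i 0)"
    by (rule laplace_expansion_column[OF B d0])
  also have "\<dots> = (\<Sum>i<d. if i = d - 1 then - coeff a 0 * cofactor B (d - 1) 0 else 0)"
  proof (intro sum.cong refl)
    fix i assume "i \<in> {..<d}"
    then consider "i = d - 1" | "Suc i < d" by fastforce
    then show "B $$ (i, 0) * cofactor B i 0 = (if i = d - 1 then - coeff a 0 * cofactor B (d - 1) 0 else 0)"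
      by cases (use row d0 last in auto)
  qed
  also have "\<dots> = - coeff a 0 * cofactor B (d - 1) 0" using d0 by simp
  also have "mat_delete B (d - 1) 0 = 1\<^sub>m (d - 1)"
    using B by (intro eq_matI) (auto simp: mat_delete_def row)
  then have "cofactor B (d - 1) 0 = (- 1) ^ (d - 1)" by (simp add: cofactor_def)
  also have "- coeff a 0 * (- 1) ^ (d - 1) = (- 1) ^ Suc (d - 1) * coeff a 0" by simp
  finally show ?thesis using d0 unfolding B_def d_def by simp
qed

text \<open>Splitting off one factor \<open>x\<close> twists the determinant of the rest by
  \<sigma>. At \<open>k = n\<close> the product is a norm.\<close>

lemma det_shift_mat:
  assumes "0 < degree a"
  shows "det (shift_mat a k) = (\<Prod>i<k. (\<sigma> ^^ i) (det (shift_mat a 1)))"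
proof (induction k)
  case 0
  then show ?case by (simp add: shift_mat_0[OF assms])
next
  case (Suc k)
  have "det (shift_mat a (1 + k)) = det (map_mat (\<sigma> ^^ 1) (shift_mat a k)) * det (shift_mat a 1)"
    unfolding shift_mat_add[OF assms] by (intro det_mult[of _ "degree a"]) auto
  also have "\<dots> = (\<Prod>i<k. (\<sigma> ^^ Suc i) (det (shift_mat a 1))) * (\<sigma> ^^ 0) (det (shift_mat a 1))"
    by (simp add: hom_det Suc hom_prod)
  also have "\<dots> = (\<Prod>i<Suc k. (\<sigma> ^^ i) (det (shift_mat a 1)))"
    unfolding prod.lessThan_Suc_shift by (simp only: mult.commute)
  finally show ?case by simp
qed

text \<open>An eigenvector for \<open>z\<close> is read as a functional \<psi> on
  \<open>R/Ra\<close> with values in the algebraic closure. It turns left multiplication by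
  \<open>x^n\<close> into multiplication by \<open>z\<close>, hence \<open>F(x^n)\<close> into
  \<open>F(z)\<close>; but \<open>F(x^n)\<close> acts as zero, and \<psi> is not zero.\<close>

lemma char_poly_shift_mat_roots:
  assumes d: "0 < degree a" and F: "K_irreducible F" and aF: "rdvd a (in_xn F)"
    and z: "poly (map_poly to_ac (char_poly (shift_mat a n))) z = 0"
  shows "poly (map_poly to_ac F) z = 0"
proof -
  define T where "T = map_mat to_ac (shift_mat a n)"
  have T: "T \<in> carrier_mat (degree a) (degree a)" by (simp add: T_def)
  have "char_poly T = map_poly to_ac (char_poly (shift_mat a n))"
    unfolding T_def by (rule to_ac.char_poly_hom[OF shift_mat_carrier(1)])
  then have "eigenvalue T z" using z eigenvalue_root_char_poly[OF T] by simp
  then obtain v where v: "v \<in> carrier_vec (degree a)" "v \<noteq> 0\<^sub>v (degree a)" "T *\<^sub>v v = z \<cdot>\<^sub>v v"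
    unfolding eigenvalue_def eigenvector_def using T by auto
  define \<psi> where "\<psi> p = (\<Sum>j<degree a. to_ac (coeff (skew_rem \<sigma> p a) j) * v $ j)" for p
  have psi_add: "\<psi> (p + q) = \<psi> p + \<psi> q" for p q
    unfolding \<psi>_def skew_rem_add[OF d] by (simp add: distrib_right sum.distrib)
  have psi_smult: "\<psi> (smult c p) = to_ac c * \<psi> p" for c p
    unfolding \<psi>_def skew_rem_smult[OF d] by (simp add: sum_distrib_left mult.assoc)
  have psi_0: "\<psi> p = 0" if "rdvd a p" for p
    using that rdvd_skew_rem_iff[OF d] by (simp add: \<psi>_def)
  have psi_sum: "\<psi> (sum g I) = (\<Sum>i\<in>I. \<psi> (g i))" for g and I :: "nat set"
    by (induction I rule: infinite_finite_induct) (auto simp: psi_add psi_0)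
  have psi_rem: "\<psi> (skew_rem \<sigma> p a) = \<psi> p" for p
    unfolding \<psi>_def by (simp add: skew_rem_small[OF skew_rem_spec(1)[OF d]])
  have psi_monom: "\<psi> (monom 1 i) = v $ i" if "i < degree a" for i
  proof -
    have "skew_rem \<sigma> (monom 1 i) a = monom 1 i"
      using that by (intro skew_rem_small) (simp add: degree_monom_eq)
    then have "\<psi> (monom 1 i) = (\<Sum>j<degree a. if i = j then v $ j else 0)"
      unfolding \<psi>_def by (intro sum.cong) auto
    then show ?thesis using that by simp
  qed
  have psi_shift: "\<psi> (monom 1 (n + i)) = z * v $ i" if "i < degree a" for i
  proof -
    have "(T *\<^sub>v v) $ i = \<psi> (monom 1 (n + i))"
      using that v(1) by (simp add: T_def \<psi>_def scalar_prod_def shift_mat_def atLeast0LessThan)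
    then show ?thesis using v(1,3) that by simp
  qed
  have step: "\<psi> (monom 1 n \<star> p) = z * \<psi> p" for p
  proof -
    have "\<psi> (monom 1 n \<star> p) = \<psi> (skew_rem \<sigma> (monom 1 n \<star> p) a)"
      by (rule psi_rem[symmetric])
    \<comment> \<open>Shifting by \<open>n\<close> twists the coordinates by
      \<open>\<sigma> ^^ n\<close>, which is the identity, so no twist remains.\<close>
    also have "\<dots> = (\<Sum>q<degree a. to_ac (coeff (skew_rem \<sigma> p a) q) * \<psi> (monom 1 (n + q)))"
      unfolding skew_rem_monom_shift[OF d] by (simp add: psi_sum psi_smult psi_rem)
    also have "\<dots> = z * \<psi> p" unfolding \<psi>_def[of p] by (simp add: psi_shift sum_distrib_left mult_ac)
    finally show ?thesis .
  qed
  have powers: "\<psi> (monom 1 (n * k) \<star> p) = z ^ k * \<psi> p" for k p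
  proof (induction k arbitrary: p)
    case (Suc k)
    have "monom 1 (n * Suc k) \<star> p = monom 1 n \<star> (monom 1 (n * k) \<star> p)"
      by (simp add: skew_assoc[symmetric])
    then show ?case by (simp add: step Suc mult.assoc)
  qed (simp add: monom_0 one_pCons[symmetric])
  have eval: "\<psi> (in_xn G \<star> p) = poly (map_poly to_ac G) z * \<psi> p" for G p
  proof (induction G rule: poly_monom_induct)
    case (monom b k)
    have "in_xn (monom b k) \<star> p = smult b (monom 1 (n * k) \<star> p)"
      unfolding in_xn_monom smult_skew[symmetric] smult_monom by simp
    then show ?case by (simp add: psi_smult powers to_ac.map_poly_hom_monom poly_monom)
  qed (auto simp: psi_0 in_xn_add add_skew psi_add to_ac.map_poly_hom_add distrib_right)
  obtain i where i: "i < degree a" "v $ i \<noteq> 0"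
    using v(1,2) by (metis (no_types, lifting) carrier_vecD eq_vecI index_zero_vec(1) index_zero_vec(2))
  \<comment> \<open>Divisibility makes left multiples of \<open>F(x^n)\<close> vanish modulo
    \<open>a\<close>; centrality turns the product at hand into one of them.\<close>
  have "in_xn F \<star> monom 1 i = monom 1 i \<star> in_xn F"
    using F by (intro in_xn_central) (simp add: K_irreducible_def)
  then have "\<psi> (in_xn F \<star> monom 1 i) = 0" using psi_0[OF rdvd_mult[OF aF]] by simp
  then show ?thesis using i unfolding eval psi_monom[OF i(1)] by simp
qed

text \<open>The sign stays inside the norm because it belongs to the companion determinant and the
  parity of \<open>n\<close> is open here.\<close>

lemma field_norm_right_divisor:
  assumes F: "K_irreducible F" and a: "lead_coeff a = 1" "0 < degree a" and aF: "rdvd a (in_xn F)"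
  shows "\<exists>j. degree a = degree F * j \<and>
    field_norm K ((- 1) ^ degree a * coeff a 0) = (- 1) ^ degree a * coeff F 0 ^ j"
proof -
  define d where "d = degree a"
  define B where "B = shift_mat a 1"
  define T where "T = shift_mat a n"
  have B: "B \<in> carrier_mat d d" and T: "T \<in> carrier_mat d d" by (simp_all add: B_def T_def d_def)
  have detB: "det B = (- 1) ^ d * coeff a 0" unfolding B_def d_def by (rule det_shift_mat_1[OF a(2,1)])
  obtain c where c: "in_xn F = c \<star> a" using aF unfolding rdvd_def by blast
  have "coeff (in_xn F) 0 \<noteq> 0" using F by (simp add: coeff_0_in_xn K_irreducible_def)
  then have "coeff a 0 \<noteq> 0" unfolding c coeff_0_skew by auto
  then have "det B \<noteq> 0" unfolding detB by simp
  then have "B \<in> Units (ring_mat TYPE('a) d ())" by (rule det_non_zero_imp_unit[OF B])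
  then obtain Q where Q: "Q \<in> carrier_mat d d" "B * Q = 1\<^sub>m d" "Q * B = 1\<^sub>m d"
    unfolding Units_def by (auto simp: ring_mat_def)
  have sT: "map_mat \<sigma> T \<in> carrier_mat d d" using T by simp
  \<comment> \<open>\<open>x^(n+1)\<close> is split as \<open>x x^n\<close> and as
    \<open>x^n x\<close>. The second splitting leaves \<open>B\<close> untwisted, which makes
    \<open>T\<close> similar to its conjugate.\<close>
  have "map_mat (\<sigma> ^^ 1) T * B = shift_mat a (1 + n)"
    unfolding T_def B_def by (rule shift_mat_add[OF a(2), symmetric])
  also have "\<dots> = shift_mat a (n + 1)" by (simp only: add.commute)
  also have "\<dots> = map_mat (\<sigma> ^^ n) B * T"
    unfolding T_def B_def by (rule shift_mat_add[OF a(2)])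
  also have "map_mat (\<sigma> ^^ n) B = B" by (rule eq_matI) auto
  finally have comm: "map_mat \<sigma> T * B = B * T" by simp
  have "map_mat \<sigma> T = map_mat \<sigma> T * (B * Q)" using Q sT by simp
  also have "\<dots> = map_mat \<sigma> T * B * Q" using assoc_mult_mat[OF sT B Q(1)] by simp
  finally have "map_mat \<sigma> T = B * T * Q" unfolding comm .
  then have "similar_mat (map_mat \<sigma> T) T" using B Q T sT by (intro similar_matI[of _ _ B Q d]) auto
  then have "char_poly (map_mat \<sigma> T) = char_poly T" by (rule char_poly_similar)
  then have Kchi: "K_poly (char_poly T)" unfolding K_poly_iff using char_poly_hom[OF T] by simp
  have chi: "degree (char_poly T) = d" "lead_coeff (char_poly T) = 1"
    using degree_monic_char_poly[OF T] by auto
  obtain j where j: "char_poly T = F ^ j"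
    using K_power_of_roots[OF F Kchi chi(2)] char_poly_shift_mat_roots[OF a(2) F aF] unfolding T_def by blast
  have "F \<noteq> 0" using F by (auto simp: K_irreducible_def)
  then have dj: "d = degree F * j" using chi(1) unfolding j by (simp add: degree_power_eq mult.commute)
  have "poly (char_poly T) 0 = det (- (char_matrix T 0))" by (rule char_poly_matrix[OF T])
  also have "- (char_matrix T 0) = (- 1) \<cdot>\<^sub>m T"
    using T by (intro eq_matI) (auto simp: char_matrix_def)
  also have "det ((- 1) \<cdot>\<^sub>m T) = (- 1) ^ d * det T" using T by simp
  also have "det T = field_norm K (det B)"
    unfolding T_def B_def field_norm_eq by (rule det_shift_mat[OF a(2)])
  finally have "coeff F 0 ^ j = (- 1) ^ d * field_norm K (det B)"
    unfolding j by (simp add: poly_power flip: poly_0_coeff_0)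
  then have "(- 1) ^ d * coeff F 0 ^ j = ((- 1) ^ d * (- 1) ^ d) * field_norm K (det B)" by simp
  also have "(- 1 :: 'a) ^ d * (- 1) ^ d = 1" by (simp flip: power_mult_distrib)
  finally show ?thesis using dj unfolding detB d_def by auto
qed

end

section \<open>The simple module \<open>R/Rf\<close>\<close>

context skew_poly
begin

lemma skew_poly_ring_simps [simp]:
  "carrier R = UNIV" "monoid.mult R = skew_mult \<sigma>"
  "add R = (+)" "\<zero>\<^bsub>R\<^esub> = 0" "\<one>\<^bsub>R\<^esub> = 1"
  by (simp_all add: skew_poly_ring_def)

lemma Units_skew_poly_ring: "p \<in> Units R \<longleftrightarrow> degree p = 0 \<and> p \<noteq> 0"
proof
  assume "p \<in> Units R"
  then obtain q where q: "q \<star> p = 1" unfolding Units_def by auto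
  then have "p \<noteq> 0" "q \<noteq> 0" by auto
  then show "degree p = 0 \<and> p \<noteq> 0" using degree_skew[of q p] q by simp
next
  assume p: "degree p = 0 \<and> p \<noteq> 0"
  then obtain c where c: "p = [:c:]" "c \<noteq> 0" by (metis degree_eq_zeroE pCons_0_0)
  have "[:inverse c:] \<star> p = 1" "p \<star> [:inverse c:] = 1"
    using c by (simp_all add: one_pCons)
  then show "p \<in> Units R" unfolding Units_def mem_Collect_eq skew_poly_ring_simps by blast
qed

text \<open>Proper factors in the sense of \<open>properfactor\<close> are left factors. For
  \<open>g = a b\<close>, either \<open>a\<close> is a proper factor and so a unit, or
  \<open>a = g c\<close>, and cancelling \<open>g\<close> gives \<open>c b = 1\<close>.\<close>

lemma ring_irreducible_imp_skew_irreducible: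
  assumes "ring_irreducible\<^bsub>R\<^esub> g"
  shows "skew_irreducible g"
proof -
  have g0: "g \<noteq> 0" and nu: "g \<notin> Units R"
    and pf: "\<And>b. properfactor R b g \<Longrightarrow> b \<in> Units R"
    using assms unfolding ring_irreducible_def Divisibility.irreducible_def by auto
  have "degree a = 0 \<or> degree b = 0" if ab: "g = a \<star> b" for a b
  proof (cases "\<exists>c. a = g \<star> c")
    case True
    then obtain c where c: "a = g \<star> c" by blast
    have "g \<star> (c \<star> b) = g \<star> 1" using ab unfolding c skew_assoc by simp
    then have "c \<star> b = 1" using skew_cancel_left[OF g0] by blast
    moreover from this have "c \<noteq> 0" "b \<noteq> 0" by auto
    ultimately show ?thesis using degree_skew[of c b] by simp
  next
    case False
    then have "properfactor R a g"
      using ab unfolding properfactor_def factor_def by auto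
    from pf[OF this] show ?thesis unfolding Units_skew_poly_ring by simp
  qed
  moreover have "0 < degree g" using nu g0 Units_skew_poly_ring[of g] by simp
  ultimately show ?thesis unfolding skew_irreducible_def by blast
qed

end

locale central_factor = cyclic_galois K n \<sigma>
  for K :: "'a::field set" and n \<sigma> +
  fixes F f :: "'a poly" and m :: nat
  assumes F: "K_irreducible F" and f: "skew_irreducible f" and monic_f: "lead_coeff f = 1"
    and f_rdvd: "rdvd f (in_xn F)" and m: "1 < m"
    and factorization: "has_irreducible_factorization R (in_xn F) m"
begin

abbreviation "H \<equiv> in_xn F"

lemma f_nonzero: "f \<noteq> 0"
  using f by (auto simp: skew_irreducible_def)

lemma H_central: "H \<star> p = p \<star> H"
  using F by (intro in_xn_central) (simp add: K_irreducible_def)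

lemma H_nonzero: "H \<noteq> 0"
  using F by (auto simp: K_irreducible_def)

text \<open>The annihilator of the whole module \<open>R/Rg\<close> is two-sided, contains the
  central \<open>H\<close> and omits 1.\<close>

lemma annihilator_all:
  assumes g: "skew_irreducible g" and gH: "rdvd g H"
  shows "(\<forall>w. rdvd g (r \<star> w)) \<longleftrightarrow> rdvd H r"
proof -
  let ?I = "{r. \<forall>w. rdvd g (r \<star> w)}"
  have "r \<in> ?I \<longleftrightarrow> rdvd H r"
  proof (rule two_sided_ideal_eq[OF F])
    show "left_ideal ?I"
      unfolding left_ideal_def by (auto simp: add_skew skew_assoc intro: rdvd_add rdvd_mult)
    show "p \<star> a \<in> ?I" if "p \<in> ?I" for p a using that by (simp add: skew_assoc)
    show "H \<in> ?I" using rdvd_mult[OF gH] by (simp add: H_central)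
    show "1 \<notin> ?I"
    proof
      assume "1 \<in> ?I"
      then have "rdvd g (1 \<star> 1)" by blast
      then show False using skew_irreducible_not_rdvd_1[OF g] by simp
    qed
  qed
  then show ?thesis by simp
qed

text \<open>With \<open>H = c f\<close>, some nonzero element of \<open>R/Rg\<close> is killed by
  \<open>f\<close>. Otherwise \<open>f c = H\<close> would force \<open>c\<close> to annihilate all
  of \<open>R/Rg\<close> and thus to be a multiple of \<open>H\<close>, although its degree is
  smaller.\<close>

lemma degree_factor:
  assumes g: "skew_irreducible g" and gH: "rdvd g H"
  shows "degree g = degree f"
proof -
  obtain c where c: "H = c \<star> f" using f_rdvd unfolding rdvd_def by blast
  have "(f \<star> c) \<star> f = H \<star> f" unfolding skew_assoc c[symmetric] by (simp only: H_central)
  then have fc: "f \<star> c = H" using skew_cancel_right[OF f_nonzero] by blast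
  have c0: "c \<noteq> 0" using c H_nonzero by auto
  have "\<exists>u. rdvd g (f \<star> u) \<and> \<not> rdvd g u"
  proof (rule ccontr)
    assume *: "\<nexists>u. rdvd g (f \<star> u) \<and> \<not> rdvd g u"
    have "rdvd g (c \<star> w)" for w
    proof -
      have "f \<star> (c \<star> w) = w \<star> H" unfolding skew_assoc[symmetric] fc by (rule H_central)
      then have "rdvd g (f \<star> (c \<star> w))" using rdvd_mult[OF gH] by simp
      then show ?thesis using * by blast
    qed
    then have "rdvd H c" using annihilator_all[OF g gH] by blast
    then have "degree H \<le> degree c" using rdvd_degree_le c0 by blast
    moreover have "degree H = degree c + degree f" unfolding c using c0 f_nonzero by (rule degree_skew)
    ultimately show False using f by (simp add: skew_irreducible_def)
  qed
  then obtain u where "rdvd g (f \<star> u)" "\<not> rdvd g u" by blast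
  from skew_irreducible_degree_eq[OF f g this] show ?thesis by (rule sym)
qed

text \<open>Because \<open>H\<close> is central, its factorization can be rotated cyclically until
  any chosen factor stands at the right; so all factors have the degree of \<open>f\<close>.\<close>

lemma degree_H: "degree H = m * degree f"
proof -
  obtain gs where gs: "length gs = m" "foldr (\<star>) gs 1 = H"
    "\<forall>g\<in>set gs. g \<in> UNIV \<and> ring_irreducible\<^bsub>R\<^esub> g"
    using factorization unfolding has_irreducible_factorization_def skew_poly_ring_simps by blast
  have irr: "skew_irreducible g" if "g \<in> set gs" for g
    using gs(3) that ring_irreducible_imp_skew_irreducible by blast
  have fold: "foldr (\<star>) (xs @ ys) 1 = foldr (\<star>) xs 1 \<star> foldr (\<star>) ys 1" for xs ys
    by (induction xs) (auto simp: skew_assoc)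
  have "rdvd g H" if "g \<in> set gs" for g
  proof -
    obtain xs ys where "gs = xs @ g # ys" using split_list[OF \<open>g \<in> set gs\<close>] by blast
    then have H: "H = foldr (\<star>) xs 1 \<star> (g \<star> foldr (\<star>) ys 1)" (is "H = ?A \<star> (g \<star> ?B)")
      using gs(2) fold[of xs "g # ys"] by simp
    have nz: "g \<star> ?B \<noteq> 0"
    proof
      assume "g \<star> ?B = 0"
      then have "H = 0" unfolding H by simp
      then show False using H_nonzero by simp
    qed
    have "((g \<star> ?B) \<star> ?A) \<star> (g \<star> ?B) = H \<star> (g \<star> ?B)"
      unfolding skew_assoc[of "g \<star> ?B"] H[symmetric] by (simp only: H_central)
    then have e1: "(g \<star> ?B) \<star> ?A = H" using skew_cancel_right[OF nz] by blast
    have "((?B \<star> ?A) \<star> g) \<star> (?B \<star> ?A) = (?B \<star> ?A) \<star> H"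
      unfolding e1[symmetric] by (simp only: skew_assoc)
    also have "\<dots> = H \<star> (?B \<star> ?A)" by (rule H_central[symmetric])
    finally have "((?B \<star> ?A) \<star> g) \<star> (?B \<star> ?A) = H \<star> (?B \<star> ?A)" .
    moreover have "?B \<star> ?A \<noteq> 0"
    proof
      assume BA: "?B \<star> ?A = 0"
      have "H = 0" unfolding e1[symmetric] skew_assoc BA by simp
      then show False using H_nonzero by simp
    qed
    ultimately have "(?B \<star> ?A) \<star> g = H" using skew_cancel_right by blast
    then show ?thesis by (metis rdvd_skew)
  qed
  then have dg: "degree g = degree f \<and> g \<noteq> 0" if "g \<in> set gs" for g
    using degree_factor[OF irr[OF that]] irr[OF that] that by (auto simp: skew_irreducible_def)
  have "degree (foldr (\<star>) xs 1) = length xs * degree f \<and> foldr (\<star>) xs 1 \<noteq> 0"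
    if "set xs \<subseteq> set gs" for xs
    using that
  proof (induction xs)
    case (Cons x xs)
    then have "degree x = degree f" "x \<noteq> 0" using dg[of x] by simp_all
    then show ?case using Cons by (simp add: degree_skew)
  qed simp
  from this[of gs] show ?thesis using gs by simp
qed

text \<open>Counting degrees only gives \<open>m * degree f = n * degree F\<close>. That
  \<open>m\<close> divides \<open>n\<close> comes from the divisibility of \<open>degree f\<close>
  by \<open>degree F\<close> in \<open>field_norm_right_divisor\<close>.\<close>

lemma degree_f: "n = m * (n div m)" "degree f = degree F * (n div m)"
proof -
  obtain j where j: "degree f = degree F * j"
    using field_norm_right_divisor[OF F monic_f skew_irreducible_degree[OF f] f_rdvd] by blast
  have "degree F * n = degree F * (m * j)" using degree_H j by (simp add: degree_in_xn mult_ac)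
  moreover have "0 < degree F" using F by (simp add: K_irreducible_def)
  ultimately have nj: "n = m * j" by simp
  then have "n div m = j" using m by simp
  then show "n = m * (n div m)" "degree f = degree F * (n div m)" using nj j by simp_all
qed

lemma annihilated_rdvd: "rdvd H r \<Longrightarrow> rdvd f (r \<star> w)"
  using annihilator_all[OF f f_rdvd] by blast

section \<open>Independent families and bases of \<open>R/Rf\<close>\<close>

lemma independent_card_le:
  assumes "finite J" "independent_mod f v J"
  shows "card J \<le> m"
proof -
  obtain g where g: "degree g = card J * degree f" "\<And>r. (\<forall>j\<in>J. rdvd f (r \<star> v j)) \<longleftrightarrow> rdvd g r"
    using annihilator_of_independent[OF f assms] by blast
  have "rdvd g H" using g(2)[of H] annihilated_rdvd[OF rdvd_refl] by simp
  from rdvd_degree_le[OF this H_nonzero] have "card J * degree f \<le> m * degree f"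
    unfolding g(1) degree_H .
  then show ?thesis using skew_irreducible_degree[OF f] by simp
qed

text \<open>The annihilator of \<open>m\<close> independent elements divides \<open>H\<close> and
  has its degree, so it is an associate of \<open>H\<close> and kills everything; density then puts
  every \<open>w\<close> into the span.\<close>

lemma independent_spans:
  assumes "finite J" "independent_mod f v J" "card J = m"
  shows "in_span_mod f v J w" and "(\<forall>j\<in>J. rdvd f (r \<star> v j)) \<longleftrightarrow> rdvd H r"
proof -
  obtain g where g: "degree g = card J * degree f" "\<And>r. (\<forall>j\<in>J. rdvd f (r \<star> v j)) \<longleftrightarrow> rdvd g r"
    "\<And>w. rdvd f (g \<star> w) \<Longrightarrow> in_span_mod f v J w"
    using annihilator_of_independent[OF f assms(1,2)] by blast
  have gH: "rdvd g H" using g(2)[of H] annihilated_rdvd[OF rdvd_refl] by simp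
  then obtain c where c: "H = c \<star> g" unfolding rdvd_def by blast
  then have "c \<noteq> 0" "g \<noteq> 0" using H_nonzero by auto
  then have "degree c = 0" using degree_skew[of c g] g(1) assms(3) degree_H c by simp
  then have Hg: "rdvd H g" using rdvd_cofactor_const[OF c _ H_nonzero] by blast
  show "in_span_mod f v J w" by (rule g(3)[OF annihilated_rdvd[OF Hg]])
  show "(\<forall>j\<in>J. rdvd f (r \<star> v j)) \<longleftrightarrow> rdvd H r"
    unfolding g(2) using rdvd_trans[OF gH, of r] rdvd_trans[OF Hg, of r] by blast
qed

text \<open>A maximal independent family of size \<open>j\<close> spans, so its annihilator kills
  the whole module and is a multiple of \<open>H\<close>. Comparing degrees gives
  \<open>m \<le> j\<close>.\<close>

lemma independent_exists: "\<exists>v. independent_mod f v {..<m}"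
proof -
  define P where "P j \<longleftrightarrow> (\<exists>v. independent_mod f v {..<j})" for j :: nat
  have "P 0" by (simp add: P_def independent_mod_def)
  moreover have le: "j \<le> m" if "P j" for j
    using that independent_card_le[of "{..<j}"] unfolding P_def by auto
  ultimately obtain j where j: "P j" and max: "\<And>i. P i \<Longrightarrow> i \<le> j"
    using ex_has_greatest_nat[of P 0 id "Suc m"] by (auto simp: less_Suc_eq_le)
  obtain v where v: "independent_mod f v {..<j}" using j unfolding P_def by blast
  have span: "in_span_mod f v {..<j} w" for w
  proof (rule ccontr)
    assume w: "\<not> in_span_mod f v {..<j} w"
    define v' where "v' = v(j := w)"
    have eq: "(\<Sum>i<j. v' i \<star> c i) = (\<Sum>i<j. v i \<star> c i)" for c
      by (intro sum.cong) (auto simp: v'_def)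
    have "independent_mod f v' {..<j}" using v unfolding independent_mod_def eq .
    moreover have "\<not> in_span_mod f v' {..<j} (v' j)"
      using w unfolding in_span_mod_def eq by (simp add: v'_def)
    ultimately have "independent_mod f v' (insert j {..<j})"
      by (intro independent_mod_insert[OF f]) auto
    then have "P (Suc j)" unfolding P_def by (auto simp: lessThan_Suc)
    then show False using max by fastforce
  qed
  obtain g where g: "degree g = card {..<j} * degree f" "lead_coeff g = 1"
     "\<And>r. (\<forall>i\<in>{..<j}. rdvd f (r \<star> v i)) \<longleftrightarrow> rdvd g r"
    using annihilator_of_independent[OF f _ v] by blast
  have gi: "rdvd f (g \<star> v i)" if "i < j" for i using g(3)[of g] that by simp
  have "rdvd f (g \<star> w)" for w
  proof -
    obtain c where c: "\<forall>i<j. c i \<in> idealizer f" "rdvd f (w - (\<Sum>i<j. v i \<star> c i))"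
      using span[of w] unfolding in_span_mod_def by auto
    have "rdvd f (g \<star> (\<Sum>i<j. v i \<star> c i))"
      unfolding skew_sum skew_assoc[symmetric]
    proof (rule rdvd_sum)
      fix i assume "i \<in> {..<j}"
      then show "rdvd f (g \<star> v i \<star> c i)" using c(1) gi by (intro idealizer_rdvd[of "c i"]) auto
    qed
    moreover have "rdvd f (g \<star> w - g \<star> (\<Sum>i<j. v i \<star> c i))"
      using rdvd_mult[OF c(2), of g] by (simp add: skew_diff)
    ultimately show ?thesis using rdvd_congr by blast
  qed
  then have "rdvd H g" using annihilator_all[OF f f_rdvd] by blast
  moreover have "g \<noteq> 0" using g(2) by auto
  ultimately have "m * degree f \<le> j * degree f" using rdvd_degree_le[of H g] g(1) degree_H by simp
  then have "m \<le> j" using skew_irreducible_degree[OF f] by simp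
  then have "j = m" using le[OF j] by simp
  then show ?thesis using v by blast
qed

text \<open>The annihilator of all members but \<open>v j\<close> does not kill \<open>v j\<close>,
  which is outside their span. Inverting its value there and multiplying by \<open>w j\<close>
  solves the problem at \<open>j\<close> with zeros elsewhere; the solutions are added.\<close>

lemma density:
  assumes J: "finite J" and ind: "independent_mod f v J"
  shows "\<exists>a. \<forall>j\<in>J. rdvd f (a \<star> v j - w j)"
proof -
  have "\<exists>a. rdvd f (a \<star> v j - w j) \<and> (\<forall>i\<in>J-{j}. rdvd f (a \<star> v i))" if j: "j \<in> J" for j
  proof -
    have ins: "insert j (J - {j}) = J" using j by auto
    have "independent_mod f v (J - {j})" using independent_mod_subset[OF ind _ J] by auto
    then obtain g where g: "\<And>r. (\<forall>i\<in>J-{j}. rdvd f (r \<star> v i)) \<longleftrightarrow> rdvd g r"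
        "\<And>w. rdvd f (g \<star> w) \<Longrightarrow> in_span_mod f v (J - {j}) w"
      using annihilator_of_independent[OF f, of "J - {j}" v] J by auto
    have "independent_mod f v (insert j (J - {j}))" unfolding ins by (rule ind)
    then have "\<not> in_span_mod f v (J - {j}) (v j)"
      using J by (intro independent_mod_not_in_span[OF f]) simp_all
    then have "\<not> rdvd f (g \<star> v j)" using g(2) by blast
    then obtain b where b: "rdvd f (b \<star> (g \<star> v j) - 1)" using skew_irreducible_inverse[OF f] by blast
    have "rdvd f ((w j \<star> b \<star> g) \<star> v j - w j)"
      using rdvd_mult[OF b, of "w j"] by (simp add: skew_diff skew_assoc)
    moreover have "\<forall>i\<in>J-{j}. rdvd f ((w j \<star> b \<star> g) \<star> v i)" using g(1) by simp
    ultimately show ?thesis by blast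
  qed
  then obtain a where a: "\<And>j. j \<in> J \<Longrightarrow> rdvd f (a j \<star> v j - w j)"
    "\<And>j i. j \<in> J \<Longrightarrow> i \<in> J \<Longrightarrow> i \<noteq> j \<Longrightarrow> rdvd f (a j \<star> v i)"
    by (metis Diff_iff empty_iff insert_iff)
  have "rdvd f ((\<Sum>i\<in>J. a i) \<star> v j - w j)" if j: "j \<in> J" for j
  proof -
    have "(\<Sum>i\<in>J. a i) \<star> v j - w j = (a j \<star> v j - w j) + (\<Sum>i\<in>J-{j}. a i \<star> v j)"
      using j J by (simp add: sum_skew add_skew sum.remove[of J j])
    moreover have "rdvd f (\<Sum>i\<in>J-{j}. a i \<star> v j)" using a(2) j by (intro rdvd_sum) auto
    ultimately show ?thesis by (simp only: rdvd_add[OF a(1)[OF j]])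
  qed
  then show ?thesis by blast
qed

lemma carrier_eigenring: "g \<in> carrier (eigenring \<sigma> f) \<longleftrightarrow> degree g < degree f \<and> g \<in> idealizer f"
  by (simp add: eigenring_def mem_PIdl_iff idealizer_def)

lemma skew_rem_f: "degree (skew_rem \<sigma> p f) < degree f" "rdvd f (p - skew_rem \<sigma> p f)"
  using skew_rem_spec[OF skew_irreducible_degree[OF f]] by blast+

lemma skew_rem_idealizer: "e \<in> idealizer f \<Longrightarrow> skew_rem \<sigma> e f \<in> carrier (eigenring \<sigma> f)"
  using skew_rem_f[of e] idealizer_diff[OF _ idealizer_multiple[OF skew_rem_f(2)[of e]], of e]
  by (simp add: carrier_eigenring)

lemma carrier_eigenring_rdvd: "e \<in> carrier (eigenring \<sigma> f) \<Longrightarrow> rdvd f e \<Longrightarrow> e = 0"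
  using rdvd_small unfolding carrier_eigenring by blast

text \<open>Reduction modulo \<open>f\<close> passes between idealizer coefficients and reduced
  coordinates; spanning is automatic for \<open>m\<close> independent elements.\<close>

lemma right_basis_iff: "right_basis \<sigma> f m v \<longleftrightarrow> independent_mod f v {..<m}"
proof
  assume b: "right_basis \<sigma> f m v"
  show "independent_mod f v {..<m}" unfolding independent_mod_def
  proof (intro allI impI)
    fix c assume c: "(\<forall>j\<in>{..<m}. c j \<in> idealizer f) \<and> rdvd f (\<Sum>j<m. v j \<star> c j)"
    \<comment> \<open>Two coordinate families for the class of 0, the reduced coefficients and zero;
      they are restricted because uniqueness is about extensional functions.\<close>
    define c1 where "c1 = restrict (\<lambda>i. skew_rem \<sigma> (c i) f) {..<m}"
    define c0 where "c0 = restrict (\<lambda>i. 0 :: 'a poly) {..<m}"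
    have "rdvd f (\<Sum>j<m. v j \<star> (c j - skew_rem \<sigma> (c j) f))"
      using skew_rem_f by (intro rdvd_sum rdvd_mult) auto
    then have "rdvd f ((\<Sum>j<m. v j \<star> c j) - (\<Sum>j<m. v j \<star> c1 j))"
      by (simp add: skew_diff sum_subtractf c1_def)
    from rdvd_congr[OF this] have "rdvd f (\<Sum>j<m. v j \<star> c1 j)" using c by simp
    from rdvd_minus[OF this] have A1: "rdvd f (0 - (\<Sum>j<m. v j \<star> c1 j))" by simp
    have P1: "c1 \<in> {..<m} \<rightarrow>\<^sub>E carrier (eigenring \<sigma> f)"
      using c skew_rem_idealizer unfolding c1_def by auto
    have P0: "c0 \<in> {..<m} \<rightarrow>\<^sub>E carrier (eigenring \<sigma> f)"
      using skew_irreducible_degree[OF f] by (auto simp: c0_def carrier_eigenring)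
    have A0: "rdvd f (0 - (\<Sum>j<m. v j \<star> c0 j))" by (simp add: c0_def)
    have "\<exists>!c. c \<in> {..<m} \<rightarrow>\<^sub>E carrier (eigenring \<sigma> f) \<and> rdvd f (0 - (\<Sum>j<m. v j \<star> c j))"
      using b unfolding right_basis_def mem_PIdl_iff skew_poly_ring_simps by (rule spec)
    then obtain c2 where uniq: "\<And>c. c \<in> {..<m} \<rightarrow>\<^sub>E carrier (eigenring \<sigma> f) \<Longrightarrow>
        rdvd f (0 - (\<Sum>j<m. v j \<star> c j)) \<Longrightarrow> c = c2"
      by (elim ex1E) blast
    have eq: "c1 = c0" unfolding uniq[OF P1 A1] uniq[OF P0 A0] ..
    have "skew_rem \<sigma> (c j) f = 0" if "j < m" for j
    proof -
      have "c1 j = c0 j" unfolding eq ..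
      then show ?thesis using that by (simp add: c0_def c1_def)
    qed
    then show "\<forall>j\<in>{..<m}. rdvd f (c j)"
      using rdvd_skew_rem_iff[OF skew_irreducible_degree[OF f]] by simp
  qed
next
  assume ind: "independent_mod f v {..<m}"
  show "right_basis \<sigma> f m v" unfolding right_basis_def mem_PIdl_iff skew_poly_ring_simps
  proof (intro allI ex_ex1I)
    fix g
    have "in_span_mod f v {..<m} g" by (rule independent_spans(1)[OF _ ind]) simp_all
    then obtain c where c: "\<forall>j\<in>{..<m}. c j \<in> idealizer f" "rdvd f (g - (\<Sum>j<m. v j \<star> c j))"
      unfolding in_span_mod_def by blast
    define c1 where "c1 = restrict (\<lambda>i. skew_rem \<sigma> (c i) f) {..<m}"
    have "rdvd f (\<Sum>j<m. v j \<star> (c j - skew_rem \<sigma> (c j) f))"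
      using skew_rem_f by (intro rdvd_sum rdvd_mult) auto
    then have "rdvd f ((g - (\<Sum>j<m. v j \<star> c j)) + ((\<Sum>j<m. v j \<star> c j) - (\<Sum>j<m. v j \<star> c1 j)))"
      by (intro rdvd_add[OF c(2)]) (simp add: skew_diff sum_subtractf c1_def)
    then have "rdvd f (g - (\<Sum>j<m. v j \<star> c1 j))" by simp
    moreover have "c1 \<in> {..<m} \<rightarrow>\<^sub>E carrier (eigenring \<sigma> f)"
      using c skew_rem_idealizer unfolding c1_def by auto
    ultimately show "\<exists>c. c \<in> {..<m} \<rightarrow>\<^sub>E carrier (eigenring \<sigma> f) \<and> rdvd f (g - (\<Sum>i<m. v i \<star> c i))"
      by blast
  next
    fix g c c'
    assume c: "c \<in> {..<m} \<rightarrow>\<^sub>E carrier (eigenring \<sigma> f) \<and> rdvd f (g - (\<Sum>i<m. v i \<star> c i))"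
      and c': "c' \<in> {..<m} \<rightarrow>\<^sub>E carrier (eigenring \<sigma> f) \<and> rdvd f (g - (\<Sum>i<m. v i \<star> c' i))"
    have "rdvd f ((g - (\<Sum>i<m. v i \<star> c' i)) - (g - (\<Sum>i<m. v i \<star> c i)))"
      by (rule rdvd_diff[OF c'[THEN conjunct2] c[THEN conjunct2]])
    then have "rdvd f (\<Sum>i<m. v i \<star> (c i - c' i))" by (simp add: skew_diff sum_subtractf)
    moreover have ci: "c i \<in> carrier (eigenring \<sigma> f)" "c' i \<in> carrier (eigenring \<sigma> f)" if "i < m" for i
      using PiE_mem[OF c[THEN conjunct1]] PiE_mem[OF c'[THEN conjunct1]] that by simp_all
    then have "\<forall>i\<in>{..<m}. c i - c' i \<in> idealizer f"
      unfolding carrier_eigenring by (simp add: idealizer_diff)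
    ultimately have "\<forall>i\<in>{..<m}. rdvd f (c i - c' i)"
      using ind[unfolded independent_mod_def, THEN spec, of "\<lambda>i. c i - c' i"] by simp
    moreover have "degree (c i - c' i) < degree f" if "i < m" for i
      using ci[OF that] unfolding carrier_eigenring by (simp add: degree_diff_less)
    ultimately have "c i = c' i" if "i < m" for i
      using rdvd_small[of f "c i - c' i"] that by simp
    then show "c = c'"
      by (intro PiE_ext[OF c[THEN conjunct1] c'[THEN conjunct1]]) simp
  qed
qed

end

section \<open>The matrix representation\<close>

lemma abelian_group_plusI:
  fixes R :: "('b::ab_group_add, 'c) ring_scheme"
  assumes "add R = (+)" "ring.zero R = 0" and "0 \<in> carrier R"
    and "\<And>x y. x \<in> carrier R \<Longrightarrow> y \<in> carrier R \<Longrightarrow> x + y \<in> carrier R"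
    and "\<And>x. x \<in> carrier R \<Longrightarrow> - x \<in> carrier R"
  shows "abelian_group R"
proof (rule abelian_groupI)
  fix x assume "x \<in> carrier R"
  then show "\<exists>y\<in>carrier R. y \<oplus>\<^bsub>R\<^esub> x = \<zero>\<^bsub>R\<^esub>"
    by (intro bexI[of _ "- x"]) (simp_all add: assms)
qed (simp_all add: assms add_ac)

lemma finsum_eq_sum:
  fixes g :: "'i \<Rightarrow> 'b::ab_group_add" and R :: "('b, 'c) ring_scheme"
  assumes "abelian_group R" "add R = (+)" "ring.zero R = 0"
    and "finite A" "\<And>i. i \<in> A \<Longrightarrow> g i \<in> carrier R"
  shows "finsum R g A = sum g A"
proof -
  interpret R: abelian_group R by (rule assms(1))
  show ?thesis using assms(4,5)
    by (induction A rule: finite_induct) (simp_all add: assms(2,3) Pi_def)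
qed

context skew_poly
begin

lemma ring_skew_poly_ring: "ring R"
proof (rule ringI)
  show "abelian_group R"
    by (rule abelian_group_plusI) (simp_all add: skew_poly_ring_def)
  show "monoid R"
    by (rule monoidI) (simp_all add: skew_poly_ring_def skew_assoc)
qed (simp_all add: skew_poly_ring_def add_skew skew_add)

end

context central_factor
begin

abbreviation "E \<equiv> eigenring \<sigma> f"

abbreviation "rem p \<equiv> skew_rem \<sigma> p f"

lemma eigenring_simps [simp]:
  "g \<otimes>\<^bsub>E\<^esub> h = rem (g \<star> h)" "add E = (+)" "\<zero>\<^bsub>E\<^esub> = 0" "\<one>\<^bsub>E\<^esub> = 1"
  by (simp_all add: eigenring_def)

lemma deg_f: "0 < degree f"
  by (rule skew_irreducible_degree[OF f])

lemma E_closed: "0 \<in> carrier E" "1 \<in> carrier E"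
  "a \<in> carrier E \<Longrightarrow> b \<in> carrier E \<Longrightarrow> a + b \<in> carrier E"
  "a \<in> carrier E \<Longrightarrow> - a \<in> carrier E"
  "a \<in> carrier E \<Longrightarrow> b \<in> carrier E \<Longrightarrow> a - b \<in> carrier E"
  "a \<in> carrier E \<Longrightarrow> b \<in> carrier E \<Longrightarrow> rem (a \<star> b) \<in> carrier E"
  using deg_f by (auto simp: carrier_eigenring degree_add_less degree_diff_less idealizer_add
      idealizer_minus idealizer_diff skew_rem_idealizer[unfolded carrier_eigenring] idealizer_skew)

lemma E_sum_closed: "(\<And>i. i \<in> A \<Longrightarrow> g i \<in> carrier E) \<Longrightarrow> sum g A \<in> carrier E"
  by (induction A rule: infinite_finite_induct) (auto intro: E_closed)

lemma abelian_group_E: "abelian_group E"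
  by (rule abelian_group_plusI) (simp_all add: E_closed)

text \<open>Reducing the left factor changes it by an element of \<open>Rf\<close>; right
  multiplication by \<open>c\<close> keeps this change in \<open>Rf\<close> because \<open>c\<close>
  is in the idealizer.\<close>

lemma rem_rem_left:
  assumes "c \<in> idealizer f"
  shows "rem (rem a \<star> c) = rem (a \<star> c)"
proof (rule skew_rem_cong[OF deg_f])
  have "rdvd f ((a - rem a) \<star> c)" by (rule idealizer_rdvd[OF assms skew_rem_f(2)])
  then show "rdvd f (rem a \<star> c - a \<star> c)" using rdvd_minus by (fastforce simp: diff_skew)
qed

lemma rem_rem_right: "rem (a \<star> rem c) = rem (a \<star> c)"
proof (rule skew_rem_cong[OF deg_f])
  have "rdvd f (a \<star> (c - rem c))" by (rule rdvd_mult[OF skew_rem_f(2)])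
  then show "rdvd f (a \<star> rem c - a \<star> c)" using rdvd_minus by (fastforce simp: skew_diff)
qed

lemma ring_E: "ring E"
proof (rule ringI[OF abelian_group_E])
  show "monoid E"
    by (rule monoidI)
      (simp_all add: E_closed(6)[unfolded carrier_eigenring] deg_f rem_rem_left rem_rem_right
         carrier_eigenring skew_assoc skew_rem_small)
qed (simp_all add: add_skew skew_add skew_rem_add[OF deg_f])

lemma finsum_E:
  assumes "finite A" "\<And>i. i \<in> A \<Longrightarrow> g i \<in> carrier E"
  shows "finsum E g A = sum g A"
  by (rule finsum_eq_sum[OF abelian_group_E _ _ assms]) simp_all

lemma ideal_H: "ideal (PIdl\<^bsub>R\<^esub> H) R"
proof (rule idealI[OF ring_skew_poly_ring])
  interpret R: ring R by (rule ring_skew_poly_ring)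
  show "subgroup (PIdl\<^bsub>R\<^esub> H) (add_monoid R)"
  proof (rule R.add.subgroupI)
    show "PIdl\<^bsub>R\<^esub> H \<noteq> {}" using mem_PIdl_iff[of 0 H] by auto
    fix a b assume a: "a \<in> PIdl\<^bsub>R\<^esub> H"
    have "\<ominus>\<^bsub>R\<^esub> a = - a"
      using R.add.inv_equality[of "- a" a] by simp
    then show "\<ominus>\<^bsub>R\<^esub> a \<in> PIdl\<^bsub>R\<^esub> H"
      using a by (simp add: mem_PIdl_iff rdvd_minus)
    assume "b \<in> PIdl\<^bsub>R\<^esub> H"
    then show "a \<oplus>\<^bsub>R\<^esub> b \<in> PIdl\<^bsub>R\<^esub> H"
      using a by (simp add: mem_PIdl_iff rdvd_add)
  qed simp
next
  fix a x assume a: "a \<in> PIdl\<^bsub>R\<^esub> H"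
  show "x \<otimes>\<^bsub>R\<^esub> a \<in> PIdl\<^bsub>R\<^esub> H"
    using a by (simp add: mem_PIdl_iff rdvd_mult)
  obtain q where "a = q \<star> H" using a unfolding mem_PIdl_iff rdvd_def by blast
  then have "a \<star> x = (q \<star> x) \<star> H" by (simp only: skew_assoc H_central[of x])
  then show "a \<otimes>\<^bsub>R\<^esub> x \<in> PIdl\<^bsub>R\<^esub> H"
    by (simp add: mem_PIdl_iff)
qed

lemma mem_skew_class: "x \<in> skew_class \<sigma> H a \<longleftrightarrow> rdvd H (x - a)"
proof -
  have "x \<in> skew_class \<sigma> H a \<longleftrightarrow> (\<exists>h. rdvd H h \<and> x = h + a)"
    unfolding skew_class_def a_r_coset_def' by (auto simp: mem_PIdl_iff)
  also have "\<dots> \<longleftrightarrow> rdvd H (x - a)" by (metis add_diff_cancel diff_add_cancel)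
  finally show ?thesis .
qed

lemma skew_class_eq_iff: "skew_class \<sigma> H a = skew_class \<sigma> H b \<longleftrightarrow> rdvd H (a - b)"
proof
  assume "skew_class \<sigma> H a = skew_class \<sigma> H b"
  then show "rdvd H (a - b)" using mem_skew_class[of a a] mem_skew_class[of a b] by simp
next
  assume ab: "rdvd H (a - b)"
  have "rdvd H (x - a) \<longleftrightarrow> rdvd H (x - b)" for x
    using rdvd_congr[of H "x - b" "x - a"] ab by simp
  then show "skew_class \<sigma> H a = skew_class \<sigma> H b" by (auto simp: mem_skew_class)
qed

lemma quotient_simps:
  "carrier (skew_quotient \<sigma> H) = range (skew_class \<sigma> H)"
  "skew_class \<sigma> H a \<otimes>\<^bsub>skew_quotient \<sigma> H\<^esub> skew_class \<sigma> H b = skew_class \<sigma> H (a \<star> b)"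
  "skew_class \<sigma> H a \<oplus>\<^bsub>skew_quotient \<sigma> H\<^esub> skew_class \<sigma> H b = skew_class \<sigma> H (a + b)"
  "\<one>\<^bsub>skew_quotient \<sigma> H\<^esub> = skew_class \<sigma> H 1"
  "\<zero>\<^bsub>skew_quotient \<sigma> H\<^esub> = skew_class \<sigma> H 0"
proof -
  interpret I: ideal "PIdl\<^bsub>R\<^esub> H" R by (rule ideal_H)
  show "carrier (skew_quotient \<sigma> H) = range (skew_class \<sigma> H)"
    unfolding skew_quotient_def FactRing_def A_RCOSETS_def' skew_class_def by auto
  show "skew_class \<sigma> H a \<otimes>\<^bsub>skew_quotient \<sigma> H\<^esub> skew_class \<sigma> H b = skew_class \<sigma> H (a \<star> b)"
    unfolding skew_quotient_def FactRing_def skew_class_def using I.rcoset_mult_add[of a b] by simp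
  show "skew_class \<sigma> H a \<oplus>\<^bsub>skew_quotient \<sigma> H\<^esub> skew_class \<sigma> H b = skew_class \<sigma> H (a + b)"
    unfolding skew_quotient_def FactRing_def skew_class_def using I.a_rcos_sum[of a b] by simp
  show "\<one>\<^bsub>skew_quotient \<sigma> H\<^esub> = skew_class \<sigma> H 1"
    unfolding skew_quotient_def FactRing_def skew_class_def by simp
  have "x \<in> PIdl\<^bsub>R\<^esub> H \<longleftrightarrow> x \<in> skew_class \<sigma> H 0" for x
    by (simp add: mem_PIdl_iff mem_skew_class)
  then show "\<zero>\<^bsub>skew_quotient \<sigma> H\<^esub> = skew_class \<sigma> H 0"
    unfolding skew_quotient_def FactRing_def by auto
qed

lemma const_central:
  assumes "c \<in> K"
  shows "p \<star> [:c:] = smult c p"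
proof -
  have "in_xn [:c:] = [:c:]" by (simp add: poly_in_xn_def)
  moreover have "K_poly [:c:]"
    using assms subfield_type_closed(1)[OF subfield_K] by (auto simp: K_poly_def coeff_pCons split: nat.splits)
  ultimately show ?thesis using in_xn_central[of "[:c:]" p] by simp
qed

lemma const_in_E: "c \<in> K \<Longrightarrow> [:c:] \<in> carrier E"
  using deg_f by (simp add: carrier_eigenring idealizer_def const_central rdvd_smult)

end

locale central_factor_basis = central_factor +
  fixes v :: "nat \<Rightarrow> 'a poly"
  assumes basis: "independent_mod f v {..<m}"
begin

abbreviation "M \<equiv> mat_ring E m"

definition lin_comb :: "(nat \<Rightarrow> 'a poly) \<Rightarrow> 'a poly" where "lin_comb c = (\<Sum>i<m. v i \<star> c i)"

lemma lin_comb_add: "lin_comb (\<lambda>i. c i + c' i) = lin_comb c + lin_comb c'"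
  by (simp add: lin_comb_def skew_add sum.distrib)

lemma coordinates_unique:
  assumes "\<And>i. i < m \<Longrightarrow> c i \<in> carrier E" "\<And>i. i < m \<Longrightarrow> c' i \<in> carrier E"
    and "rdvd f (lin_comb c - lin_comb c')" and "i < m"
  shows "c i = c' i"
proof -
  have "rdvd f (\<Sum>i<m. v i \<star> (c i - c' i))"
    using assms(3) by (simp add: lin_comb_def skew_diff sum_subtractf)
  moreover have "\<forall>i\<in>{..<m}. c i - c' i \<in> idealizer f"
    using assms(1,2) by (simp add: carrier_eigenring idealizer_diff)
  ultimately have "rdvd f (c i - c' i)"
    using basis[unfolded independent_mod_def, THEN spec, of "\<lambda>i. c i - c' i"] assms(4) by simp
  moreover have "c i - c' i \<in> carrier E" using assms by (simp add: E_closed)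
  ultimately show ?thesis using carrier_eigenring_rdvd by fastforce
qed

lemma coordinates_exist: "\<exists>c. (\<forall>i<m. c i \<in> carrier E) \<and> rdvd f (w - lin_comb c)"
proof -
  have "right_basis \<sigma> f m v" using right_basis_iff basis by blast
  then obtain c where "c \<in> {..<m} \<rightarrow>\<^sub>E carrier E" "rdvd f (w - (\<Sum>i<m. v i \<star> c i))"
    unfolding right_basis_def mem_PIdl_iff skew_poly_ring_simps by blast
  then show ?thesis unfolding lin_comb_def by (intro exI[of _ c]) (auto dest: PiE_mem)
qed

text \<open>Kept as a relation beside the function \<open>matrix_of\<close>, so that sums and
  products are treated by exhibiting a matrix and appealing to uniqueness.\<close>

definition represents :: "'a poly \<Rightarrow> (nat \<Rightarrow> nat \<Rightarrow> 'a poly) \<Rightarrow> bool" where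
  "represents a A \<longleftrightarrow> A \<in> carrier M \<and> (\<forall>j<m. rdvd f (a \<star> v j - lin_comb (\<lambda>i. A i j)))"

lemma carrier_M: "A \<in> carrier M \<longleftrightarrow> (\<forall>i j. if i < m \<and> j < m then A i j \<in> carrier E else A i j = 0)"
  by (simp add: mat_ring_def)

lemma carrier_M_entry: "A \<in> carrier M \<Longrightarrow> i < m \<Longrightarrow> j < m \<Longrightarrow> A i j \<in> carrier E"
  and carrier_M_outside: "A \<in> carrier M \<Longrightarrow> \<not> (i < m \<and> j < m) \<Longrightarrow> A i j = 0"
proof -
  assume "A \<in> carrier M"
  then have "if i < m \<and> j < m then A i j \<in> carrier E else A i j = 0" unfolding carrier_M by blast
  then show "i < m \<Longrightarrow> j < m \<Longrightarrow> A i j \<in> carrier E" "\<not> (i < m \<and> j < m) \<Longrightarrow> A i j = 0"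
    by (simp_all split: if_splits)
qed

lemma represents_unique:
  assumes "represents a A" "represents a B"
  shows "A = B"
proof (intro ext)
  fix i j
  show "A i j = B i j"
  proof (cases "i < m \<and> j < m")
    case True
    have "rdvd f ((a \<star> v j - lin_comb (\<lambda>i. B i j)) - (a \<star> v j - lin_comb (\<lambda>i. A i j)))"
      by (rule rdvd_diff) (use assms True in \<open>simp_all add: represents_def\<close>)
    then have "rdvd f (lin_comb (\<lambda>i. A i j) - lin_comb (\<lambda>i. B i j))" by simp
    moreover have "A i j \<in> carrier E" "B i j \<in> carrier E" if "i < m" for i
      using assms True that carrier_M_entry by (simp_all add: represents_def)
    ultimately show ?thesis using True coordinates_unique[of "\<lambda>i. A i j" "\<lambda>i. B i j" i] by simp
  next
    case False
    have "A \<in> carrier M" "B \<in> carrier M" using assms by (simp_all add: represents_def)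
    from this[THEN carrier_M_outside, OF False] show ?thesis by simp
  qed
qed

lemma represents_exists: "\<exists>A. represents a A"
proof -
  have "\<forall>j. \<exists>c. (\<forall>i<m. c i \<in> carrier E) \<and> rdvd f (a \<star> v j - lin_comb c)"
    using coordinates_exist by blast
  from choice[OF this] obtain c
    where c: "\<And>j. (\<forall>i<m. c j i \<in> carrier E) \<and> rdvd f (a \<star> v j - lin_comb (c j))" by blast
  define A where "A i j = (if i < m \<and> j < m then c j i else 0)" for i j
  have "lin_comb (\<lambda>i. A i j) = lin_comb (c j)" if "j < m" for j
    using that unfolding lin_comb_def by (intro sum.cong) (auto simp: A_def)
  then show ?thesis using c unfolding represents_def carrier_M by (intro exI[of _ A]) (auto simp: A_def)
qed

definition matrix_of :: "'a poly \<Rightarrow> nat \<Rightarrow> nat \<Rightarrow> 'a poly" where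
  "matrix_of a = (THE A. represents a A)"

lemma matrix_of_eq: "represents a A \<Longrightarrow> matrix_of a = A"
  unfolding matrix_of_def by (rule the_equality) (auto intro: represents_unique)

lemma represents_matrix_of: "represents a (matrix_of a)"
  using represents_exists[of a] matrix_of_eq by metis

lemma represents_cong:
  assumes "rdvd H (a - b)"
  shows "represents a A \<longleftrightarrow> represents b A"
proof -
  have "rdvd f (a \<star> v j - lin_comb (\<lambda>i. A i j)) \<longleftrightarrow> rdvd f (b \<star> v j - lin_comb (\<lambda>i. A i j))" for j
  proof (rule rdvd_congr)
    have "rdvd f ((a - b) \<star> v j)" by (rule annihilated_rdvd[OF assms])
    then show "rdvd f (a \<star> v j - lin_comb (\<lambda>i. A i j) - (b \<star> v j - lin_comb (\<lambda>i. A i j)))"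
      by (simp add: diff_skew)
  qed
  then show ?thesis unfolding represents_def by simp
qed

text \<open>Multiples of \<open>H\<close> annihilate \<open>R/Rf\<close>, so all members of a class
  act alike and one representative decides.\<close>

lemma left_mult_matrix_class: "left_mult_matrix \<sigma> f m v (skew_class \<sigma> H a) = matrix_of a"
proof -
  have "A \<in> carrier M \<and> (\<forall>b\<in>skew_class \<sigma> H a. \<forall>j<m. rdvd f (b \<star> v j - lin_comb (\<lambda>i. A i j)))
     \<longleftrightarrow> represents a A" for A
  proof
    assume "A \<in> carrier M \<and> (\<forall>b\<in>skew_class \<sigma> H a. \<forall>j<m. rdvd f (b \<star> v j - lin_comb (\<lambda>i. A i j)))"
    moreover have "a \<in> skew_class \<sigma> H a" by (simp add: mem_skew_class)
    ultimately show "represents a A" unfolding represents_def by blast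
  next
    assume a: "represents a A"
    have "represents b A" if "b \<in> skew_class \<sigma> H a" for b
      using that represents_cong[of b a] a by (simp add: mem_skew_class)
    then show "A \<in> carrier M \<and> (\<forall>b\<in>skew_class \<sigma> H a. \<forall>j<m. rdvd f (b \<star> v j - lin_comb (\<lambda>i. A i j)))"
      using a unfolding represents_def by blast
  qed
  then show ?thesis
    unfolding left_mult_matrix_def mem_PIdl_iff skew_poly_ring_simps lin_comb_def[symmetric]
      matrix_of_def by simp
qed

lemma M_simps:
  "A \<otimes>\<^bsub>M\<^esub> B = (\<lambda>i j. if i < m \<and> j < m then \<Oplus>\<^bsub>E\<^esub>k\<in>{..<m}. rem (A i k \<star> B k j) else 0)"
  "A \<oplus>\<^bsub>M\<^esub> B = (\<lambda>i j. A i j + B i j)"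
  "\<one>\<^bsub>M\<^esub> = (\<lambda>i j. if i < m \<and> j < m \<and> i = j then 1 else 0)"
  "\<zero>\<^bsub>M\<^esub> = (\<lambda>i j. 0)"
  by (simp_all add: mat_ring_def cong: if_cong)

lemma represents_add:
  assumes "represents a A" "represents b B"
  shows "represents (a + b) (\<lambda>i j. A i j + B i j)"
  unfolding represents_def
proof (intro conjI allI impI)
  show "(\<lambda>i j. A i j + B i j) \<in> carrier M"
    using assms E_closed(3) unfolding represents_def carrier_M by simp
  fix j assume j: "j < m"
  have "rdvd f ((a \<star> v j - lin_comb (\<lambda>i. A i j)) + (b \<star> v j - lin_comb (\<lambda>i. B i j)))"
    by (rule rdvd_add) (use assms j in \<open>simp_all add: represents_def\<close>)
  then show "rdvd f ((a + b) \<star> v j - lin_comb (\<lambda>i. A i j + B i j))"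
    by (simp add: add_skew lin_comb_add algebra_simps)
qed

lemma represents_mult:
  assumes A: "represents a A" and B: "represents b B"
  shows "represents (a \<star> b) (A \<otimes>\<^bsub>M\<^esub> B)"
proof -
  have AE: "A i k \<in> carrier E" and BE: "B i k \<in> carrier E" if "i < m" "k < m" for i k
    using A B that carrier_M_entry by (simp_all add: represents_def)
  have AB: "(A \<otimes>\<^bsub>M\<^esub> B) i j = (\<Sum>k<m. rem (A i k \<star> B k j))" if "i < m" "j < m" for i j
    unfolding M_simps using that AE BE E_closed(6) by (subst finsum_E) simp_all
  have "A \<otimes>\<^bsub>M\<^esub> B \<in> carrier M"
    unfolding carrier_M
  proof (intro allI)
    fix i j
    show "if i < m \<and> j < m then (A \<otimes>\<^bsub>M\<^esub> B) i j \<in> carrier E else (A \<otimes>\<^bsub>M\<^esub> B) i j = 0"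
    proof (cases "i < m \<and> j < m")
      case True
      have "(\<Sum>k<m. rem (A i k \<star> B k j)) \<in> carrier E"
        by (rule E_sum_closed, rule E_closed(6)) (use True AE BE in auto)
      then show ?thesis using True by (simp add: AB)
    next
      case False
      then show ?thesis by (auto simp: M_simps)
    qed
  qed
  moreover have "rdvd f ((a \<star> b) \<star> v j - lin_comb (\<lambda>i. (A \<otimes>\<^bsub>M\<^esub> B) i j))" if j: "j < m" for j
  proof -
    \<comment> \<open>The image under \<open>a\<close> of column \<open>j\<close> of
      \<open>B\<close>, expanded by the columns of \<open>A\<close>. Three congruences lead to the
      product: replacing \<open>b v_j\<close>, replacing every \<open>a v_k\<close> (here
      \<open>B k j\<close> must be in the idealizer), and reducing the entries.\<close>
    define w where "w = (\<Sum>k<m. lin_comb (\<lambda>i. A i k) \<star> B k j)"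
    have "rdvd f (a \<star> (b \<star> v j - lin_comb (\<lambda>i. B i j)))"
      by (rule rdvd_mult) (use B j in \<open>simp add: represents_def\<close>)
    then have 1: "rdvd f ((a \<star> b) \<star> v j - a \<star> lin_comb (\<lambda>i. B i j))"
      by (simp add: skew_diff skew_assoc)
    have "rdvd f (\<Sum>k<m. (a \<star> v k - lin_comb (\<lambda>i. A i k)) \<star> B k j)"
    proof (rule rdvd_sum)
      fix k assume "k \<in> {..<m}"
      then show "rdvd f ((a \<star> v k - lin_comb (\<lambda>i. A i k)) \<star> B k j)"
        using BE[of k j] j A unfolding carrier_eigenring represents_def
        by (intro idealizer_rdvd[of "B k j"]) simp_all
    qed
    then have 2: "rdvd f (a \<star> lin_comb (\<lambda>i. B i j) - w)"
      by (simp add: w_def diff_skew sum_subtractf skew_sum skew_assoc lin_comb_def)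
    have w: "w = (\<Sum>i<m. v i \<star> (\<Sum>k<m. A i k \<star> B k j))"
      unfolding w_def lin_comb_def sum_skew skew_sum skew_assoc by (rule sum.swap)
    have "rdvd f (\<Sum>i<m. v i \<star> (\<Sum>k<m. A i k \<star> B k j - rem (A i k \<star> B k j)))"
      by (intro rdvd_sum rdvd_mult skew_rem_f)
    moreover have "(\<Sum>i<m. v i \<star> (\<Sum>k<m. A i k \<star> B k j - rem (A i k \<star> B k j)))
       = w - lin_comb (\<lambda>i. (A \<otimes>\<^bsub>M\<^esub> B) i j)"
      using j by (simp add: w lin_comb_def AB sum_subtractf skew_diff)
    ultimately have 3: "rdvd f (w - lin_comb (\<lambda>i. (A \<otimes>\<^bsub>M\<^esub> B) i j))" by simp
    show ?thesis using rdvd_add[OF rdvd_add[OF 1 2] 3] by simp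
  qed
  ultimately show ?thesis unfolding represents_def by blast
qed

lemma lin_comb_single: "j < m \<Longrightarrow> lin_comb (\<lambda>i. if i = j then c else 0) = v j \<star> c"
proof -
  assume j: "j < m"
  have "lin_comb (\<lambda>i. if i = j then c else 0) = (\<Sum>i<m. if i = j then v j \<star> c else 0)"
    unfolding lin_comb_def by (intro sum.cong) auto
  then show ?thesis using j by simp
qed

lemma represents_scalar:
  assumes "c \<in> K"
  shows "represents [:c:] (scalar_mat E m [:c:])"
  unfolding represents_def
proof (intro conjI allI impI)
  show "scalar_mat E m [:c:] \<in> carrier M"
    using const_in_E[OF assms] E_closed(1) by (simp add: carrier_M scalar_mat_def)
  fix j assume j: "j < m"
  have "lin_comb (\<lambda>i. scalar_mat E m [:c:] i j) = lin_comb (\<lambda>i. if i = j then [:c:] else 0)"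
    unfolding lin_comb_def using j by (intro sum.cong) (auto simp: scalar_mat_def)
  also have "\<dots> = smult c (v j)" by (simp only: lin_comb_single[OF j] const_central[OF assms])
  finally show "rdvd f ([:c:] \<star> v j - lin_comb (\<lambda>i. scalar_mat E m [:c:] i j))" by simp
qed

lemma matrix_of_add: "matrix_of (a + b) = matrix_of a \<oplus>\<^bsub>M\<^esub> matrix_of b"
  unfolding M_simps by (intro matrix_of_eq represents_add represents_matrix_of)

lemma matrix_of_mult: "matrix_of (a \<star> b) = matrix_of a \<otimes>\<^bsub>M\<^esub> matrix_of b"
  by (intro matrix_of_eq represents_mult represents_matrix_of)

lemma matrix_of_scalar: "c \<in> K \<Longrightarrow> matrix_of [:c:] = scalar_mat E m [:c:]"
  by (intro matrix_of_eq represents_scalar)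

lemma matrix_of_one: "matrix_of 1 = \<one>\<^bsub>M\<^esub>"
proof -
  have "matrix_of [:1:] = scalar_mat E m [:1:]"
    using subfield_type_closed(2)[OF subfield_K] by (rule matrix_of_scalar)
  then show ?thesis by (simp add: one_pCons[symmetric] M_simps scalar_mat_def cong: if_cong)
qed

lemma matrix_of_0: "matrix_of 0 = \<zero>\<^bsub>M\<^esub>"
proof -
  have "matrix_of [:0:] = scalar_mat E m [:0:]"
    using subfield_type_closed(1)[OF subfield_K] by (rule matrix_of_scalar)
  then show ?thesis by (simp add: M_simps scalar_mat_def cong: if_cong)
qed

lemma matrix_of_carrier: "matrix_of a \<in> carrier M"
  using represents_matrix_of unfolding represents_def by blast

text \<open>Faithfulness: an element that kills a basis is a multiple of \<open>H\<close>.\<close>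

lemma matrix_of_eq_iff: "matrix_of a = matrix_of b \<longleftrightarrow> rdvd H (a - b)"
proof
  assume "rdvd H (a - b)"
  then show "matrix_of a = matrix_of b" using represents_cong by (simp add: matrix_of_def)
next
  assume e: "matrix_of a = matrix_of b"
  have "\<forall>j\<in>{..<m}. rdvd f ((a - b) \<star> v j)"
  proof
    fix j assume "j \<in> {..<m}"
    then have "rdvd f (a \<star> v j - lin_comb (\<lambda>i. matrix_of a i j))"
      "rdvd f (b \<star> v j - lin_comb (\<lambda>i. matrix_of a i j))"
      using represents_matrix_of[of a] represents_matrix_of[of b] unfolding represents_def e by simp_all
    from rdvd_diff[OF this] show "rdvd f ((a - b) \<star> v j)" by (simp add: diff_skew)
  qed
  then show "rdvd H (a - b)" using independent_spans(2)[OF _ basis] by simp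
qed

lemma matrix_of_surj:
  assumes "A \<in> carrier M"
  shows "\<exists>a. matrix_of a = A"
proof -
  obtain a where "\<forall>j\<in>{..<m}. rdvd f (a \<star> v j - lin_comb (\<lambda>i. A i j))"
    using density[OF _ basis, of "\<lambda>j. lin_comb (\<lambda>i. A i j)"] by blast
  then have "represents a A" using assms by (simp add: represents_def)
  then show ?thesis using matrix_of_eq by blast
qed

lemma left_mult_matrix_ring_iso:
  "left_mult_matrix \<sigma> f m v \<in> ring_iso (skew_quotient \<sigma> H) M"
proof (rule ring_iso_memI)
  let ?h = "left_mult_matrix \<sigma> f m v"
  fix x y assume x: "x \<in> carrier (skew_quotient \<sigma> H)" and y: "y \<in> carrier (skew_quotient \<sigma> H)"
  obtain a where a: "x = skew_class \<sigma> H a" using x unfolding quotient_simps by blast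
  obtain b where b: "y = skew_class \<sigma> H b" using y unfolding quotient_simps by blast
  show "?h x \<in> carrier M" unfolding a left_mult_matrix_class by (rule matrix_of_carrier)
  show "?h (x \<otimes>\<^bsub>skew_quotient \<sigma> H\<^esub> y) = ?h x \<otimes>\<^bsub>M\<^esub> ?h y"
    unfolding a b quotient_simps left_mult_matrix_class by (rule matrix_of_mult)
  show "?h (x \<oplus>\<^bsub>skew_quotient \<sigma> H\<^esub> y) = ?h x \<oplus>\<^bsub>M\<^esub> ?h y"
    unfolding a b quotient_simps left_mult_matrix_class by (rule matrix_of_add)
next
  let ?h = "left_mult_matrix \<sigma> f m v"
  show "?h \<one>\<^bsub>skew_quotient \<sigma> H\<^esub> = \<one>\<^bsub>M\<^esub>"
    unfolding quotient_simps left_mult_matrix_class by (rule matrix_of_one)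
  have "inj_on ?h (range (skew_class \<sigma> H))"
    unfolding inj_on_def by (auto simp: left_mult_matrix_class matrix_of_eq_iff skew_class_eq_iff)
  moreover have "?h ` range (skew_class \<sigma> H) = carrier M"
    unfolding image_image left_mult_matrix_class using matrix_of_carrier matrix_of_surj by blast
  ultimately show "bij_betw ?h (carrier (skew_quotient \<sigma> H)) (carrier M)"
    unfolding bij_betw_def quotient_simps by blast
qed

text \<open>The ring axioms are transported from the quotient ring along the bijection, whose proof
  uses only the operations of \<open>M\<close>.\<close>

lemma ring_M: "ring M"
proof -
  interpret I: ideal "PIdl\<^bsub>R\<^esub> H" R by (rule ideal_H)
  have "ring (skew_quotient \<sigma> H)" unfolding skew_quotient_def by (rule I.quotient_is_ring)
  from ring.ring_iso_imp_img_ring[OF this left_mult_matrix_ring_iso]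
  have "ring (M\<lparr>ring.zero := left_mult_matrix \<sigma> f m v \<zero>\<^bsub>skew_quotient \<sigma> H\<^esub>\<rparr>)" .
  moreover have "left_mult_matrix \<sigma> f m v \<zero>\<^bsub>skew_quotient \<sigma> H\<^esub> = \<zero>\<^bsub>M\<^esub>"
    unfolding quotient_simps left_mult_matrix_class by (rule matrix_of_0)
  ultimately show ?thesis by simp
qed

end

section \<open>Ranks\<close>

context central_factor_basis
begin

text \<open>Column \<open>j\<close> holds the coordinates of \<open>a v_j\<close>, so relations
  among columns are relations among these elements of \<open>R/Rf\<close>.\<close>

lemma columns_independent_iff:
  assumes "represents a A" "J \<subseteq> {..<m}"
  shows "columns_independent E m A J \<longleftrightarrow> independent_mod f (\<lambda>j. a \<star> v j) J"
proof -
  have J: "finite J" using assms(2) finite_subset by blast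
  have A: "A \<in> carrier M" using assms(1) by (simp add: represents_def)
  have key: "(\<forall>i<m. (\<Oplus>\<^bsub>E\<^esub>j\<in>J. A i j \<otimes>\<^bsub>E\<^esub> c j) = \<zero>\<^bsub>E\<^esub>) \<longleftrightarrow> rdvd f (\<Sum>j\<in>J. (a \<star> v j) \<star> c j)"
    if c: "\<And>j. j \<in> J \<Longrightarrow> c j \<in> carrier E" for c
  proof -
    have AE: "A i j \<in> carrier E" if "i < m" "j \<in> J" for i j
      using carrier_M_entry[OF A that(1)] that(2) assms(2) by blast
    define x where "x i = (\<Sum>j\<in>J. rem (A i j \<star> c j))" for i
    have fs: "(\<Oplus>\<^bsub>E\<^esub>j\<in>J. A i j \<otimes>\<^bsub>E\<^esub> c j) = x i" if "i < m" for i
      unfolding x_def eigenring_simps by (rule finsum_E[OF J]) (rule E_closed(6)[OF AE[OF that] c])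
    have xE: "x i \<in> carrier E" if "i < m" for i
      unfolding x_def by (rule E_sum_closed) (rule E_closed(6)[OF AE[OF that] c])
    define w where "w = (\<Sum>j\<in>J. lin_comb (\<lambda>i. A i j) \<star> c j)"
    have "rdvd f (\<Sum>j\<in>J. (a \<star> v j - lin_comb (\<lambda>i. A i j)) \<star> c j)"
    proof (rule rdvd_sum)
      fix j assume j: "j \<in> J"
      have "rdvd f (a \<star> v j - lin_comb (\<lambda>i. A i j))"
        using assms j by (auto simp: represents_def)
      then show "rdvd f ((a \<star> v j - lin_comb (\<lambda>i. A i j)) \<star> c j)"
        using c[OF j] by (intro idealizer_rdvd[of "c j"]) (simp_all add: carrier_eigenring)
    qed
    then have 1: "rdvd f ((\<Sum>j\<in>J. (a \<star> v j) \<star> c j) - w)"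
      by (simp add: w_def diff_skew sum_subtractf)
    have w: "w = (\<Sum>i<m. v i \<star> (\<Sum>j\<in>J. A i j \<star> c j))"
      unfolding w_def lin_comb_def sum_skew skew_sum skew_assoc by (rule sum.swap)
    have "rdvd f (\<Sum>i<m. v i \<star> (\<Sum>j\<in>J. A i j \<star> c j - rem (A i j \<star> c j)))"
      by (intro rdvd_sum rdvd_mult skew_rem_f)
    then have 2: "rdvd f (w - lin_comb x)"
      by (simp add: w lin_comb_def x_def sum_subtractf skew_diff)
    have "rdvd f (\<Sum>j\<in>J. (a \<star> v j) \<star> c j) \<longleftrightarrow> rdvd f (lin_comb x)"
      using rdvd_congr[OF 1] rdvd_congr[OF 2] by simp
    also have "\<dots> \<longleftrightarrow> (\<forall>i<m. x i = 0)"
    proof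
      assume "rdvd f (lin_comb x)"
      then have "rdvd f (lin_comb x - lin_comb (\<lambda>i. 0))" by (simp add: lin_comb_def)
      from coordinates_unique[OF xE E_closed(1) this] show "\<forall>i<m. x i = 0" by simp
    next
      assume "\<forall>i<m. x i = 0"
      then have "lin_comb x = 0" unfolding lin_comb_def by (intro sum.neutral) simp
      then show "rdvd f (lin_comb x)" by simp
    qed
    finally show ?thesis using fs by simp
  qed
  show ?thesis
  proof
    assume ci: "columns_independent E m A J"
    show "independent_mod f (\<lambda>j. a \<star> v j) J" unfolding independent_mod_def
    proof (intro allI impI)
      fix c assume c: "(\<forall>j\<in>J. c j \<in> idealizer f) \<and> rdvd f (\<Sum>j\<in>J. a \<star> v j \<star> c j)"
      define c' where "c' j = rem (c j)" for j
      have c'E: "c' j \<in> carrier E" if "j \<in> J" for j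
        unfolding c'_def using c that by (simp add: skew_rem_idealizer)
      have "rdvd f (\<Sum>j\<in>J. (a \<star> v j) \<star> (c j - c' j))"
        unfolding c'_def by (intro rdvd_sum rdvd_mult skew_rem_f)
      then have "rdvd f ((\<Sum>j\<in>J. (a \<star> v j) \<star> c j) - (\<Sum>j\<in>J. (a \<star> v j) \<star> c' j))"
        by (simp add: skew_diff sum_subtractf)
      from rdvd_congr[OF this] c have "rdvd f (\<Sum>j\<in>J. (a \<star> v j) \<star> c' j)" by simp
      then have "\<forall>i<m. (\<Oplus>\<^bsub>E\<^esub>j\<in>J. A i j \<otimes>\<^bsub>E\<^esub> c' j) = \<zero>\<^bsub>E\<^esub>" using key[of c'] c'E by blast
      then have "\<forall>j\<in>J. c' j = \<zero>\<^bsub>E\<^esub>"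
        using ci c'E unfolding columns_independent_def by blast
      then show "\<forall>j\<in>J. rdvd f (c j)" using rdvd_skew_rem_iff[OF deg_f] by (simp add: c'_def)
    qed
  next
    assume ind: "independent_mod f (\<lambda>j. a \<star> v j) J"
    show "columns_independent E m A J" unfolding columns_independent_def
    proof (intro ballI impI)
      fix c j assume c: "c \<in> J \<rightarrow> carrier E" and z: "\<forall>i<m. (\<Oplus>\<^bsub>E\<^esub>j\<in>J. A i j \<otimes>\<^bsub>E\<^esub> c j) = \<zero>\<^bsub>E\<^esub>" and j: "j \<in> J"
      have cE: "\<And>j. j \<in> J \<Longrightarrow> c j \<in> carrier E" using c by blast
      have "rdvd f (\<Sum>j\<in>J. (a \<star> v j) \<star> c j)" using key[of c] cE z by auto
      moreover have "\<forall>j\<in>J. c j \<in> idealizer f" using cE by (simp add: carrier_eigenring)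
      ultimately have "rdvd f (c j)" using ind j unfolding independent_mod_def by blast
      then show "c j = \<zero>\<^bsub>E\<^esub>" using carrier_eigenring_rdvd[OF cE[OF j]] by simp
    qed
  qed
qed

text \<open>Rank and nullity: for a maximal independent set \<open>J\<close> of columns, every other
  \<open>v i\<close> can be corrected by the \<open>v j\<close> with \<open>j\<close> in
  \<open>J\<close> to an element that \<open>a\<close> kills.\<close>

lemma kernel_of_rank:
  assumes "represents a A"
  shows "mat_rank E m A \<le> m \<and>
    (\<exists>u (I :: nat set). finite I \<and> card I = m - mat_rank E m A \<and> independent_mod f u I \<and>
      (\<forall>i\<in>I. rdvd f (a \<star> u i)))"
proof -
  let ?S = "{J. J \<subseteq> {..<m} \<and> columns_independent E m A J}"
  have fin: "finite (card ` ?S)" by (intro finite_imageI finite_subset[of ?S "Pow {..<m}"]) auto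
  have "{} \<in> ?S" by (simp add: columns_independent_def)
  then have "card ` ?S \<noteq> {}" by blast
  from Max_in[OF fin this] obtain J where J: "J \<subseteq> {..<m}" "columns_independent E m A J"
    "card J = mat_rank E m A"
    unfolding mat_rank_def by auto
  have Jf: "finite J" using J(1) finite_subset by blast
  have card: "card J \<le> m" using card_mono[OF _ J(1)] by simp
  have ind: "independent_mod f (\<lambda>j. a \<star> v j) J" using columns_independent_iff[OF assms J(1)] J(2) by simp
  have "in_span_mod f (\<lambda>j. a \<star> v j) J (a \<star> v i)" if i: "i \<in> {..<m} - J" for i
  proof (rule ccontr)
    assume "\<not> in_span_mod f (\<lambda>j. a \<star> v j) J (a \<star> v i)"
    then have "independent_mod f (\<lambda>j. a \<star> v j) (insert i J)"
      using i by (intro independent_mod_insert[OF f Jf _ ind]) auto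
    then have "insert i J \<in> ?S" using columns_independent_iff[OF assms, of "insert i J"] i J(1) by simp
    then have "card (insert i J) \<le> mat_rank E m A"
      unfolding mat_rank_def by (intro Max_ge[OF fin]) blast
    then show False using i Jf J(3) by simp
  qed
  then have "\<forall>i\<in>{..<m} - J. \<exists>c. (\<forall>j\<in>J. c j \<in> idealizer f) \<and>
      rdvd f (a \<star> v i - (\<Sum>j\<in>J. a \<star> v j \<star> c j))"
    unfolding in_span_mod_def by blast
  from bchoice[OF this] obtain c where
    c: "\<And>i j. i \<in> {..<m} - J \<Longrightarrow> j \<in> J \<Longrightarrow> c i j \<in> idealizer f"
    "\<And>i. i \<in> {..<m} - J \<Longrightarrow> rdvd f (a \<star> v i - (\<Sum>j\<in>J. a \<star> v j \<star> c i j))" by blast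
  define u where "u i = v i - (\<Sum>j\<in>J. v j \<star> c i j)" for i
  have kill: "rdvd f (a \<star> u i)" if "i \<in> {..<m} - J" for i
    using c(2)[OF that] by (simp add: u_def skew_diff skew_sum skew_assoc)
  have indu: "independent_mod f u ({..<m} - J)" unfolding independent_mod_def
  proof (intro allI impI)
    fix e assume e: "(\<forall>i\<in>{..<m} - J. e i \<in> idealizer f) \<and> rdvd f (\<Sum>i\<in>{..<m} - J. u i \<star> e i)"
    \<comment> \<open>A relation among the corrected elements becomes one among all
      \<open>v i\<close>, with unchanged coefficients outside \<open>J\<close>.\<close>
    define e' where "e' i = (if i \<in> J then - (\<Sum>k\<in>{..<m} - J. c k i \<star> e k) else e i)" for i
    have "(\<Sum>i<m. v i \<star> e' i) = (\<Sum>i\<in>{..<m} - J. v i \<star> e' i) + (\<Sum>i\<in>J. v i \<star> e' i)"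
      using J(1) by (intro sum.subset_diff) auto
    also have "(\<Sum>i\<in>J. v i \<star> e' i) = - (\<Sum>k\<in>{..<m} - J. \<Sum>i\<in>J. v i \<star> (c k i \<star> e k))"
      by (subst sum.swap) (simp add: e'_def skew_minus skew_sum sum_negf)
    also have "(\<Sum>i\<in>{..<m} - J. v i \<star> e' i) = (\<Sum>i\<in>{..<m} - J. v i \<star> e i)"
      by (intro sum.cong) (auto simp: e'_def)
    finally have "(\<Sum>i<m. v i \<star> e' i) = (\<Sum>i\<in>{..<m} - J. u i \<star> e i)"
      by (simp add: u_def diff_skew sum_skew skew_assoc sum_subtractf)
    then have "rdvd f (\<Sum>i<m. v i \<star> e' i)" using e by simp
    moreover have "\<forall>i\<in>{..<m}. e' i \<in> idealizer f"
    proof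
      fix i assume i: "i \<in> {..<m}"
      show "e' i \<in> idealizer f"
      proof (cases "i \<in> J")
        case True
        have "(\<Sum>k\<in>{..<m} - J. c k i \<star> e k) \<in> idealizer f"
          by (rule idealizer_sum, rule idealizer_skew) (use c(1) True e in auto)
        then show ?thesis using True by (simp add: e'_def idealizer_minus)
      next
        case False
        then show ?thesis using e i by (simp add: e'_def)
      qed
    qed
    ultimately have "\<forall>i\<in>{..<m}. rdvd f (e' i)" using basis unfolding independent_mod_def by blast
    then show "\<forall>i\<in>{..<m} - J. rdvd f (e i)" by (auto simp: e'_def split: if_splits)
  qed
  have "card ({..<m} - J) = m - mat_rank E m A" using J Jf by (simp add: card_Diff_subset)
  moreover have "mat_rank E m A \<le> m" using card J(3) by simp
  moreover have "finite ({..<m} - J)" by simp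
  ultimately show ?thesis using indu kill by blast
qed

text \<open>\<open>a\<close> is a left multiple of the annihilator \<open>g\<close> of its kernel,
  whose degree is the nullity times \<open>degree f\<close>. Equal degrees make \<open>a\<close> an
  associate of \<open>g\<close>, and \<open>g\<close> divides \<open>H\<close> from the
  right.\<close>

lemma rank_degree_bound:
  assumes "a \<noteq> 0"
  shows "(m - mat_rank E m (matrix_of a)) * degree f \<le> degree a"
    and "(m - mat_rank E m (matrix_of a)) * degree f = degree a \<Longrightarrow> rdvd a H"
proof -
  define r where "r = m - mat_rank E m (matrix_of a)"
  obtain u and I :: "nat set" where I: "finite I" "card I = r"
    and u: "independent_mod f u I" "\<forall>i\<in>I. rdvd f (a \<star> u i)"
    using kernel_of_rank[OF represents_matrix_of] unfolding r_def by blast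
  obtain g where g: "degree g = r * degree f" "\<And>p. (\<forall>i\<in>I. rdvd f (p \<star> u i)) \<longleftrightarrow> rdvd g p"
    using annihilator_of_independent[OF f I(1) u(1)] unfolding I(2) by blast
  have ga: "rdvd g a" using g(2)[of a] u(2) by simp
  then show "r * degree f \<le> degree a" using rdvd_degree_le[OF ga assms] g(1) by simp
  assume eq: "r * degree f = degree a"
  obtain c where c: "a = c \<star> g" using ga unfolding rdvd_def by blast
  then have "c \<noteq> 0" "g \<noteq> 0" using assms by auto
  then have "degree c = 0" using degree_skew[of c g] c g(1) eq by simp
  then have "rdvd a g" using rdvd_cofactor_const[OF c _ assms] by blast
  moreover have "rdvd g H" using g(2)[of H] annihilated_rdvd[OF rdvd_refl] by simp
  ultimately show "rdvd a H" by (rule rdvd_trans)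
qed

text \<open>The annihilator of the first \<open>k\<close> basis elements has zero columns there. The
  factor \<open>c\<close> is carried along because the codeword built from it has to be
  rescaled.\<close>

lemma small_annihilator:
  assumes "k \<le> m"
  shows "\<exists>g. lead_coeff g = 1 \<and> degree g = k * degree f \<and> rdvd g H \<and>
    (\<forall>c. mat_rank E m (matrix_of (smult c g)) \<le> m - k)"
proof -
  have ind: "independent_mod f v {..<k}" using independent_mod_subset[OF basis] assms by auto
  obtain g where g: "lead_coeff g = 1" "degree g = card {..<k} * degree f"
    "\<And>p. (\<forall>i\<in>{..<k}. rdvd f (p \<star> v i)) \<longleftrightarrow> rdvd g p"
    using annihilator_of_independent[OF f _ ind] by auto
  have gH: "rdvd g H" using g(3)[of H] annihilated_rdvd[OF rdvd_refl] by simp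
  have "mat_rank E m (matrix_of (smult c g)) \<le> m - k" for c
  proof -
    define A where "A = matrix_of (smult c g)"
    have A: "represents (smult c g) A" unfolding A_def by (rule represents_matrix_of)
    have "J \<subseteq> {k..<m}" if J: "J \<subseteq> {..<m}" "columns_independent E m A J" for J
    proof
      fix j assume j: "j \<in> J"
      have Jf: "finite J" using J(1) finite_subset by blast
      show "j \<in> {k..<m}"
      proof (rule ccontr)
        assume "j \<notin> {k..<m}"
        then have "j < k" using j J(1) by auto
        then have gv: "rdvd f (smult c g \<star> v j)" using g(3)[of "smult c g"] rdvd_smult[OF rdvd_refl] by auto
        have ind: "independent_mod f (\<lambda>j. smult c g \<star> v j) J"
          using columns_independent_iff[OF A J(1)] J(2) by simp
        define e where "e i = (if i = j then 1 else 0 :: 'a poly)" for i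
        have "(\<Sum>i\<in>J. smult c g \<star> v i \<star> e i) = (\<Sum>i\<in>J. if i = j then smult c g \<star> v j else 0)"
          by (intro sum.cong) (auto simp: e_def)
        also have "\<dots> = smult c g \<star> v j" using j Jf by simp
        finally have "rdvd f (\<Sum>i\<in>J. smult c g \<star> v i \<star> e i)" using gv by simp
        moreover have "\<forall>i\<in>J. e i \<in> idealizer f" by (simp add: e_def)
        ultimately have "rdvd f (e j)" using ind j unfolding independent_mod_def by blast
        then show False using skew_irreducible_not_rdvd_1[OF f] by (simp add: e_def)
      qed
    qed
    then have "card J \<le> m - k" if "J \<subseteq> {..<m}" "columns_independent E m A J" for J
      using card_mono[of "{k..<m}" J] that by auto
    then have le: "i \<le> m - k" if "i \<in> card ` {J. J \<subseteq> {..<m} \<and> columns_independent E m A J}" for i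
      using that by blast
    let ?S = "{J. J \<subseteq> {..<m} \<and> columns_independent E m A J}"
    have "finite (card ` ?S)" by (intro finite_imageI finite_subset[of ?S "Pow {..<m}"]) auto
    moreover have "{} \<in> ?S" by (simp add: columns_independent_def)
    then have "card ` ?S \<noteq> {}" by blast
    ultimately have "mat_rank E m A \<le> m - k" unfolding mat_rank_def using le by (rule Max.boundedI)
    then show ?thesis unfolding A_def .
  qed
  then show ?thesis using g(1,2) gH by (intro exI[of _ g]) simp
qed

end

section \<open>Dimensions\<close>

text \<open>The scalars move along \<iota>, so one statement serves maps from coefficients to
  monomials, from representatives to the eigenring and from polynomials to matrices.\<close>

lemma dimension_image:
  fixes R (structure) and S (structure)
  assumes "ring R" "ring S" and K: "subfield K R" and "ring.dimension R d K V"
    and "\<And>x y. x \<in> V \<Longrightarrow> y \<in> V \<Longrightarrow> \<phi> (x \<oplus>\<^bsub>R\<^esub> y) = \<phi> x \<oplus>\<^bsub>S\<^esub> \<phi> y"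
    and "\<And>k x. k \<in> K \<Longrightarrow> x \<in> V \<Longrightarrow> \<phi> (k \<otimes>\<^bsub>R\<^esub> x) = \<iota> k \<otimes>\<^bsub>S\<^esub> \<phi> x"
    and "\<phi> \<zero>\<^bsub>R\<^esub> = \<zero>\<^bsub>S\<^esub>" and "inj_on \<phi> V" and "\<phi> ` V \<subseteq> carrier S"
  shows "ring.dimension S d (\<iota> ` K) (\<phi> ` V)"
proof -
  interpret R: ring R by (rule assms(1))
  interpret S: ring S by (rule assms(2))
  show ?thesis using assms(4,3,5-9)
  proof (induction rule: R.dimension.induct)
    case (zero_dim K)
    then show ?case by simp
  next
    case (Suc_dim v E d K)
    note K = Suc_dim.prems(1)
    note E = R.space_subgroup_props[OF K Suc_dim.hyps(3)]
    let ?V = "R.line_extension K v E"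
    have kc: "k \<in> carrier R" if "k \<in> K" for k using that subfieldE(3)[OF K] by blast
    have one: "\<one>\<^bsub>R\<^esub> \<in> K" and zero: "\<zero>\<^bsub>R\<^esub> \<in> K"
      using subringE(2,3)[OF subfieldE(1)[OF K]] by blast+
    have kv: "k \<otimes>\<^bsub>R\<^esub> v \<in> ?V" if "k \<in> K" for k
      unfolding R.line_extension_mem_iff using that E(2) kc[OF that] Suc_dim.hyps(1)
      by (intro bexI[of _ k] bexI[of _ "\<zero>\<^bsub>R\<^esub>"]) simp_all
    have vV: "v \<in> ?V" using kv[OF one] Suc_dim.hyps(1) by simp
    have EV: "E \<subseteq> ?V"
    proof
      fix e assume "e \<in> E"
      then show "e \<in> ?V" unfolding R.line_extension_mem_iff
        using E(1) zero Suc_dim.hyps(1) by (intro bexI[of _ "\<zero>\<^bsub>R\<^esub>"] bexI[of _ e]) auto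
    qed
    have \<phi>E: "S.dimension d (\<iota> ` K) (\<phi> ` E)"
    proof (rule Suc_dim.IH[OF K])
      show "inj_on \<phi> E" using Suc_dim.prems(5) EV inj_on_subset by blast
      show "\<phi> ` E \<subseteq> carrier S" using Suc_dim.prems(6) EV by blast
    qed (use Suc_dim.prems(2-4) EV in blast)+
    have "\<phi> ` ?V = S.line_extension (\<iota> ` K) (\<phi> v) (\<phi> ` E)"
    proof -
      have "\<phi> (k \<otimes>\<^bsub>R\<^esub> v \<oplus>\<^bsub>R\<^esub> e) = \<iota> k \<otimes>\<^bsub>S\<^esub> \<phi> v \<oplus>\<^bsub>S\<^esub> \<phi> e" if "k \<in> K" "e \<in> E" for k e
        using Suc_dim.prems(2)[OF kv[OF that(1)], of e] Suc_dim.prems(3)[OF that(1) vV] that(2) EV by auto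
      then show ?thesis
        unfolding set_eq_iff S.line_extension_mem_iff image_iff Bex_def R.line_extension_mem_iff
        by metis
    qed
    moreover have "\<phi> v \<notin> \<phi> ` E"
    proof
      assume "\<phi> v \<in> \<phi> ` E"
      then obtain e where "e \<in> E" "\<phi> v = \<phi> e" by blast
      then have "v = e" using Suc_dim.prems(5) vV EV by (meson inj_onD subsetD)
      then show False using \<open>e \<in> E\<close> Suc_dim.hyps(2) by simp
    qed
    moreover have "\<phi> v \<in> carrier S" using Suc_dim.prems(6) vV by blast
    ultimately show ?case using S.Suc_dim[OF _ _ \<phi>E] by simp
  qed
qed

context cyclic_galois
begin

abbreviation "const_polys \<equiv> (\<lambda>c. [:c:]) ` K"

lemma subfield_const_polys: "subfield const_polys R"
proof -
  interpret L: field L by (rule field_from_type_algebra)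
  interpret R: ring R by (rule ring_skew_poly_ring)
  interpret h: ring_hom_ring L R "\<lambda>c. [:c:]"
    by (rule ring_hom_ringI2[OF L.ring_axioms R.ring_axioms], rule ring_hom_memI)
      (simp_all add: one_pCons)
  show ?thesis using h.img_is_subfield(2)[OF subfield_K] by simp
qed

text \<open>A common form for the code and for the remainders modulo \<open>f\<close>; its dimension
  is found one monomial at a time.\<close>

definition coeff_space :: "(nat \<Rightarrow> 'a set) \<Rightarrow> nat \<Rightarrow> 'a poly set" where
  "coeff_space S N = {p. (\<forall>i<N. coeff p i \<in> S i) \<and> (\<forall>i\<ge>N. coeff p i = 0)}"

lemma dimension_coeff_space:
  assumes "\<And>i. i < N \<Longrightarrow> ring.dimension L (d i) K (S i)"
  shows "ring.dimension R (\<Sum>i<N. d i) const_polys (coeff_space S N)"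
  using assms
proof (induction N)
  case 0
  have "coeff_space S 0 = {0}" by (auto simp: coeff_space_def intro: poly_eqI)
  then show ?case using ring.zero_dim[OF ring_skew_poly_ring, of const_polys] by simp
next
  case (Suc N)
  interpret L: ring L by (rule ring_from_type_algebra)
  interpret R: ring R by (rule ring_skew_poly_ring)
  have dN: "L.dimension (d N) K (S N)" using Suc.prems by simp
  have zero: "0 \<in> S i" if "i \<le> N" for i
    using L.space_subgroup_props(2)[OF subfield_K Suc.prems[of i]] that by simp
  have 1: "R.dimension (\<Sum>i<N. d i) const_polys (coeff_space S N)" using Suc by simp
  have 2: "R.dimension (d N) const_polys ((\<lambda>a. monom a N) ` S N)"
    by (rule dimension_image[OF L.ring_axioms R.ring_axioms subfield_K dN])
      (auto simp: add_monom smult_monom inj_on_def)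
  have "coeff_space S N \<inter> (\<lambda>a. monom a N) ` S N = {0}"
  proof (rule equalityI; rule subsetI)
    fix p assume "p \<in> coeff_space S N \<inter> (\<lambda>a. monom a N) ` S N"
    then obtain a where "p = monom a N" "coeff p N = 0" by (auto simp: coeff_space_def)
    then show "p \<in> {0}" by simp
  next
    fix p :: "'a poly" assume "p \<in> {0}"
    then show "p \<in> coeff_space S N \<inter> (\<lambda>a. monom a N) ` S N"
      using zero by (auto simp: coeff_space_def intro!: image_eqI[of _ _ 0])
  qed
  then have "R.dimension ((\<Sum>i<N. d i) + d N) const_polys
      (coeff_space S N <+>\<^bsub>R\<^esub> (\<lambda>a. monom a N) ` S N)"
    using R.dimension_direct_sum_space[OF subfield_const_polys 1 2] by simp
  moreover have "coeff_space S N <+>\<^bsub>R\<^esub> (\<lambda>a. monom a N) ` S N = coeff_space S (Suc N)"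
  proof (rule equalityI; rule subsetI)
    fix p assume "p \<in> coeff_space S N <+>\<^bsub>R\<^esub> (\<lambda>a. monom a N) ` S N"
    then obtain q a where "p = q + monom a N" "q \<in> coeff_space S N" "a \<in> S N"
      unfolding set_add_def' by auto
    then show "p \<in> coeff_space S (Suc N)" by (auto simp: coeff_space_def less_Suc_eq)
  next
    fix p assume p: "p \<in> coeff_space S (Suc N)"
    define q where "q = p - monom (coeff p N) N"
    have "q \<in> coeff_space S N" using p by (auto simp: coeff_space_def q_def less_Suc_eq_le)
    moreover have "coeff p N \<in> S N" using p by (simp add: coeff_space_def)
    moreover have "p = q + monom (coeff p N) N" by (simp add: q_def)
    ultimately show "p \<in> coeff_space S N <+>\<^bsub>R\<^esub> (\<lambda>a. monom a N) ` S N"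
      unfolding set_add_def' by auto
  qed
  ultimately show ?case by simp
qed

lemma dimension_degree_less:
  assumes "0 < N"
  shows "ring.dimension R (n * N) const_polys {p. degree p < N}"
proof -
  have "coeff_space (\<lambda>i. UNIV) N = {p. degree p < N}"
  proof (rule equalityI; rule subsetI)
    fix p :: "'a poly" assume p: "p \<in> coeff_space (\<lambda>i. UNIV) N"
    have "degree p \<le> N - 1" by (rule degree_le) (use p in \<open>simp add: coeff_space_def\<close>)
    then show "p \<in> {p. degree p < N}" using assms by simp
  qed (auto simp: coeff_space_def coeff_eq_0)
  then show ?thesis
    using dimension_coeff_space[of N "\<lambda>i. n" "\<lambda>i. UNIV"] dimension_L by (simp add: mult.commute)
qed

end

context central_factor_basis
begin

lemma const_skew_E: "k \<in> K \<Longrightarrow> rem ([:k:] \<star> x) = smult k (rem x)"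
  by (simp add: skew_rem_smult[OF deg_f])

lemma rem_0 [simp]: "rem 0 = 0"
  by (rule skew_rem_small) (simp add: deg_f)

text \<open>\<open>R/Rf\<close>, represented by the polynomials of degree below
  \<open>degree f\<close>, is counted twice: by coefficients, and as the direct sum of
  \<open>m\<close> copies of the eigenring given by the basis.\<close>

lemma eigenring_dimension:
  "\<exists>e. ring.dimension E e const_polys (carrier E) \<and> m * e = n * degree f"
proof -
  interpret R: ring R by (rule ring_skew_poly_ring)
  let ?V = "{p :: 'a poly. degree p < degree f}"
  have V: "R.dimension (n * degree f) const_polys ?V" by (rule dimension_degree_less[OF deg_f])
  have "subalgebra const_polys (carrier E) R"
    unfolding subalgebra_def subalgebra_axioms_def
  proof (intro conjI allI impI)
    show "subgroup (carrier E) (add_monoid R)"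
    proof (rule R.add.subgroupI)
      fix a assume "a \<in> carrier E"
      moreover have "\<ominus>\<^bsub>R\<^esub> a = - a" using R.add.inv_equality[of "- a" a] by simp
      ultimately show "\<ominus>\<^bsub>R\<^esub> a \<in> carrier E" by (simp add: E_closed)
    next
      show "carrier E \<noteq> {}" using E_closed(1) by blast
    qed (simp_all add: E_closed)
    fix k x assume "k \<in> const_polys" "x \<in> carrier E"
    then obtain c where c: "k = [:c:]" "c \<in> K" by blast
    have "rem ([:c:] \<star> x) \<in> carrier E" using E_closed(6)[OF const_in_E[OF c(2)] \<open>x \<in> carrier E\<close>] .
    moreover have "rem ([:c:] \<star> x) = [:c:] \<star> x"
      using \<open>x \<in> carrier E\<close> unfolding const_skew_E[OF c(2)] by (simp add: carrier_eigenring skew_rem_small)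
    ultimately show "k \<otimes>\<^bsub>R\<^esub> x \<in> carrier E" using c by simp
  qed
  moreover have "carrier E \<subseteq> ?V" by (auto simp: carrier_eigenring)
  ultimately have "R.finite_dimension const_polys (carrier E)"
    using R.subalbegra_incl_imp_finite_dimension[OF subfield_const_polys R.finite_dimensionI[OF V]] by blast
  then obtain e where e: "R.dimension e const_polys (carrier E)" unfolding R.finite_dimension_def by blast
  have indep: "rdvd f (c i)" if "\<And>i. i < m \<Longrightarrow> c i \<in> idealizer f" "rdvd f (lin_comb c)" "i < m" for c i
    using basis[unfolded independent_mod_def, THEN spec, of c] that by (simp add: lin_comb_def)
  define W where "W j = {rem (\<Sum>i<j. v i \<star> c i) |c. \<forall>i<j. c i \<in> carrier E}" for j
  have col: "R.dimension e const_polys ((\<lambda>c. rem (v j \<star> c)) ` carrier E)" if j: "j < m" for j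
  proof -
    have "R.dimension e (id ` const_polys) ((\<lambda>c. rem (v j \<star> c)) ` carrier E)"
    proof (rule dimension_image[OF R.ring_axioms R.ring_axioms subfield_const_polys e])
      fix k x assume "k \<in> const_polys"
      then obtain c where c: "k = [:c:]" "c \<in> K" by blast
      have "v j \<star> ([:c:] \<star> x) = smult c (v j \<star> x)"
        by (simp only: skew_assoc[symmetric] const_central[OF c(2)] smult_skew)
      then show "rem (v j \<star> (k \<otimes>\<^bsub>R\<^esub> x)) = id k \<otimes>\<^bsub>R\<^esub> rem (v j \<star> x)"
        by (simp add: c skew_rem_smult[OF deg_f] del: const_skew) simp
    next
      show "inj_on (\<lambda>c. rem (v j \<star> c)) (carrier E)"
      proof (rule inj_onI)
        fix c c' assume c: "c \<in> carrier E" "c' \<in> carrier E" and eq: "rem (v j \<star> c) = rem (v j \<star> c')"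
        have "rdvd f ((v j \<star> c - rem (v j \<star> c)) - (v j \<star> c' - rem (v j \<star> c')))"
          by (intro rdvd_diff skew_rem_f)
        then have "rdvd f (v j \<star> (c - c'))" by (simp add: eq skew_diff)
        then have "rdvd f (lin_comb (\<lambda>i. if i = j then c - c' else 0))"
          unfolding lin_comb_single[OF j] .
        from indep[OF _ this j] c have "rdvd f (c - c')"
          by (simp add: carrier_eigenring idealizer_diff)
        moreover have "c - c' \<in> carrier E" using c by (rule E_closed)
        ultimately show "c = c'" using carrier_eigenring_rdvd by fastforce
      qed
    qed (simp_all add: skew_add skew_rem_add[OF deg_f] rem_0)
    then show ?thesis by simp
  qed
  have "R.dimension (j * e) const_polys (W j)" if "j \<le> m" for j
    using that
  proof (induction j)
    case 0
    have "W 0 = {0}" using deg_f by (simp add: W_def skew_rem_small)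
    then show ?case using R.zero_dim[of const_polys] by simp
  next
    case (Suc j)
    let ?C = "(\<lambda>c. rem (v j \<star> c)) ` carrier E"
    have 1: "R.dimension (j * e) const_polys (W j)" using Suc by simp
    have j: "j < m" using Suc.prems by simp
    have zero: "0 \<in> W j" "0 \<in> ?C"
      using R.space_subgroup_props(2)[OF subfield_const_polys 1]
        R.space_subgroup_props(2)[OF subfield_const_polys col[OF j]] by simp_all
    have "W j \<inter> ?C = {0}"
    proof (rule equalityI; rule subsetI)
      fix p assume p: "p \<in> W j \<inter> ?C"
      obtain c where c: "\<forall>i<j. c i \<in> carrier E" "p = rem (\<Sum>i<j. v i \<star> c i)"
        using p unfolding W_def by blast
      obtain x where x: "x \<in> carrier E" "p = rem (v j \<star> x)" using p by blast
      \<comment> \<open>The difference of the two expressions for \<open>p\<close>, as a relation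
        among the basis elements; its entry \<open>- x\<close> at \<open>j\<close> forces
        \<open>x = 0\<close>.\<close>
      define c' where "c' i = (if i < j then c i else if i = j then - x else 0)" for i
      have "lin_comb c' = (\<Sum>i<Suc j. v i \<star> c' i)"
        unfolding lin_comb_def using Suc.prems by (intro sum.mono_neutral_right) (auto simp: c'_def)
      also have "\<dots> = (\<Sum>i<j. v i \<star> c i) - v j \<star> x" by (simp add: c'_def skew_minus)
      finally have lc: "lin_comb c' = (\<Sum>i<j. v i \<star> c i) - v j \<star> x" .
      have "rdvd f ((\<Sum>i<j. v i \<star> c i) - p)" unfolding c(2) by (rule skew_rem_f)
      moreover have "rdvd f (v j \<star> x - p)" unfolding x(2) by (rule skew_rem_f)
      ultimately have "rdvd f (((\<Sum>i<j. v i \<star> c i) - p) - (v j \<star> x - p))" by (rule rdvd_diff)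
      then have "rdvd f (lin_comb c')" by (simp add: lc)
      moreover have "c' i \<in> idealizer f" for i
        using c(1) x(1) by (auto simp: c'_def carrier_eigenring idealizer_minus)
      ultimately have "rdvd f (c' j)" using indep[of c' j] j by blast
      then have "rdvd f x" using rdvd_minus[of f "- x"] by (simp add: c'_def)
      then have "x = 0" using carrier_eigenring_rdvd x(1) by blast
      then show "p \<in> {0}" using x(2) deg_f by (simp add: skew_rem_small)
    qed (use zero in blast)
    then have "R.dimension (j * e + e) const_polys (W j <+>\<^bsub>R\<^esub> ?C)"
      using R.dimension_direct_sum_space[OF subfield_const_polys 1 col[OF j]] by simp
    moreover have "W j <+>\<^bsub>R\<^esub> ?C = W (Suc j)"
    proof (rule equalityI; rule subsetI)
      fix p assume "p \<in> W j <+>\<^bsub>R\<^esub> ?C"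
      then obtain w x where wx: "w \<in> W j" "x \<in> carrier E" "p = w + rem (v j \<star> x)"
        unfolding set_add_def' by auto
      then obtain c where c: "\<forall>i<j. c i \<in> carrier E" "x \<in> carrier E"
        "p = rem (\<Sum>i<j. v i \<star> c i) + rem (v j \<star> x)"
        unfolding W_def by blast
      have "p = rem (\<Sum>i<Suc j. v i \<star> (c(j := x)) i)"
        using c(3) by (simp add: skew_rem_add[OF deg_f])
      moreover have "\<forall>i<Suc j. (c(j := x)) i \<in> carrier E" using c by (simp add: less_Suc_eq)
      ultimately show "p \<in> W (Suc j)" unfolding W_def by blast
    next
      fix p assume "p \<in> W (Suc j)"
      then obtain c where c: "\<forall>i<Suc j. c i \<in> carrier E" "p = rem (\<Sum>i<Suc j. v i \<star> c i)"
        unfolding W_def by blast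
      then have "p = rem (\<Sum>i<j. v i \<star> c i) + rem (v j \<star> c j)" by (simp add: skew_rem_add[OF deg_f])
      moreover have "rem (\<Sum>i<j. v i \<star> c i) \<in> W j" using c(1) unfolding W_def by auto
      moreover have "rem (v j \<star> c j) \<in> ?C" using c(1) by auto
      ultimately show "p \<in> W j <+>\<^bsub>R\<^esub> ?C" unfolding set_add_def' skew_poly_ring_simps by blast
    qed
    ultimately show ?case by (simp add: add.commute)
  qed
  then have "R.dimension (m * e) const_polys (W m)" by simp
  moreover have "W m = ?V"
  proof (rule equalityI; rule subsetI)
    fix p assume "p \<in> W m"
    then show "p \<in> ?V" unfolding W_def using skew_rem_f(1) by auto
  next
    fix p assume p: "p \<in> ?V"
    obtain c where c: "\<forall>i<m. c i \<in> carrier E" "rdvd f (p - lin_comb c)" using coordinates_exist by blast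
    have "rem (lin_comb c) = rem p" using skew_rem_cong[OF deg_f c(2)] by simp
    also have "\<dots> = p" using p by (simp add: skew_rem_small)
    finally show "p \<in> W m" unfolding W_def lin_comb_def using c(1) by blast
  qed
  ultimately have "m * e = n * degree f" using R.dimension_is_inj[OF subfield_const_polys _ V] by simp
  \<comment> \<open>Up to here the eigenring was measured inside \<open>R\<close>. Constants from
    \<open>K\<close> multiply reduced representatives without a further reduction, so the identity
    carries the dimension over.\<close>
  moreover have "ring.dimension E e (id ` const_polys) (id ` carrier E)"
  proof (rule dimension_image[OF R.ring_axioms ring_E subfield_const_polys e])
    fix k x assume "k \<in> const_polys" "x \<in> carrier E"
    then obtain c where c: "k = [:c:]" "c \<in> K" by blast
    show "id (k \<otimes>\<^bsub>R\<^esub> x) = id k \<otimes>\<^bsub>E\<^esub> id x"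
      using \<open>x \<in> carrier E\<close> const_skew_E[OF c(2), of x] by (simp add: c carrier_eigenring skew_rem_small)
  qed simp_all
  ultimately show ?thesis by auto
qed

lemma ring_hom_matrix_of: "ring_hom_ring R M matrix_of"
  by (rule ring_hom_ringI2[OF ring_skew_poly_ring ring_M], rule ring_hom_memI)
    (simp_all add: matrix_of_carrier matrix_of_mult matrix_of_add matrix_of_one)

lemma ring_quotient: "ring (skew_quotient \<sigma> H)"
  unfolding skew_quotient_def by (rule ideal.quotient_is_ring[OF ideal_H])

lemma ring_hom_skew_class: "ring_hom_ring R (skew_quotient \<sigma> H) (skew_class \<sigma> H)"
  by (rule ring_hom_ringI2[OF ring_skew_poly_ring ring_quotient], rule ring_hom_memI)
    (simp_all add: quotient_simps)

lemma not_rdvd_H_1: "\<not> rdvd H 1"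
  using rdvd_trans[OF f_rdvd, of 1] skew_irreducible_not_rdvd_1[OF f] by blast

lemma scalars_eq: "scalar_mat E m ` const_polys = matrix_of ` const_polys"
  unfolding image_image by (rule image_cong) (simp_all add: matrix_of_scalar)

text \<open>Distinct polynomials of degree below \<open>degree H\<close> stay distinct modulo
  \<open>H\<close>. This serves both \<open>matrix_of\<close> and \<open>skew_class\<close>.\<close>

lemma ring_hom_image_of_small:
  assumes "ring_hom_ring R S h" "\<one>\<^bsub>S\<^esub> \<noteq> \<zero>\<^bsub>S\<^esub>"
    and dim: "ring.dimension R d const_polys C" and small: "\<And>p. p \<in> C \<Longrightarrow> degree p < degree H"
    and h: "\<And>a b. h a = h b \<longleftrightarrow> rdvd H (a - b)"
  shows "ring.dimension S d (h ` const_polys) (h ` C)" and "subalgebra (h ` const_polys) (h ` C) S"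
proof -
  interpret h: ring_hom_ring R S h by (rule assms(1))
  show d: "ring.dimension S d (h ` const_polys) (h ` C)"
  proof (rule dimension_image[OF h.R.ring_axioms h.S.ring_axioms subfield_const_polys dim])
    show "inj_on h C"
    proof (rule inj_onI)
      fix a b assume "a \<in> C" "b \<in> C" "h a = h b"
      then show "a = b" using h[of a b] small degree_diff_less[of a "degree H" b] rdvd_small[of H "a - b"] by simp
    qed
  qed (auto simp del: skew_poly_ring_simps simp: skew_poly_ring_simps(1))
  have "subfield (h ` const_polys) S" using h.img_is_subfield(2)[OF subfield_const_polys assms(2)] .
  then show "subalgebra (h ` const_polys) (h ` C) S"
    using h.S.finite_dimension_imp_subalgebra[OF _ h.S.finite_dimensionI[OF d]] by blast
qed

end

section \<open>The code\<close>

lemma code_polys_coeffs: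
  fixes \<gamma> :: "'a::field"
  assumes "0 < N"
  shows "p \<in> code_polys L' \<gamma> N \<longleftrightarrow>
    coeff p 0 \<in> L' \<and> coeff p N \<in> (*) \<gamma> ` L' \<and> (\<forall>i>N. coeff p i = 0)"
proof -
  have cf: "coeff (monom a0 0 + (\<Sum>i=1..<N. monom (a i) i) + monom (\<gamma> * b0) N) k
    = (if k = 0 then a0 else if k < N then a k else if k = N then \<gamma> * b0 else 0)" for a0 a b0 k
  proof -
    have "coeff (\<Sum>i=1..<N. monom (a i) i) k = (\<Sum>i\<in>{1..<N}. if i = k then a k else 0)"
      unfolding coeff_sum by (intro sum.cong) auto
    also have "\<dots> = (if k \<in> {1..<N} then a k else 0)" by simp
    finally show ?thesis using assms by (auto simp: not_less)
  qed
  show ?thesis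
  proof
    assume "p \<in> code_polys L' \<gamma> N"
    then obtain a0 a b0 where p: "p = monom a0 0 + (\<Sum>i=1..<N. monom (a i) i)
        + monom (\<gamma> * b0) N" "a0 \<in> L'" "b0 \<in> L'"
      unfolding code_polys_def by blast
    then show "coeff p 0 \<in> L' \<and> coeff p N \<in> (*) \<gamma> ` L' \<and> (\<forall>i>N. coeff p i = 0)"
      unfolding p(1) cf using assms by auto
  next
    assume c: "coeff p 0 \<in> L' \<and> coeff p N \<in> (*) \<gamma> ` L' \<and> (\<forall>i>N. coeff p i = 0)"
    then obtain b0 where b0: "coeff p N = \<gamma> * b0" "b0 \<in> L'" by blast
    have "p = monom (coeff p 0) 0 + (\<Sum>i=1..<N. monom (coeff p i) i)
        + monom (\<gamma> * b0) N"
      by (rule poly_eqI) (use c b0 in \<open>simp only: cf; auto simp: not_less\<close>)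
    then show "p \<in> code_polys L' \<gamma> N" unfolding code_polys_def using c b0(2) by blast
  qed
qed

context cyclic_galois
begin

lemma K_irreducible_of_ring_irreducible:
  assumes F: "F \<in> carrier (poly_ring_over K)" "lead_coeff F = 1"
    and irr: "ring_irreducible\<^bsub>poly_ring_over K\<^esub> F" and "F \<noteq> [:0, 1:]"
  shows "K_irreducible F"
proof -
  let ?P = "poly_ring_over K"
  have car: "p \<in> carrier ?P \<longleftrightarrow> K_poly p" for p by (simp add: poly_ring_over_def K_poly_def)
  have mult: "p \<otimes>\<^bsub>?P\<^esub> q = p * q" and one: "\<one>\<^bsub>?P\<^esub> = 1" for p q
    by (simp_all add: poly_ring_over_def ring_of_type_algebra_def)
  have K1: "K_poly 1" unfolding K_poly_iff by simp
  have nu: "F \<notin> Units ?P" and "\<forall>b\<in>carrier ?P. properfactor ?P b F \<longrightarrow> b \<in> Units ?P"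
    using irr unfolding ring_irreducible_def Divisibility.irreducible_def by blast+
  then have pf: "\<And>b. K_poly b \<Longrightarrow> properfactor ?P b F \<Longrightarrow> b \<in> Units ?P" using car by blast
  have F0: "F \<noteq> 0" using F(2) by auto
  have fac: "degree a = 0 \<or> degree b = 0" if a: "K_poly a" and b: "K_poly b" and ab: "F = a * b" for a b
  proof (cases "\<exists>c. K_poly c \<and> a = F * c")
    case True
    then obtain c where c: "a = F * c" by blast
    have nz: "a \<noteq> 0" "b \<noteq> 0" using ab F0 by auto
    then have "c \<noteq> 0" using c by auto
    have "degree F = degree a + degree b" unfolding ab using nz by (rule degree_mult_eq)
    moreover have "degree a = degree F + degree c" unfolding c using F0 \<open>c \<noteq> 0\<close> by (rule degree_mult_eq)
    ultimately show ?thesis by simp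
  next
    case False
    then have "properfactor ?P a F"
      unfolding properfactor_def factor_def mult Bex_def car using b ab by blast
    from pf[OF a this] obtain c where "a * c = 1" unfolding Units_def mult one by blast
    moreover from this have "a \<noteq> 0" "c \<noteq> 0" by auto
    ultimately have "degree a + degree c = 0" using degree_mult_eq[of a c] by simp
    then show ?thesis by simp
  qed
  have dF: "0 < degree F"
  proof (rule ccontr)
    assume "\<not> 0 < degree F"
    then obtain c where "F = [:c:]" by (metis degree_eq_zeroE not_gr_zero)
    then have "F = 1" using F(2) by (simp add: one_pCons)
    moreover have "1 \<in> Units ?P" unfolding Units_def mult one mem_Collect_eq using K1 car[of 1] by auto
    ultimately show False using nu by simp
  qed
  \<comment> \<open>Otherwise \<open>y\<close> splits off, and irreducibility together with being
    monic makes \<open>F\<close> equal to \<open>y\<close>.\<close>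
  have "coeff F 0 \<noteq> 0"
  proof
    assume z: "coeff F 0 = 0"
    obtain q where q: "F = pCons 0 q" using z by (cases F) auto
    then have e: "F = [:0, 1:] * q" by simp
    have "K_poly [:0, 1:]" unfolding K_poly_iff by simp
    moreover have "K_poly q"
    proof -
      have "coeff q i = coeff F (Suc i)" for i unfolding q by simp
      then show ?thesis using F(1) by (simp add: car K_poly_def)
    qed
    ultimately have "degree q = 0" using fac[OF _ _ e] by simp
    then obtain c where "q = [:c:]" by (metis degree_eq_zeroE)
    then have "F = [:0, 1:]" using F(2) q by (auto split: if_splits)
    with assms(4) show False by simp
  qed
  then show ?thesis unfolding K_irreducible_def using F dF fac car by blast
qed

text \<open>The norm formula is applied to the monic multiple \<open>b\<close> of \<open>a\<close>.
  The constant coefficient of \<open>a\<close> and \<beta> lie in \<open>L'\<close>, so their norms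
  are squares, and the expression is a quotient of two squares.\<close>

lemma right_divisor_contradiction:
  assumes F: "K_irreducible F" and n: "n = 2 * t"
    and L': "subfield L' L" "K \<subseteq> L'"
      "ring.dimension L 2 L' UNIV"
    and a: "coeff a 0 \<in> L'" "coeff a N \<in> (*) \<gamma> ` L'" "degree a = N" "0 < N" "rdvd a (in_xn F)"
    and N: "N = degree F * j"
  shows "\<exists>c\<in>K. (- 1) ^ N * coeff (in_xn F) 0 ^ j * field_norm K \<gamma> = c ^ 2"
proof -
  obtain \<beta> where \<beta>: "\<beta> \<in> L'" "coeff a N = \<gamma> * \<beta>" using a(2) by blast
  have lc: "lead_coeff a = \<gamma> * \<beta>" using \<beta> a(3) by simp
  have nz: "\<gamma> * \<beta> \<noteq> 0" unfolding lc[symmetric] using a(3,4) by auto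
  then have \<gamma>0: "\<gamma> \<noteq> 0" and \<beta>0: "\<beta> \<noteq> 0" by auto
  define b where "b = smult (inverse (\<gamma> * \<beta>)) a"
  have lb: "lead_coeff b = 1" unfolding b_def lead_coeff_smult lc by (rule left_inverse[OF nz])
  have db: "degree b = N" unfolding b_def using nz a(3) by simp
  have ab: "a = [:\<gamma> * \<beta>:] \<star> b"
    using right_inverse[OF nz] by (simp add: b_def del: inverse_mult_distrib)
  then have "rdvd b a" unfolding rdvd_def by blast
  then have "rdvd b (in_xn F)" using a(5) by (rule rdvd_trans)
  from field_norm_right_divisor[OF F lb _ this] obtain i where i: "N = degree F * i"
    "field_norm K ((- 1) ^ N * coeff b 0) = (- 1) ^ N * coeff F 0 ^ i"
    unfolding db using a(4) by blast
  have "0 < degree F" using F by (simp add: K_irreducible_def)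
  then have ij: "i = j" using i(1) N by simp
  have "even n" using n by simp
  \<comment> \<open>Since \<open>n\<close> is even, the norm ignores this sign.\<close>
  have "(- 1) ^ N * coeff b 0 = coeff b 0 \<or> (- 1) ^ N * coeff b 0 = - coeff b 0"
    by (cases "even N") simp_all
  then have nb: "field_norm K (coeff b 0) = (- 1) ^ N * coeff F 0 ^ j"
    using i(2) field_norm_minus[OF \<open>even n\<close>] ij by auto
  have "coeff a 0 = coeff ([:\<gamma> * \<beta>:] \<star> b) 0" by (subst ab) (rule refl)
  then have "coeff a 0 = (\<gamma> * \<beta>) * coeff b 0" by simp
  then have na: "field_norm K (coeff a 0) = field_norm K \<gamma> * field_norm K \<beta> * ((- 1) ^ N * coeff F 0 ^ j)"
    by (simp add: field_norm_mult nb)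
  obtain c1 where c1: "c1 \<in> K" "field_norm K (coeff a 0) = c1 ^ 2"
    using norm_square[OF n L' a(1)] by blast
  obtain c2 where c2: "c2 \<in> K" "field_norm K \<beta> = c2 ^ 2"
    using norm_square[OF n L' \<beta>(1)] by blast
  have "c2 \<noteq> 0" using c2(2) \<beta>0 field_norm_eq_0_iff[of \<beta>] by auto
  have "c1 ^ 2 = ((- 1) ^ N * coeff F 0 ^ j * field_norm K \<gamma>) * c2 ^ 2"
    using na unfolding c1(2) c2(2) by simp
  then have "(- 1) ^ N * coeff F 0 ^ j * field_norm K \<gamma> = (c1 * inverse c2) ^ 2"
    using \<open>c2 \<noteq> 0\<close> by (simp add: power_mult_distrib power_inverse field_simps)
  moreover have "c1 * inverse c2 \<in> K" using c1(1) c2(1) subfield_type_closed(4,7)[OF subfield_K] by blast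
  ultimately show ?thesis unfolding coeff_0_in_xn by blast
qed

text \<open>The constant and the top coefficient range over spaces of dimension \<open>t\<close>,
  half of \<open>n\<close>, and together count as one full coefficient.\<close>

lemma dimension_code_polys:
  assumes n: "n = 2 * t" and L': "subfield L' L" "K \<subseteq> L'"
      "ring.dimension L 2 L' UNIV"
    and "0 < N" "\<gamma> \<noteq> 0"
  shows "ring.dimension R (n * N) const_polys (code_polys L' \<gamma> N)"
proof -
  interpret L: ring L by (rule ring_from_type_algebra)
  have dL': "L.dimension t K L'" by (rule dimension_intermediate[OF n L'])
  have "L.dimension t (id ` K) ((*) \<gamma> ` L')"
    by (rule dimension_image[OF L.ring_axioms L.ring_axioms subfield_K dL'])
      (use \<open>\<gamma> \<noteq> 0\<close> in \<open>auto simp: distrib_left inj_on_def\<close>)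
  then have dg: "L.dimension t K ((*) \<gamma> ` L')" by simp
  define S where "S i = (if i = 0 then L' else if i = N then (*) \<gamma> ` L' else UNIV)" for i
  define d where "d i = (if i = 0 then t else if i = N then t else n)" for i :: nat
  have "ring.dimension R (\<Sum>i<Suc N. d i) const_polys (coeff_space S (Suc N))"
    by (rule dimension_coeff_space) (simp add: S_def d_def dL' dg dimension_L)
  moreover have "(\<Sum>i<Suc N. d i) = n * N"
  proof -
    obtain M where M: "N = Suc M" using \<open>0 < N\<close> gr0_conv_Suc by blast
    have "(\<Sum>i<Suc N. d i) = d 0 + (\<Sum>i<M. d (Suc i)) + d N"
      unfolding M by (simp only: sum.lessThan_Suc[of d "Suc M"] sum.lessThan_Suc_shift[of d M])
    also have "(\<Sum>i<M. d (Suc i)) = n * M" by (simp add: d_def M)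
    finally show ?thesis using n M by (simp add: d_def)
  qed
  moreover have "coeff_space S (Suc N) = code_polys L' \<gamma> N"
  proof (rule Set.set_eqI)
    fix p
    show "p \<in> coeff_space S (Suc N) \<longleftrightarrow> p \<in> code_polys L' \<gamma> N"
      unfolding code_polys_coeffs[OF \<open>0 < N\<close>] coeff_space_def mem_Collect_eq
      using \<open>0 < N\<close> by (auto simp: S_def less_Suc_eq Suc_le_eq)
  qed
  ultimately show ?thesis by simp
qed

end

context central_factor_basis
begin

lemma minimum_distance:
  assumes n: "n = 2 * t"
    and L': "subfield L' L" "K \<subseteq> L'"
      "ring.dimension L 2 L' UNIV"
    and k: "0 < k" "k < m" and N: "N = k * degree f"
    and nonsquare: "\<not> (\<exists>c\<in>K. (- 1) ^ N * coeff H 0 ^ (k * (n div m)) * field_norm K \<gamma> = c ^ 2)"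
  shows "has_min_distance E m (matrix_of ` code_polys L' \<gamma> N) (m - k + 1)"
proof -
  have N0: "0 < N" using k(1) deg_f unfolding N by simp
  have NH: "N < degree H" unfolding N degree_H using k(2) deg_f by simp
  have lower: "m - k + 1 \<le> mat_rank E m (matrix_of a)" if a: "a \<in> code_polys L' \<gamma> N" "a \<noteq> 0" for a
  proof (rule ccontr)
    assume *: "\<not> m - k + 1 \<le> mat_rank E m (matrix_of a)"
    note c = a(1)[unfolded code_polys_coeffs[OF N0]]
    have da: "degree a \<le> N" using c by (intro degree_le) blast
    define r where "r = m - mat_rank E m (matrix_of a)"
    \<comment> \<open>The degree of a codeword leaves no room above \<open>k * degree f\<close>, so
      \<open>r \<ge> k\<close> leads to the case of equality.\<close>
    have "k \<le> r" using * k(2) unfolding r_def by linarith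
    have rb: "r * degree f \<le> degree a" using rank_degree_bound(1)[OF a(2)] unfolding r_def .
    have "k * degree f \<le> r * degree f" using \<open>k \<le> r\<close> by simp
    then have eq: "degree a = N" "r * degree f = degree a" using da rb unfolding N by linarith+
    have "rdvd a H" using rank_degree_bound(2)[OF a(2)] eq(2) unfolding r_def by blast
    moreover have "N = degree F * (k * (n div m))" unfolding N using degree_f(2) by (simp add: mult_ac)
    ultimately show False
      using right_divisor_contradiction[OF F n L' _ _ eq(1) N0] c nonsquare by blast
  qed
  \<comment> \<open>With \<open>k - 1\<close> basis elements killed, the rank is at most
    \<open>m - k + 1\<close> and the degree stays below \<open>N\<close>.\<close>
  have "k - 1 \<le> m" using k by simp
  then obtain g where g: "lead_coeff g = 1" "degree g = (k - 1) * degree f" "rdvd g H"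
    "\<And>c. mat_rank E m (matrix_of (smult c g)) \<le> m - (k - 1)"
    using small_annihilator by blast
  obtain q where q: "H = q \<star> g" using g(3) unfolding rdvd_def by blast
  have "coeff H 0 \<noteq> 0" using F by (simp add: coeff_0_in_xn K_irreducible_def)
  then have g0: "coeff g 0 \<noteq> 0" unfolding q coeff_0_skew by auto
  \<comment> \<open>The constant coefficient of a codeword must lie in \<open>L'\<close>; scaling
    makes it 1.\<close>
  define a where "a = smult (inverse (coeff g 0)) g"
  have "degree g < N" unfolding g(2) N using k(1) deg_f by simp
  then have small: "degree a < N" using g0 by (simp add: a_def)
  have a0: "coeff a 0 = 1" using g0 by (simp add: a_def)
  then have "a \<noteq> 0" by auto
  have "coeff a 0 \<in> L'" unfolding a0 by (rule subfield_type_closed(2)[OF L'(1)])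
  moreover have "coeff a N = \<gamma> * 0" using small by (simp add: coeff_eq_0)
  then have "coeff a N \<in> (*) \<gamma> ` L'" using subfield_type_closed(1)[OF L'(1)] by blast
  moreover have "\<forall>i>N. coeff a i = 0" using small by (simp add: coeff_eq_0)
  ultimately have aC: "a \<in> code_polys L' \<gamma> N" unfolding code_polys_coeffs[OF N0] by blast
  have nonzero: "matrix_of a \<noteq> \<zero>\<^bsub>M\<^esub>"
    unfolding matrix_of_0[symmetric] matrix_of_eq_iff using rdvd_small[of H a] small NH \<open>a \<noteq> 0\<close> by auto
  have "mat_rank E m (matrix_of a) \<le> m - k + 1" using g(4)[of "inverse (coeff g 0)"] k unfolding a_def by simp
  then have "mat_rank E m (matrix_of a) = m - k + 1" using lower[OF aC \<open>a \<noteq> 0\<close>] by simp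
  moreover have "m - k + 1 \<le> mat_rank E m A" if "A \<in> matrix_of ` code_polys L' \<gamma> N - {\<zero>\<^bsub>M\<^esub>}" for A
  proof -
    obtain b where b: "A = matrix_of b" "b \<in> code_polys L' \<gamma> N" "A \<noteq> \<zero>\<^bsub>M\<^esub>" using \<open>A \<in> _\<close> by blast
    then have "b \<noteq> 0" using matrix_of_0 by auto
    then show ?thesis using lower b by simp
  qed
  ultimately show ?thesis unfolding has_min_distance_def using aC nonzero by blast
qed

lemma code_is_MRD:
  assumes n: "n = 2 * t"
    and L': "subfield L' L" "K \<subseteq> L'"
      "ring.dimension L 2 L' UNIV"
    and k: "0 < k" "k < m" and N: "N = k * degree f" and \<gamma>: "\<gamma> \<noteq> 0"
    and nonsquare: "\<not> (\<exists>c\<in>K. (- 1) ^ N * coeff H 0 ^ (k * (n div m)) * field_norm K \<gamma> = c ^ 2)"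
  shows "linear_MRD_code const_polys E m (m - k + 1) (matrix_of ` code_polys L' \<gamma> N)"
    and "subalgebra (skew_class \<sigma> H ` const_polys) (skew_class \<sigma> H ` code_polys L' \<gamma> N) (skew_quotient \<sigma> H)"
proof -
  have N0: "0 < N" using k(1) deg_f unfolding N by simp
  have NH: "N < degree H" unfolding N degree_H using k(2) deg_f by simp
  let ?C = "code_polys L' \<gamma> N"
  have dim: "ring.dimension R (n * N) const_polys ?C" by (rule dimension_code_polys[OF n L' N0 \<gamma>])
  have small: "degree p < degree H" if "p \<in> ?C" for p
  proof -
    have "degree p \<le> N" using that unfolding code_polys_coeffs[OF N0] by (intro degree_le) blast
    then show ?thesis using NH by simp
  qed
  have "\<one>\<^bsub>M\<^esub> \<noteq> \<zero>\<^bsub>M\<^esub>"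
    unfolding matrix_of_0[symmetric] matrix_of_one[symmetric] matrix_of_eq_iff using not_rdvd_H_1 by simp
  note im = ring_hom_image_of_small[OF ring_hom_matrix_of this dim small matrix_of_eq_iff]
  obtain e where e: "ring.dimension E e const_polys (carrier E)" "m * e = n * degree f"
    using eigenring_dimension by blast
  \<comment> \<open>At distance \<open>m - k + 1\<close> the Singleton-type bound is
    \<open>m * k * e\<close>, which equals the dimension \<open>n * N\<close> of the code.\<close>
  have "m * (m - (m - k + 1) + 1) * e = k * (m * e)" using k by simp
  also have "\<dots> = n * N" unfolding e(2) N by simp
  finally have "ring.dimension M (m * (m - (m - k + 1) + 1) * e) (scalar_mat E m ` const_polys) (matrix_of ` ?C)"
    using im(1) by (simp only: scalars_eq)
  moreover have "matrix_of ` ?C \<subseteq> carrier M" using matrix_of_carrier by blast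
  ultimately show "linear_MRD_code const_polys E m (m - k + 1) (matrix_of ` ?C)"
    unfolding linear_MRD_code_def using im(2) minimum_distance[OF n L' k N nonsquare] e(1)
    by (simp only: scalars_eq) blast
  have "\<one>\<^bsub>skew_quotient \<sigma> H\<^esub> \<noteq> \<zero>\<^bsub>skew_quotient \<sigma> H\<^esub>"
    unfolding quotient_simps skew_class_eq_iff using not_rdvd_H_1 by simp
  from ring_hom_image_of_small(2)[OF ring_hom_skew_class this dim small skew_class_eq_iff]
  show "subalgebra (skew_class \<sigma> H ` const_polys) (skew_class \<sigma> H ` ?C) (skew_quotient \<sigma> H)" .
qed

end

theorem mainTheorem15:
  fixes K L' :: "'a::field set" and \<sigma> :: "'a \<Rightarrow> 'a"
    and n t s m l k :: nat and F f :: "'a poly" and \<gamma> :: 'a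
  assumes "cyclic_galois_extension K n \<sigma>"
    and "n = 2 * t"
    and "subfield L' (ring_of_type_algebra :: 'a ring)" and "K \<subseteq> L'"
    and "ring.dimension (ring_of_type_algebra :: 'a ring) 2 L' UNIV"
    and "F \<in> carrier (poly_ring_over K)" and "lead_coeff F = 1"
    and "ring_irreducible\<^bsub>poly_ring_over K\<^esub> F"
    and "Polynomial.degree F = s" and "F \<noteq> [:0, 1:]"
    and "has_irreducible_factorization (skew_poly_ring \<sigma>) (poly_in_xn F n) m"
    and "l = n div m"
    and "lead_coeff f = 1" and "ring_irreducible\<^bsub>skew_poly_ring \<sigma>\<^esub> f"
    and "poly_in_xn F n \<in> PIdl\<^bsub>skew_poly_ring \<sigma>\<^esub> f"
    and "f \<notin> ring_center (skew_poly_ring \<sigma>)"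
    and "0 < k" and "k < m"
    and "\<gamma> \<notin> L'"
    and "\<not> (\<exists>c\<in>K. (-1) ^ (s * k * l) * Polynomial.coeff (poly_in_xn F n) 0 ^ (k * l)
                      * field_norm K \<gamma> = c ^ 2)"
  shows "subalgebra ((\<lambda>c. skew_class \<sigma> (poly_in_xn F n) [:c:]) ` K)
           (code_D \<sigma> L' n l k \<gamma> F) (skew_quotient \<sigma> (poly_in_xn F n)) \<and>
         (\<exists>v. right_basis \<sigma> f m v) \<and>
         (\<forall>v. right_basis \<sigma> f m v \<longrightarrow>
            left_mult_matrix \<sigma> f m v
              \<in> ring_iso (skew_quotient \<sigma> (poly_in_xn F n)) (mat_ring (eigenring \<sigma> f) m) \<and>
            linear_MRD_code ((\<lambda>c. [:c:]) ` K) (eigenring \<sigma> f) m (m - k + 1)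
              (left_mult_matrix \<sigma> f m v ` code_D \<sigma> L' n l k \<gamma> F))"
proof -
  interpret cyclic_galois K n \<sigma> by unfold_locales (rule assms(1))
  have F: "K_irreducible F"
    using assms(6,7,8,10) by (rule K_irreducible_of_ring_irreducible)
  have m: "1 < m" using assms(17,18) by simp
  interpret central_factor K n \<sigma> F f m
  proof unfold_locales
    show "skew_irreducible f" by (rule ring_irreducible_imp_skew_irreducible[OF assms(14)])
    show "rdvd f (in_xn F)" using assms(15) by (simp only: mem_PIdl_iff)
  qed (use F m assms in simp_all)
  have l: "s * k * l = k * degree f" using degree_f(2) assms(9,12) by (simp add: mult_ac)
  have "\<gamma> \<noteq> 0" using assms(19) subfield_type_closed(1)[OF assms(3)] by auto
  have ns: "\<not> (\<exists>c\<in>K. (- 1) ^ (s * k * l) * coeff H 0 ^ (k * (n div m)) * field_norm K \<gamma> = c ^ 2)"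
    using assms(20) unfolding assms(12) .
  have code: "code_D \<sigma> L' n l k \<gamma> F = skew_class \<sigma> H ` code_polys L' \<gamma> (s * k * l)"
    unfolding code_D_def assms(9) ..
  \<comment> \<open>The subalgebra claim does not mention \<open>v\<close>, but it is obtained where
    a basis is at hand; the existence of a basis releases it.\<close>
  have all: "left_mult_matrix \<sigma> f m v \<in> ring_iso (skew_quotient \<sigma> H) (mat_ring E m) \<and>
      linear_MRD_code const_polys E m (m - k + 1) (left_mult_matrix \<sigma> f m v ` code_D \<sigma> L' n l k \<gamma> F) \<and>
      subalgebra ((\<lambda>c. skew_class \<sigma> H [:c:]) ` K) (code_D \<sigma> L' n l k \<gamma> F) (skew_quotient \<sigma> H)"
    if v: "right_basis \<sigma> f m v" for v
  proof -
    interpret central_factor_basis K n \<sigma> F f m v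
      by unfold_locales (use v right_basis_iff in blast)
    note mrd = code_is_MRD[OF assms(2,3,4,5,17,18) l \<open>\<gamma> \<noteq> 0\<close> ns]
    have "linear_MRD_code const_polys E m (m - k + 1) (left_mult_matrix \<sigma> f m v ` code_D \<sigma> L' n l k \<gamma> F)"
      using mrd(1) unfolding code image_image left_mult_matrix_class .
    moreover have "subalgebra ((\<lambda>c. skew_class \<sigma> H [:c:]) ` K) (code_D \<sigma> L' n l k \<gamma> F) (skew_quotient \<sigma> H)"
      using mrd(2) unfolding code image_image[of "skew_class \<sigma> H" "\<lambda>c. [:c:]"] .
    ultimately show ?thesis using left_mult_matrix_ring_iso by blast
  qed
  obtain v where "right_basis \<sigma> f m v" using independent_exists right_basis_iff by blast
  then show ?thesis using all by blast
qed

end
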